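(* Let $q\in\Omega$ be a modified cubic polynomial. Then the extended index $\mathrm{Ind}_0(q)$ is finite.
   Context: $Q$ is a complete connected Riemannian manifold with metric $\langle\cdot,\cdot\rangle$, Levi-Civita connection $\nabla$, and curvature endomorphism $R(X,Y)Z = \nabla_X\nabla_Y Z - \nabla_Y\nabla_X Z - \nabla_{[X,Y]}Z$; $\frac{D}{dt}$ is the covariant derivative along a curve. $V:Q\to\mathbb{R}$ is smooth and non-negative, with gradient $\operatorname{grad}V$. Fix $T>0$ and $\xi=(q_a,v_a)$, $\eta=(q_b,v_b)$ in $TQ$. $\Omega=\Omega^{0,T}_{\xi,\eta}$ is the set of piecewise smooth $C^1$ curves $\gamma:[0,T]\to Q$ with $\gamma(0)=q_a$, $\dot\gamma(0)=v_a$, $\gamma(T)=q_b$, $\dot\gamma(T)=v_b$. For $q\in\Omega$, $T_q\Omega$ is the space of piecewise smooth $C^1$ vector fields $X$ along $q$ with $X(0)=X(T)=0$ and $\frac{DX}{dt}(0)=\frac{DX}{dt}(T)=0$. A modified cubic polynomial is a smooth curve $q$ satisfying $\frac{D^3\dot q}{dt^3}+R\big(\frac{D\dot q}{dt},\dot q\big)\dot q+\operatorname{grad}V(q(t))=0$. $\mathring{H}^2_q$ is the completion of $T_q\Omega$ under the norm $\|X\|=\big(\int_0^T[\|X\|^2+\|\frac{DX}{dt}\|^2+\|\frac{D^2X}{dt^2}\|^2]dt\big)^{1/2}$; via a parallel orthonormal frame along $q$ it is identified with the Sobolev space $\mathring{H}^2([0,T],\mathbb{R}^n)$, $n=\dim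 Q$. Define \begin{align*} F(X,Y) &= (\nabla^2_Y R)(X,Y)Y + (\nabla_X R)(\nabla_Y Y,Y)Y + R(R(X,Y)Y,Y)Y + R(X,\nabla^2_Y Y)Y \\ &\quad + 2\big[(\nabla_Y R)(\nabla_Y X,Y)Y + (\nabla_Y R)(X,\nabla_Y Y)Y + R(\nabla^2_Y X,Y)Y\big] \\ &\quad + 3\big[(\nabla_Y R)(X,Y)\nabla_Y Y + R(X,Y)\nabla^2_Y Y + R(X,\nabla_Y Y)\nabla_Y Y\big] + 4R(\nabla_Y X,Y)\nabla_Y Y , \end{align*} where in $F(X,\dot q)$ derivatives in the direction $\dot q$ are covariant derivatives along $q$: $\nabla_{\dot q}X=\frac{DX}{dt}$, $\nabla^2_{\dot q}X=\frac{D^2X}{dt^2}$, $\nabla_{\dot q}\dot q=\frac{D\dot q}{dt}$, $\nabla^2_{\dot q}\dot q=\frac{D^2\dot q}{dt^2}$, and $\nabla^2_{\dot q}R$ is the second covariant derivative of $R$ along $q$. The index form $I:\mathring{H}^2_q\times\mathring{H}^2_q\to\mathbb{R}$ is $$I(X,Y)=\int_0^T\Big[\Big\langle\frac{D^2X}{dt^2},\frac{D^2Y}{dt^2}\Big\rangle+\big\langle Y,F(X,\dot q)+\nabla_X\operatorname{grad}V\big\rangle\Big]dt.$$ The extended index $\mathrm{Ind}_0(q)$ is the dimension of the largest subspace of $\mathring{H}^2_q$ on which $I$ is negative semidefinite (i.e. $I(X,X)\le0$ for all $X$ in the subspace); that is, the supremum of the dimensions of such subspaces. *)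

theory Defs
  imports "HOL-Analysis.Analysis" "HOL-Library.Function_Algebras" "HOL-Library.Extended_Nat"
begin

section \<open>Real vector space of functions, possibly infinite dimension\<close>

instantiation "fun" :: (type, real_vector) real_vector
begin

definition scaleR_fun :: "real \<Rightarrow> ('a \<Rightarrow> 'b) \<Rightarrow> 'a \<Rightarrow> 'b"
  where "scaleR_fun c f = (\<lambda>x. c *\<^sub>R f x)"

instance
  by standard (auto simp: scaleR_fun_def fun_eq_iff plus_fun_def algebra_simps)

end

text \<open>The library function \<^const>\<open>dim\<close> returns \<open>0\<close> on infinite-dimensional subspaces.\<close>

definition edim :: "'v::real_vector set \<Rightarrow> enat"
  where "edim S = (if \<exists>B. finite B \<and> S \<subseteq> span B then enat (dim S) else \<infinity>)"

section \<open>Smoothness in vector spaces\<close>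

text \<open>\<open>Ck_on\<close> and \<open>smooth_on\<close> are meant for open sets; \<open>smooth_curve_on\<close> and \<open>C1_curve_on\<close>
  for relatively open subsets of an interval, with one-sided derivatives at the end points.\<close>

primrec Ck_on :: "nat \<Rightarrow> 'v::real_normed_vector set \<Rightarrow> ('v \<Rightarrow> 'w::real_normed_vector) \<Rightarrow> bool" where
  "Ck_on 0 S f \<longleftrightarrow> continuous_on S f"
| "Ck_on (Suc k) S f \<longleftrightarrow>
     (\<forall>x\<in>S. f differentiable (at x)) \<and> (\<forall>v. Ck_on k S (\<lambda>x. frechet_derivative f (at x) v))"

definition smooth_on :: "'v::real_normed_vector set \<Rightarrow> ('v \<Rightarrow> 'w::real_normed_vector) \<Rightarrow> bool"
  where "smooth_on S f \<longleftrightarrow> (\<forall>k. Ck_on k S f)"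

definition smooth_curve_on :: "real set \<Rightarrow> (real \<Rightarrow> 'w::real_normed_vector) \<Rightarrow> bool"
  where "smooth_curve_on J f \<longleftrightarrow>
    (\<exists>D :: nat \<Rightarrow> real \<Rightarrow> 'w. D 0 = f \<and>
      (\<forall>k. \<forall>t\<in>J. (D k has_vector_derivative D (Suc k) t) (at t within J)))"

definition C1_curve_on :: "real set \<Rightarrow> (real \<Rightarrow> 'w::real_normed_vector) \<Rightarrow> bool"
  where "C1_curve_on J f \<longleftrightarrow>
    (\<exists>f'. continuous_on J f' \<and> (\<forall>t\<in>J. (f has_vector_derivative f' t) (at t within J)))"

text \<open>\<open>P\<close> holds on every closed piece of \<open>[0,T]\<close> cut out by some finite set of break points.\<close>

definition piecewise :: "real \<Rightarrow> (real set \<Rightarrow> bool) \<Rightarrow> bool"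
  where "piecewise T P \<longleftrightarrow>
    (\<exists>B. finite B \<and> (\<forall>a b. 0 \<le> a \<and> a < b \<and> b \<le> T \<and> {a<..<b} \<inter> B = {} \<longrightarrow> P {a..b}))"

section \<open>Riemannian manifolds\<close>

text \<open>
  A manifold is a topological space \<open>'a\<close> with an atlas, indexed by the points of the space, whose
  chart at \<open>p\<close> has a domain containing \<open>p\<close> and takes values in the model space \<open>'e\<close>. The tangent
  space at \<open>p\<close> is identified with \<open>'e\<close> through the chart at \<open>p\<close>, so the metric at \<open>p\<close> is a bilinear
  form on \<open>'e\<close>, and a vector field along a curve \<open>q\<close> is a function \<open>X :: real \<Rightarrow> 'e\<close>, where \<open>X t\<close>
  is the tangent vector at \<open>q t\<close> with components \<open>X t\<close> in the chart at \<open>q t\<close>.\<close>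

record ('a, 'e) rmfd =
  chart_dom :: "'a \<Rightarrow> 'a set"
  chart :: "'a \<Rightarrow> 'a \<Rightarrow> 'e"
  metric :: "'a \<Rightarrow> 'e \<Rightarrow> 'e \<Rightarrow> real"

definition chart_inv :: "('a, 'e) rmfd \<Rightarrow> 'a \<Rightarrow> 'e \<Rightarrow> 'a"
  where "chart_inv M p = inv_into (chart_dom M p) (chart M p)"

definition chart_img :: "('a, 'e) rmfd \<Rightarrow> 'a \<Rightarrow> 'e set"
  where "chart_img M p = chart M p ` chart_dom M p"

definition smooth_manifold ::
    "('a::{t2_space,second_countable_topology}, 'e::euclidean_space) rmfd \<Rightarrow> bool"
  where "smooth_manifold M \<longleftrightarrow>
    (\<forall>p. p \<in> chart_dom M p \<and> open (chart_dom M p) \<and> open (chart_img M p) \<and>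
      homeomorphism (chart_dom M p) (chart_img M p) (chart M p) (chart_inv M p)) \<and>
    (\<forall>p p'. smooth_on (chart M p ` (chart_dom M p \<inter> chart_dom M p')) (chart M p' \<circ> chart_inv M p))"

text \<open>\<open>change M p p' r\<close> turns the components in the chart at \<open>p\<close> of a tangent vector at \<open>r\<close> into its
  components in the chart at \<open>p'\<close>. In particular \<open>change M r p r v\<close> are the components of
  \<open>v\<close>, an element of the tangent space at \<open>r\<close>, in the chart at \<open>p\<close>, and \<open>change M p r r u\<close> is the
  tangent vector at \<open>r\<close> with components \<open>u\<close> in the chart at \<open>p\<close>.\<close>

definition change ::
    "('a, 'e::euclidean_space) rmfd \<Rightarrow> 'a \<Rightarrow> 'a \<Rightarrow> 'a \<Rightarrow> 'e \<Rightarrow> 'e"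
  where "change M p p' r u = frechet_derivative (chart M p' \<circ> chart_inv M p) (at (chart M p r)) u"

definition local_metric ::
    "('a, 'e::euclidean_space) rmfd \<Rightarrow> 'a \<Rightarrow> 'e \<Rightarrow> 'e \<Rightarrow> 'e \<Rightarrow> real"
  where "local_metric M p y u v =
    (let r = chart_inv M p y in metric M r (change M p r r u) (change M p r r v))"

definition riemannian_manifold ::
    "('a::{t2_space,second_countable_topology}, 'e::euclidean_space) rmfd \<Rightarrow> bool"
  where "riemannian_manifold M \<longleftrightarrow> smooth_manifold M \<and>
    (\<forall>p. bilinear (metric M p) \<and> (\<forall>u v. metric M p u v = metric M p v u) \<and>
      (\<forall>u. u \<noteq> 0 \<longrightarrow> 0 < metric M p u u)) \<and>
    (\<forall>p u v. smooth_on (chart_img M p) (\<lambda>y. local_metric M p y u v))"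

subsection \<open>Functions and gradient\<close>

definition smooth_function :: "('a, 'e::euclidean_space) rmfd \<Rightarrow> ('a \<Rightarrow> real) \<Rightarrow> bool"
  where "smooth_function M V \<longleftrightarrow> (\<forall>p. smooth_on (chart_img M p) (V \<circ> chart_inv M p))"

definition grad :: "('a, 'e::euclidean_space) rmfd \<Rightarrow> ('a \<Rightarrow> real) \<Rightarrow> 'a \<Rightarrow> 'e"
  where "grad M V p = (THE z. \<forall>w. metric M p z w =
    frechet_derivative (V \<circ> chart_inv M p) (at (chart M p p)) w)"

subsection \<open>Levi-Civita connection and curvature in a chart\<close>

text \<open>In the chart at \<open>p\<close> a connection is \<open>\<nabla>\<^bsub>X\<^esub> Y = DY(X) + \<Gamma>(X,Y)\<close>, with \<open>\<Gamma>\<close> evaluated at the base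
  point. The two conditions below say that it is torsion-free and compatible with the metric.\<close>

definition christoffel ::
    "('a, 'e::euclidean_space) rmfd \<Rightarrow> 'a \<Rightarrow> 'e \<Rightarrow> 'e \<Rightarrow> 'e \<Rightarrow> 'e"
  where "christoffel M p y = (THE \<Gamma>.
    (\<forall>u v. \<Gamma> u v = \<Gamma> v u) \<and>
    (\<forall>u v w. frechet_derivative (\<lambda>z. local_metric M p z v w) (at y) u =
      local_metric M p y (\<Gamma> u v) w + local_metric M p y v (\<Gamma> u w)))"

text \<open>In the following, \<open>X\<close>, \<open>Y\<close>, \<open>Z\<close> are vector fields written in the chart at \<open>p\<close>.\<close>

definition nabla ::
    "('a, 'e::euclidean_space) rmfd \<Rightarrow> 'a \<Rightarrow> ('e \<Rightarrow> 'e) \<Rightarrow> ('e \<Rightarrow> 'e) \<Rightarrow> 'e \<Rightarrow> 'e"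
  where "nabla M p X Y y = frechet_derivative Y (at y) (X y) + christoffel M p y (X y) (Y y)"

definition lie_bracket :: "('e::euclidean_space \<Rightarrow> 'e) \<Rightarrow> ('e \<Rightarrow> 'e) \<Rightarrow> 'e \<Rightarrow> 'e"
  where "lie_bracket X Y y = frechet_derivative Y (at y) (X y) - frechet_derivative X (at y) (Y y)"

definition curv_op ::
    "('a, 'e::euclidean_space) rmfd \<Rightarrow> 'a \<Rightarrow> ('e \<Rightarrow> 'e) \<Rightarrow> ('e \<Rightarrow> 'e) \<Rightarrow> ('e \<Rightarrow> 'e) \<Rightarrow> 'e \<Rightarrow> 'e"
  where "curv_op M p X Y Z y =
    nabla M p X (nabla M p Y Z) y - nabla M p Y (nabla M p X Z) y - nabla M p (lie_bracket X Y) Z y"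

text \<open>Tensors are evaluated on tangent vectors by extending these to fields with constant
  components, which is harmless by tensoriality.\<close>

definition local_curv ::
    "('a, 'e::euclidean_space) rmfd \<Rightarrow> 'a \<Rightarrow> 'e \<Rightarrow> 'e \<Rightarrow> 'e \<Rightarrow> 'e \<Rightarrow> 'e"
  where "local_curv M p y u v w = curv_op M p (\<lambda>_. u) (\<lambda>_. v) (\<lambda>_. w) y"

text \<open>\<open>curvature M p u v w\<close> is \<open>R(u,v)w\<close> and \<open>nabla_curv M p a u v w\<close> is \<open>(\<nabla>\<^bsub>a\<^esub> R)(u,v)w\<close>, for
  tangent vectors at \<open>p\<close>.\<close>

definition curvature ::
    "('a, 'e::euclidean_space) rmfd \<Rightarrow> 'a \<Rightarrow> 'e \<Rightarrow> 'e \<Rightarrow> 'e \<Rightarrow> 'e"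
  where "curvature M p u v w = local_curv M p (chart M p p) u v w"

definition nabla_curv ::
    "('a, 'e::euclidean_space) rmfd \<Rightarrow> 'a \<Rightarrow> 'e \<Rightarrow> 'e \<Rightarrow> 'e \<Rightarrow> 'e \<Rightarrow> 'e"
  where "nabla_curv M p a u v w = (let y = chart M p p; A = (\<lambda>_. a) in
      nabla M p A (\<lambda>z. local_curv M p z u v w) y
      - local_curv M p y (nabla M p A (\<lambda>_. u) y) v w
      - local_curv M p y u (nabla M p A (\<lambda>_. v) y) w
      - local_curv M p y u v (nabla M p A (\<lambda>_. w) y))"

text \<open>\<open>nabla_grad M V p a\<close> is \<open>\<nabla>\<^bsub>a\<^esub> grad V\<close> for a tangent vector \<open>a\<close> at \<open>p\<close>.\<close>

definition nabla_grad ::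
    "('a, 'e::euclidean_space) rmfd \<Rightarrow> ('a \<Rightarrow> real) \<Rightarrow> 'a \<Rightarrow> 'e \<Rightarrow> 'e"
  where "nabla_grad M V p a =
    nabla M p (\<lambda>_. a)
      (\<lambda>y. let r = chart_inv M p y in change M r p r (grad M V r)) (chart M p p)"

section \<open>Curves and vector fields along curves\<close>

text \<open>\<open>K\<close> is the parameter interval of the curve \<open>q\<close>; nothing depends on \<open>q\<close> outside \<open>K\<close>.\<close>

definition smooth_curve ::
    "('a::topological_space, 'e::euclidean_space) rmfd \<Rightarrow> real set \<Rightarrow> (real \<Rightarrow> 'a) \<Rightarrow> bool"
  where "smooth_curve M K q \<longleftrightarrow> continuous_on K q \<and>
    (\<forall>p. smooth_curve_on {t\<in>K. q t \<in> chart_dom M p} (\<lambda>t. chart M p (q t)))"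

definition C1_curve ::
    "('a::topological_space, 'e::euclidean_space) rmfd \<Rightarrow> real set \<Rightarrow> (real \<Rightarrow> 'a) \<Rightarrow> bool"
  where "C1_curve M K q \<longleftrightarrow> continuous_on K q \<and>
    (\<forall>p. C1_curve_on {t\<in>K. q t \<in> chart_dom M p} (\<lambda>t. chart M p (q t)))"

definition velocity ::
    "('a, 'e::euclidean_space) rmfd \<Rightarrow> real set \<Rightarrow> (real \<Rightarrow> 'a) \<Rightarrow> real \<Rightarrow> 'e"
  where "velocity M K q t = vector_derivative (\<lambda>s. chart M (q t) (q s)) (at t within K)"

text \<open>\<open>field_comp M q p X\<close> are the components of \<open>X\<close> in the chart at \<open>p\<close>, valid as long as \<open>q\<close>
  stays in the domain of this chart.\<close>

definition field_comp ::
    "('a, 'e::euclidean_space) rmfd \<Rightarrow> (real \<Rightarrow> 'a) \<Rightarrow> 'a \<Rightarrow> (real \<Rightarrow> 'e) \<Rightarrow> real \<Rightarrow> 'e"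
  where "field_comp M q p X t = change M (q t) p (q t) (X t)"

definition continuous_field ::
    "('a, 'e::euclidean_space) rmfd \<Rightarrow> real set \<Rightarrow> (real \<Rightarrow> 'a) \<Rightarrow> (real \<Rightarrow> 'e) \<Rightarrow> bool"
  where "continuous_field M K q X \<longleftrightarrow>
    (\<forall>p. continuous_on {t\<in>K. q t \<in> chart_dom M p} (field_comp M q p X))"

definition C1_field ::
    "('a, 'e::euclidean_space) rmfd \<Rightarrow> real set \<Rightarrow> (real \<Rightarrow> 'a) \<Rightarrow> (real \<Rightarrow> 'e) \<Rightarrow> bool"
  where "C1_field M K q X \<longleftrightarrow>
    (\<forall>p. C1_curve_on {t\<in>K. q t \<in> chart_dom M p} (field_comp M q p X))"

definition smooth_field ::
    "('a, 'e::euclidean_space) rmfd \<Rightarrow> real set \<Rightarrow> (real \<Rightarrow> 'a) \<Rightarrow> (real \<Rightarrow> 'e) \<Rightarrow> bool"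
  where "smooth_field M K q X \<longleftrightarrow>
    (\<forall>p. smooth_curve_on {t\<in>K. q t \<in> chart_dom M p} (field_comp M q p X))"

text \<open>The covariant derivative \<open>DX/dt\<close>, computed at time \<open>t\<close> in the chart at \<open>q t\<close>.\<close>

definition covD ::
    "('a, 'e::euclidean_space) rmfd \<Rightarrow> real set \<Rightarrow> (real \<Rightarrow> 'a) \<Rightarrow> (real \<Rightarrow> 'e) \<Rightarrow> real \<Rightarrow> 'e"
  where "covD M K q X t =
    vector_derivative (field_comp M q (q t) X) (at t within K)
    + christoffel M (q t) (chart M (q t) (q t)) (velocity M K q t) (X t)"

text \<open>The covariant derivative along \<open>q\<close> of a family \<open>S s\<close> of \<open>(1,3)\<close>-tensors at \<open>q s\<close>, determined by
  the product rule for \<open>S(U,V)W\<close>, where \<open>E u\<close> is the field along \<open>q\<close> with value \<open>u\<close> at time \<open>t\<close> and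
  constant components in the chart at \<open>q t\<close>.\<close>

definition covD_tensor ::
    "('a, 'e::euclidean_space) rmfd \<Rightarrow> real set \<Rightarrow> (real \<Rightarrow> 'a) \<Rightarrow> (real \<Rightarrow> 'e \<Rightarrow> 'e \<Rightarrow> 'e \<Rightarrow> 'e)
      \<Rightarrow> real \<Rightarrow> 'e \<Rightarrow> 'e \<Rightarrow> 'e \<Rightarrow> 'e"
  where "covD_tensor M K q S t u v w =
    (let E = (\<lambda>u s. change M (q t) (q s) (q s) u) in
      covD M K q (\<lambda>s. S s (E u s) (E v s) (E w s)) t
      - S t (covD M K q (E u) t) v w
      - S t u (covD M K q (E v) t) w
      - S t u v (covD M K q (E w) t))"

text \<open>Completeness: every geodesic is defined for all times.\<close>

definition geodesically_complete ::
    "('a::topological_space, 'e::euclidean_space) rmfd \<Rightarrow> bool"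
  where "geodesically_complete M \<longleftrightarrow>
    (\<forall>p v. \<exists>c. smooth_curve M UNIV c \<and> c 0 = p \<and> velocity M UNIV c 0 = v \<and>
      (\<forall>t. covD M UNIV c (velocity M UNIV c) t = 0))"

section \<open>Modified cubic polynomials and the index form\<close>

definition Omega ::
    "('a::topological_space, 'e::euclidean_space) rmfd \<Rightarrow> real \<Rightarrow> 'a \<times> 'e \<Rightarrow> 'a \<times> 'e
      \<Rightarrow> (real \<Rightarrow> 'a) set"
  where "Omega M T \<xi> \<eta> = {q.
    C1_curve M {0..T} q \<and> piecewise T (\<lambda>K. smooth_curve M K q) \<and>
    (q 0, velocity M {0..T} q 0) = \<xi> \<and> (q T, velocity M {0..T} q T) = \<eta>}"

text \<open>Fields along \<open>q\<close> are extended by \<open>0\<close> outside \<open>[0,T]\<close>, so that equality of functions is equality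
  of fields.\<close>

definition T_Omega ::
    "('a::topological_space, 'e::euclidean_space) rmfd \<Rightarrow> real \<Rightarrow> (real \<Rightarrow> 'a) \<Rightarrow> (real \<Rightarrow> 'e) set"
  where "T_Omega M T q = {X.
    C1_field M {0..T} q X \<and> piecewise T (\<lambda>K. smooth_field M K q X) \<and>
    X 0 = 0 \<and> X T = 0 \<and> covD M {0..T} q X 0 = 0 \<and> covD M {0..T} q X T = 0 \<and>
    (\<forall>t. t \<notin> {0..T} \<longrightarrow> X t = 0)}"

definition modified_cubic ::
    "('a::topological_space, 'e::euclidean_space) rmfd \<Rightarrow> ('a \<Rightarrow> real) \<Rightarrow> real
      \<Rightarrow> (real \<Rightarrow> 'a) \<Rightarrow> bool"
  where "modified_cubic M V T q \<longleftrightarrow> smooth_curve M {0..T} q \<and>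
    (let D = covD M {0..T} q; Y = velocity M {0..T} q in
      \<forall>t\<in>{0..T}. D (D (D Y)) t + curvature M (q t) (D Y t) (Y t) (Y t) + grad M V (q t) = 0)"

text \<open>
  The completion of \<^const>\<open>T_Omega\<close> in the norm
  \<open>(\<integral> |X|\<^sup>2 + |DX/dt|\<^sup>2 + |D\<^sup>2X/dt\<^sup>2|\<^sup>2)\<^bsup>1/2\<^esup>\<close> is realized inside the continuous fields along \<open>q\<close>: \<open>X\<close>
  belongs to it, with weak covariant derivatives \<open>X1\<close> and \<open>X2\<close>, if some sequence in \<^const>\<open>T_Omega\<close>
  converges to \<open>X\<close> in \<open>L\<^sup>2\<close> while its first and second covariant derivatives converge to
  \<open>X1\<close> and \<open>X2\<close> in \<open>L\<^sup>2\<close>. Here \<open>X1\<close>, \<open>X2\<close> are unique up to null sets.\<close>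

definition L2_tendsto ::
    "('a, 'e::euclidean_space) rmfd \<Rightarrow> real \<Rightarrow> (real \<Rightarrow> 'a) \<Rightarrow> (nat \<Rightarrow> real \<Rightarrow> 'e)
      \<Rightarrow> (real \<Rightarrow> 'e) \<Rightarrow> bool"
  where "L2_tendsto M T q Xs X \<longleftrightarrow>
    (let sqdist = (\<lambda>k t. metric M (q t) (Xs k t - X t) (Xs k t - X t)) in
      (\<forall>k. set_integrable lebesgue {0..T} (sqdist k)) \<and>
      (\<lambda>k. LINT t:{0..T}|lebesgue. sqdist k t) \<longlonglongrightarrow> 0)"

definition has_weak_derivs ::
    "('a::topological_space, 'e::euclidean_space) rmfd \<Rightarrow> real \<Rightarrow> (real \<Rightarrow> 'a)
      \<Rightarrow> (real \<Rightarrow> 'e) \<Rightarrow> (real \<Rightarrow> 'e) \<times> (real \<Rightarrow> 'e) \<Rightarrow> bool"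
  where "has_weak_derivs M T q X = (\<lambda>(X1, X2).
    (let D = covD M {0..T} q in
      \<exists>Xs. (\<forall>k. Xs k \<in> T_Omega M T q) \<and> L2_tendsto M T q Xs X \<and>
        L2_tendsto M T q (\<lambda>k. D (Xs k)) X1 \<and> L2_tendsto M T q (\<lambda>k. D (D (Xs k))) X2))"

definition H2_0 ::
    "('a::topological_space, 'e::euclidean_space) rmfd \<Rightarrow> real \<Rightarrow> (real \<Rightarrow> 'a) \<Rightarrow> (real \<Rightarrow> 'e) set"
  where "H2_0 M T q = {X. continuous_field M {0..T} q X \<and> (\<forall>t. t \<notin> {0..T} \<longrightarrow> X t = 0) \<and>
    (\<exists>W. has_weak_derivs M T q X W)}"

definition weak_derivs ::
    "('a::topological_space, 'e::euclidean_space) rmfd \<Rightarrow> real \<Rightarrow> (real \<Rightarrow> 'a)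
      \<Rightarrow> (real \<Rightarrow> 'e) \<Rightarrow> (real \<Rightarrow> 'e) \<times> (real \<Rightarrow> 'e)"
  where "weak_derivs M T q X = (SOME W. has_weak_derivs M T q X W)"

text \<open>\<open>F_tensor M T q t X X1 X2\<close> is the value of \<open>F(X, dq/dt)\<close> at time \<open>t\<close>, where \<open>X\<close>, \<open>X1\<close>, \<open>X2\<close> stand
  for the values at \<open>t\<close> of the field and of its first and second covariant derivatives.\<close>

definition F_tensor ::
    "('a, 'e::euclidean_space) rmfd \<Rightarrow> real \<Rightarrow> (real \<Rightarrow> 'a) \<Rightarrow> real \<Rightarrow> 'e \<Rightarrow> 'e \<Rightarrow> 'e \<Rightarrow> 'e"
  where "F_tensor M T q t X X1 X2 =
    (let D = covD M {0..T} q;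
         Y = velocity M {0..T} q t;
         Y1 = D (velocity M {0..T} q) t;
         Y2 = D (D (velocity M {0..T} q)) t;
         R = curvature M (q t);
         DR = covD_tensor M {0..T} q (\<lambda>s. curvature M (q s)) t;
         DDR = covD_tensor M {0..T} q (covD_tensor M {0..T} q (\<lambda>s. curvature M (q s))) t
     in DDR X Y Y + nabla_curv M (q t) X Y1 Y Y + R (R X Y Y) Y Y + R X Y2 Y
        + 2 *\<^sub>R (DR X1 Y Y + DR X Y1 Y + R X2 Y Y)
        + 3 *\<^sub>R (DR X Y Y1 + R X Y Y2 + R X Y1 Y1)
        + 4 *\<^sub>R R X1 Y Y1)"

definition index_form ::
    "('a::topological_space, 'e::euclidean_space) rmfd \<Rightarrow> ('a \<Rightarrow> real) \<Rightarrow> real \<Rightarrow> (real \<Rightarrow> 'a)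
      \<Rightarrow> (real \<Rightarrow> 'e) \<Rightarrow> (real \<Rightarrow> 'e) \<Rightarrow> real"
  where "index_form M V T q X Y =
    (let (X1, X2) = weak_derivs M T q X; (Y1, Y2) = weak_derivs M T q Y in
      LINT t:{0..T}|lebesgue.
        metric M (q t) (X2 t) (Y2 t)
        + metric M (q t) (Y t) (F_tensor M T q t (X t) (X1 t) (X2 t) + nabla_grad M V (q t) (X t)))"

definition extended_index ::
    "('a::topological_space, 'e::euclidean_space) rmfd \<Rightarrow> ('a \<Rightarrow> real) \<Rightarrow> real \<Rightarrow> (real \<Rightarrow> 'a) \<Rightarrow> enat"
  where "extended_index M V T q =
    Sup (edim ` {S. subspace S \<and> S \<subseteq> H2_0 M T q \<and> (\<forall>X\<in>S. index_form M V T q X X \<le> 0)})"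

end

theory Submission
  imports Defs
begin

text \<open>
  Let \<open>N0\<close>, \<open>N1\<close>, \<open>N2\<close> be the integrals over \<open>[0,T]\<close> of the squared lengths of a field \<open>X\<close> in the
  completed space and of its first and second weak covariant derivatives. The form \<open>F(X,dq/dt)\<close> plus
  the covariant derivative of the gradient is linear in these three fields, with coefficients that are
  continuous along the compact arc and hence bounded. If \<open>I(X,X) \<le> 0\<close>, Cauchy-Schwarz therefore
  bounds \<open>N2\<close> by a constant times \<open>N0 + N1\<close>.

  Conversely, suppose that \<open>X\<close> vanishes at the nodes of a grid of mesh \<open>h\<close>. A Poincare inequality on
  each cell gives \<open>N0 \<le> 4 h\<^sup>2 N1\<close>, and integrating \<open>\<langle>X, DX\<rangle>' = |DX|\<^sup>2 + \<langle>X, D\<^sup>2X\<rangle>\<close>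
  gives \<open>N1\<close> in terms of \<open>N0\<close> and \<open>N2\<close>; together \<open>N1 \<le> 4 h\<^sup>2 N2\<close> and \<open>N0 \<le> 16 h\<^sup>4 N2\<close>. For small \<open>h\<close> the
  two bounds are compatible only if \<open>X = 0\<close> (lemma \<open>vanishing_field\<close>). So on a subspace on
  which \<open>I\<close> is negative semidefinite the values at the finitely many nodes determine the field, and
  the dimension is at most the number of nodes times the dimension of the manifold
  (\<open>edim_le_card_functionals\<close>).

  Two things require work. The inequalities are first proved for admissible fields, by the fundamental
  theorem of calculus and compatibility of the connection with the metric (\<open>poincare\<close>,
  \<open>interpolation\<close>), and then pass to \<open>L\<^sup>2\<close> limits along a subsequence that converges almost
  everywhere; this also provides measurability of everything that is integrated. And since a tangent
  vector at \<open>q t\<close> is represented in a chart that depends on \<open>t\<close> in an arbitrary way, boundedness and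
  measurability in \<open>t\<close> only make sense after passing to a fixed chart. For this the connection, the
  curvature, its covariant derivatives, the gradient and its covariant derivative are shown to
  transform as they should under a change of coordinates (\<open>christoffel_change\<close>,
  \<open>local_curv_change\<close>, \<open>nabla_tensor_change\<close>, \<open>local_nabla_grad_change\<close>, \<open>covD_comp\<close>,
  \<open>covD_tensor_comp\<close>). The law for the Christoffel symbols follows from uniqueness of the Levi-Civita
  connection, and the laws for derivatives follow from it.\<close>

section \<open>Functions of finite differentiability class on a set\<close>

text \<open>Derivatives are taken within the set, so that the same calculus serves for open subsets of the
  model space and for intervals including their end points.\<close>

primrec Ck_within :: "nat \<Rightarrow> 'v::real_normed_vector set \<Rightarrow> ('v \<Rightarrow> 'w::real_normed_vector) \<Rightarrow> bool" where
  "Ck_within 0 S f \<longleftrightarrow> continuous_on S f"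
| "Ck_within (Suc k) S f \<longleftrightarrow> (\<exists>f'. (\<forall>x\<in>S. (f has_derivative f' x) (at x within S)) \<and>
     (\<forall>v. Ck_within k S (\<lambda>x. f' x v)))"

lemma Ck_within_cong:
  assumes "\<And>x. x \<in> S \<Longrightarrow> f x = g x" and "Ck_within k S f"
  shows "Ck_within k S g"
proof (cases k)
  case 0
  then show ?thesis
    using assms continuous_on_cong[of S S f g] by simp
next
  case (Suc j)
  then obtain f' where "\<forall>x\<in>S. (f has_derivative f' x) (at x within S)"
    and f': "\<forall>v. Ck_within j S (\<lambda>x. f' x v)"
    using assms(2) by auto
  then have "\<forall>x\<in>S. (g has_derivative f' x) (at x within S)"
    using assms(1) by (metis has_derivative_transform)
  with f' Suc show ?thesis by auto
qed

lemma Ck_within_SucD: "Ck_within (Suc k) S f \<Longrightarrow> Ck_within k S f"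
proof (induction k arbitrary: f)
  case 0
  then show ?case by (auto intro: has_derivative_continuous_on)
next
  case (Suc k)
  then obtain f' where f': "\<forall>x\<in>S. (f has_derivative f' x) (at x within S)"
    "\<forall>v. Ck_within (Suc k) S (\<lambda>x. f' x v)"
    by (subst (asm) Ck_within.simps(2)) blast
  show ?case
    unfolding Ck_within.simps(2)[of k] using f' Suc.IH by blast
qed

lemma Ck_within_mono: "Ck_within k S f \<Longrightarrow> j \<le> k \<Longrightarrow> Ck_within j S f"
proof (induction k)
  case (Suc k)
  then show ?case using Ck_within_SucD le_Suc_eq by blast
qed simp

lemma Ck_within_subset: "Ck_within k S f \<Longrightarrow> S' \<subseteq> S \<Longrightarrow> Ck_within k S' f"
proof (induction k arbitrary: f)
  case 0
  then show ?case by (auto intro: continuous_on_subset)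
next
  case (Suc k)
  then obtain f' where "\<forall>x\<in>S. (f has_derivative f' x) (at x within S)" "\<forall>v. Ck_within k S (\<lambda>x. f' x v)"
    by auto
  then have "\<forall>x\<in>S'. (f has_derivative f' x) (at x within S')" "\<forall>v. Ck_within k S' (\<lambda>x. f' x v)"
    using Suc has_derivative_subset by blast+
  then show ?case by auto
qed

lemma Ck_within_const: "Ck_within k S (\<lambda>_. c)"
proof (induction k arbitrary: c)
  case (Suc k)
  show ?case
    unfolding Ck_within.simps
    by (rule exI[of _ "\<lambda>_ _. 0"]) (use Suc in auto)
qed simp

lemma Ck_within_add:
  "Ck_within k S f \<Longrightarrow> Ck_within k S g \<Longrightarrow> Ck_within k S (\<lambda>x. f x + g x)"
proof (induction k arbitrary: f g)
  case 0
  then show ?case by (auto intro: continuous_on_add)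
next
  case (Suc k)
  obtain f' where f': "\<forall>x\<in>S. (f has_derivative f' x) (at x within S)" "\<forall>v. Ck_within k S (\<lambda>x. f' x v)"
    using Suc.prems(1) by auto
  obtain g' where g': "\<forall>x\<in>S. (g has_derivative g' x) (at x within S)" "\<forall>v. Ck_within k S (\<lambda>x. g' x v)"
    using Suc.prems(2) by auto
  show ?case
    unfolding Ck_within.simps
    by (rule exI[of _ "\<lambda>x v. f' x v + g' x v"]) (use f' g' Suc.IH in \<open>auto intro: has_derivative_add\<close>)
qed

lemma Ck_within_bilinear:
  assumes h: "bounded_bilinear h" and "Ck_within k S f" "Ck_within k S g"
  shows "Ck_within k S (\<lambda>x. h (f x) (g x))"
  using assms(2,3)
proof (induction k arbitrary: f g)
  case 0
  then show ?case by (auto intro: bounded_bilinear.continuous_on[OF h])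
next
  case (Suc k)
  obtain f' where f': "\<forall>x\<in>S. (f has_derivative f' x) (at x within S)" "\<forall>v. Ck_within k S (\<lambda>x. f' x v)"
    using Suc.prems(1) by auto
  obtain g' where g': "\<forall>x\<in>S. (g has_derivative g' x) (at x within S)" "\<forall>v. Ck_within k S (\<lambda>x. g' x v)"
    using Suc.prems(2) by auto
  show ?case
    unfolding Ck_within.simps
  proof (intro exI[of _ "\<lambda>x v. h (f x) (g' x v) + h (f' x v) (g x)"] conjI ballI allI)
    show "((\<lambda>x. h (f x) (g x)) has_derivative (\<lambda>v. h (f x) (g' x v) + h (f' x v) (g x))) (at x within S)"
      if "x \<in> S" for x
      using bounded_bilinear.FDERIV[OF h] f' g' that by blast
    show "Ck_within k S (\<lambda>x. h (f x) (g' x v) + h (f' x v) (g x))" for v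
      using Suc.IH Ck_within_SucD[OF Suc.prems(1)] Ck_within_SucD[OF Suc.prems(2)] f'(2) g'(2)
      by (intro Ck_within_add) blast+
  qed
qed

lemmas Ck_within_scaleR = Ck_within_bilinear[OF bounded_bilinear_scaleR]
lemmas Ck_within_mult = Ck_within_bilinear[OF bounded_bilinear_mult]
lemmas Ck_within_inner = Ck_within_bilinear[OF bounded_bilinear_inner]

lemma Ck_within_minus: "Ck_within k S f \<Longrightarrow> Ck_within k S (\<lambda>x. - f x)"
  using Ck_within_scaleR[OF Ck_within_const[of k S "-1"], of f] by simp

lemma Ck_within_diff:
  "Ck_within k S f \<Longrightarrow> Ck_within k S g \<Longrightarrow> Ck_within k S (\<lambda>x. f x - g x)"
  using Ck_within_add[OF _ Ck_within_minus, of k S f g] by simp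

lemma Ck_within_sum:
  "(\<And>i. i \<in> I \<Longrightarrow> Ck_within k S (f i)) \<Longrightarrow> Ck_within k S (\<lambda>x. \<Sum>i\<in>I. f i x)"
  by (induction I rule: infinite_finite_induct) (auto intro: Ck_within_const Ck_within_add)

lemma Ck_within_inverse:
  fixes f :: "'v::real_normed_vector \<Rightarrow> real"
  shows "Ck_within k S f \<Longrightarrow> (\<And>x. x \<in> S \<Longrightarrow> f x \<noteq> 0) \<Longrightarrow> Ck_within k S (\<lambda>x. inverse (f x))"
proof (induction k)
  case 0
  then show ?case by (auto intro: continuous_on_inverse)
next
  case (Suc k)
  obtain f' where f': "\<forall>x\<in>S. (f has_derivative f' x) (at x within S)" "\<forall>v. Ck_within k S (\<lambda>x. f' x v)"
    using Suc.prems(1) by auto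
  have inv: "Ck_within k S (\<lambda>x. inverse (f x))"
    using Suc Ck_within_SucD by blast
  show ?case
    unfolding Ck_within.simps
  proof (intro exI[of _ "\<lambda>x v. - (inverse (f x) * f' x v * inverse (f x))"] conjI ballI allI)
    show "((\<lambda>x. inverse (f x)) has_derivative (\<lambda>v. - (inverse (f x) * f' x v * inverse (f x)))) (at x within S)"
      if "x \<in> S" for x
      using Suc.prems(2) f'(1) that by (intro Deriv.has_derivative_inverse) auto
    show "Ck_within k S (\<lambda>x. - (inverse (f x) * f' x v * inverse (f x)))" for v
      using inv f'(2) by (intro Ck_within_minus Ck_within_mult) auto
  qed
qed

lemma linear_basis_expansion:
  fixes L :: "'e::euclidean_space \<Rightarrow> 'w::real_vector"
  assumes "linear L"
  shows "L u = (\<Sum>b\<in>Basis. (u \<bullet> b) *\<^sub>R L b)"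
  using linear_sum[OF assms, of "\<lambda>b. (u \<bullet> b) *\<^sub>R b" Basis]
  by (simp add: euclidean_representation linear_cmul[OF assms])

lemma Ck_within_lin_apply:
  fixes L :: "'v::real_normed_vector \<Rightarrow> 'e::euclidean_space \<Rightarrow> 'w::real_normed_vector"
  assumes "\<And>x. x \<in> S \<Longrightarrow> linear (L x)" and "\<And>u. Ck_within k S (\<lambda>x. L x u)" and "Ck_within k S u"
  shows "Ck_within k S (\<lambda>x. L x (u x))"
proof (rule Ck_within_cong)
  show "Ck_within k S (\<lambda>x. \<Sum>b\<in>Basis. (u x \<bullet> b) *\<^sub>R L x b)"
    by (intro Ck_within_sum Ck_within_scaleR Ck_within_inner assms Ck_within_const)
  show "(\<Sum>b\<in>Basis. (u x \<bullet> b) *\<^sub>R L x b) = L x (u x)" if "x \<in> S" for x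
    using linear_basis_expansion[OF assms(1)[OF that]] by metis
qed

text \<open>Writing \<open>u x = u x0 + (u x - u x0)\<close> and expanding the increment in a basis reduces this product rule
  to the one for scalar multiples; the coefficients of the increment vanish at \<open>x0\<close>.\<close>

lemma has_derivative_lin_apply:
  fixes L :: "'v::real_normed_vector \<Rightarrow> 'e::euclidean_space \<Rightarrow> 'w::real_normed_vector"
  assumes lin: "\<And>x. x \<in> S \<Longrightarrow> linear (L x)" and "x0 \<in> S"
    and L: "\<And>a. ((\<lambda>x. L x a) has_derivative L' a) (at x0 within S)"
    and u: "(u has_derivative u') (at x0 within S)"
  shows "((\<lambda>x. L x (u x)) has_derivative (\<lambda>h. L' (u x0) h + L x0 (u' h))) (at x0 within S)"
proof -
  have "((\<lambda>x. \<Sum>b\<in>Basis. ((u x - u x0) \<bullet> b) *\<^sub>R L x b) has_derivative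
      (\<lambda>h. \<Sum>b\<in>Basis. ((u x0 - u x0) \<bullet> b) *\<^sub>R L' b h + (u' h \<bullet> b) *\<^sub>R L x0 b)) (at x0 within S)"
    by (intro has_derivative_sum has_derivative_scaleR L) (auto intro!: derivative_eq_intros u)
  then have "((\<lambda>x. \<Sum>b\<in>Basis. ((u x - u x0) \<bullet> b) *\<^sub>R L x b) has_derivative (\<lambda>h. L x0 (u' h))) (at x0 within S)"
    by (simp add: linear_basis_expansion[OF lin[OF \<open>x0 \<in> S\<close>], of "u' _"])
  from has_derivative_add[OF L this]
  show ?thesis
    by (rule has_derivative_transform[OF \<open>x0 \<in> S\<close>, rotated])
      (simp add: linear_basis_expansion[OF lin, symmetric] linear_diff[OF lin])
qed

lemma Ck_within_compose:
  fixes f :: "'e::euclidean_space \<Rightarrow> 'w::real_normed_vector"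
  assumes "Ck_within k U f" and "Ck_within k J c" and sub: "c ` J \<subseteq> U"
  shows "Ck_within k J (\<lambda>t. f (c t))"
  using assms(1,2)
proof (induction k arbitrary: f)
  case 0
  then show ?case using sub by (auto intro: continuous_on_compose2)
next
  case (Suc k)
  obtain f' where f': "\<forall>x\<in>U. (f has_derivative f' x) (at x within U)" "\<forall>v. Ck_within k U (\<lambda>x. f' x v)"
    using Suc.prems(1) by auto
  obtain c' where c': "\<forall>x\<in>J. (c has_derivative c' x) (at x within J)" "\<forall>v. Ck_within k J (\<lambda>x. c' x v)"
    using Suc.prems(2) by auto
  show ?case
    unfolding Ck_within.simps
  proof (intro exI[of _ "\<lambda>x v. f' (c x) (c' x v)"] conjI ballI allI)
    show "((\<lambda>t. f (c t)) has_derivative (\<lambda>v. f' (c x) (c' x v))) (at x within J)" if "x \<in> J" for x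
      by (rule has_derivative_in_compose[of c]) (use f'(1) c'(1) that sub has_derivative_subset in blast)+
    show "Ck_within k J (\<lambda>x. f' (c x) (c' x v))" for v
    proof (rule Ck_within_lin_apply)
      show "linear (f' (c x))" if "x \<in> J" for x
        using f'(1) that sub by (blast intro: has_derivative_linear)
      show "Ck_within k J (\<lambda>x. f' (c x) u)" for u
        using Suc.IH f'(2) Ck_within_SucD[OF Suc.prems(2)] by blast
      show "Ck_within k J (\<lambda>x. c' x v)" using c'(2) by blast
    qed
  qed
qed

lemma Ck_within_Suc_open:
  assumes "open U"
  shows "Ck_within (Suc k) U f \<longleftrightarrow> (\<forall>x\<in>U. f differentiable (at x)) \<and>
    (\<forall>v. Ck_within k U (\<lambda>x. frechet_derivative f (at x) v))"
proof
  assume "Ck_within (Suc k) U f"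
  then obtain f' where f'0: "\<forall>x\<in>U. (f has_derivative f' x) (at x within U)"
      and f'2: "\<forall>v. Ck_within k U (\<lambda>x. f' x v)"
    unfolding Ck_within.simps by blast
  have f': "(f has_derivative f' x) (at x)" if "x \<in> U" for x
    using bspec[OF f'0 that] at_within_open[OF that assms] by simp
  then have eq: "frechet_derivative f (at x) = f' x" if "x \<in> U" for x
    using frechet_derivative_at[OF f'[OF that]] by simp
  have "Ck_within k U (\<lambda>x. frechet_derivative f (at x) v)" for v
    by (rule Ck_within_cong[OF _ spec[OF f'2, of v]]) (simp add: eq)
  then show "(\<forall>x\<in>U. f differentiable (at x)) \<and> (\<forall>v. Ck_within k U (\<lambda>x. frechet_derivative f (at x) v))"
    using f' differentiableI by metis
next
  assume *: "(\<forall>x\<in>U. f differentiable (at x)) \<and> (\<forall>v. Ck_within k U (\<lambda>x. frechet_derivative f (at x) v))"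
  have "(f has_derivative frechet_derivative f (at x)) (at x within U)" if "x \<in> U" for x
    using * that at_within_open[OF that assms] frechet_derivative_works by metis
  with * show "Ck_within (Suc k) U f"
    unfolding Ck_within.simps by (intro exI[of _ "\<lambda>x. frechet_derivative f (at x)"]) blast
qed

lemma Ck_on_imp_Ck_within: "open U \<Longrightarrow> Ck_on k U f \<Longrightarrow> Ck_within k U f"
proof (induction k arbitrary: f)
  case (Suc k)
  then show ?case
    unfolding Ck_within_Suc_open[OF \<open>open U\<close>] by simp
qed simp

lemma smooth_curve_on_imp_Ck_within:
  assumes "smooth_curve_on J f"
  shows "Ck_within k J f"
proof -
  obtain D where D0: "D 0 = f"
    and D: "\<And>k t. t \<in> J \<Longrightarrow> (D k has_vector_derivative D (Suc k) t) (at t within J)"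
    using assms unfolding smooth_curve_on_def by blast
  have "Ck_within k J (D i)" for i
  proof (induction k arbitrary: i)
    case 0
    show ?case
      using D by (auto simp: has_vector_derivative_def intro!: has_derivative_continuous_on)
  next
    case (Suc k)
    show ?case
      unfolding Ck_within.simps
      by (intro exI[of _ "\<lambda>t v. v *\<^sub>R D (Suc i) t"] conjI ballI allI Ck_within_scaleR Ck_within_const Suc
          D[unfolded has_vector_derivative_def])
  qed
  with D0 show ?thesis by metis
qed

section \<open>Symmetry of second derivatives\<close>

lemma has_real_derivative_along_line:
  fixes f :: "'v::real_normed_vector \<Rightarrow> real"
  assumes "(f has_derivative f') (at (y + a *\<^sub>R w))"
  shows "((\<lambda>a. f (y + a *\<^sub>R w)) has_real_derivative f' w) (at a)"
proof -
  have "((\<lambda>a. y + a *\<^sub>R w) has_derivative (\<lambda>c. c *\<^sub>R w)) (at a)"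
    by (auto intro!: derivative_eq_intros)
  from has_derivative_compose[OF this assms]
  show ?thesis
    by (simp add: has_field_derivative_def linear_cmul[OF has_derivative_linear[OF assms]] mult_commute_abs)
qed

text \<open>The classical argument: by two applications of the mean value theorem the second difference of
  \<open>f\<close> over a small parallelogram equals \<open>s\<^sup>2\<close> times either mixed derivative at a nearby point, so by
  continuity the two mixed derivatives cannot differ.\<close>

lemma second_derivative_symmetric_real:
  fixes f :: "'v::real_normed_vector \<Rightarrow> real"
  assumes U: "open U" "x \<in> U" and f: "Ck_within 2 U f"
  shows "frechet_derivative (\<lambda>y. frechet_derivative f (at y) v) (at x) u
       = frechet_derivative (\<lambda>y. frechet_derivative f (at y) u) (at x) v" (is "?B = ?A")
proof (rule ccontr)
  define D where "D w y = frechet_derivative f (at y) w" for w y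
  define DD where "DD w z y = frechet_derivative (D w) (at y) z" for w z y
  have "Ck_within (Suc (Suc 0)) U f" using f by (simp add: numeral_2_eq_2)
  then have D1: "f differentiable (at y)" and C1: "Ck_within (Suc 0) U (D w)" if "y \<in> U" for y w
    using that U unfolding Ck_within_Suc_open[OF U(1), of "Suc 0"] D_def by blast+
  have f': "(f has_derivative (\<lambda>w. D w y)) (at y)" if "y \<in> U" for y
    using D1[OF that] by (simp add: D_def frechet_derivative_works[symmetric])
  have f'': "(D w has_derivative (\<lambda>z. DD w z y)) (at y)" and cont: "continuous_on U (DD w z)"
    if "y \<in> U" for y w z
    using C1[OF that, of w] that unfolding Ck_within_Suc_open[OF U(1)] DD_def
    by (simp_all add: frechet_derivative_works[symmetric])
  assume "?B \<noteq> ?A"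
  then have "DD v u x \<noteq> DD u v x" unfolding DD_def D_def .
  define e where "e = \<bar>DD v u x - DD u v x\<bar> / 2"
  have "e > 0" using \<open>DD v u x \<noteq> DD u v x\<close> by (simp add: e_def)
  have near: "\<exists>d>0. \<forall>y. dist y x < d \<longrightarrow> y \<in> U \<and> \<bar>DD w z y - DD w z x\<bar> < e" for w z
  proof -
    have "isCont (DD w z) x"
      using cont[OF U(2)] U continuous_on_eq_continuous_at by blast
    then obtain d1 where d1: "d1 > 0" "\<And>y. dist y x < d1 \<Longrightarrow> \<bar>DD w z y - DD w z x\<bar> < e"
      using \<open>e > 0\<close> unfolding continuous_at_eps_delta dist_real_def by (metis dist_commute)
    obtain d2 where "d2 > 0" "\<And>y. dist y x < d2 \<Longrightarrow> y \<in> U"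
      using U unfolding open_dist by blast
    then show ?thesis using d1 by (intro exI[of _ "min d1 d2"]) auto
  qed
  obtain d1 where d1: "d1 > 0" "\<And>y. dist y x < d1 \<Longrightarrow> y \<in> U \<and> \<bar>DD v u y - DD v u x\<bar> < e"
    using near by blast
  obtain d2 where d2: "d2 > 0" "\<And>y. dist y x < d2 \<Longrightarrow> y \<in> U \<and> \<bar>DD u v y - DD u v x\<bar> < e"
    using near by blast
  define N where "N = norm u + norm v"
  have N: "norm u \<le> N" "norm v \<le> N" "N \<ge> 0" by (simp_all add: N_def)
  \<comment> \<open>side of the parallelogram, short enough that it stays within \<open>min d1 d2\<close> of \<open>x\<close>\<close>
  define s where "s = min d1 d2 / (N + 1) / 2"
  have "s > 0" using d1(1) d2(1) N(3) by (simp add: s_def)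
  have mvt: "\<exists>y. dist y x < min d1 d2 \<and>
      f (x + s *\<^sub>R z + s *\<^sub>R w) - f (x + s *\<^sub>R w) - (f (x + s *\<^sub>R z) - f x) = s * (s * DD w z y)"
    if wz: "norm w \<le> N" "norm z \<le> N" for w z
  proof -
    have small: "dist (x + a *\<^sub>R w + b *\<^sub>R z) x < min d1 d2" if "0 \<le> a" "a \<le> s" "0 \<le> b" "b \<le> s" for a b
    proof -
      have "dist (x + a *\<^sub>R w + b *\<^sub>R z) x \<le> a * norm w + b * norm z"
        using that norm_triangle_ineq[of "a *\<^sub>R w" "b *\<^sub>R z"] by (simp add: dist_norm)
      also have "\<dots> \<le> s * N + s * N"
        using that wz by (intro add_mono mult_mono) auto
      also have "\<dots> < s * (N + 1) * 2" using \<open>s > 0\<close> by (simp add: algebra_simps)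
      also have "\<dots> = min d1 d2" using N(3) unfolding s_def by (simp add: field_simps)
      finally show ?thesis .
    qed
    then have inU: "x + a *\<^sub>R w + b *\<^sub>R z \<in> U" "x + b *\<^sub>R z + a *\<^sub>R w \<in> U"
      if "0 \<le> a" "a \<le> s" "0 \<le> b" "b \<le> s" for a b
      using that d1(2) by (simp_all add: add_ac)
    have "\<exists>a. 0 < a \<and> a < s \<and> f (x + s *\<^sub>R z + s *\<^sub>R w) - f (x + 0 *\<^sub>R z + s *\<^sub>R w)
        - (f (x + s *\<^sub>R z + 0 *\<^sub>R w) - f (x + 0 *\<^sub>R z + 0 *\<^sub>R w))
        = (s - 0) * (D w (x + s *\<^sub>R z + a *\<^sub>R w) - D w (x + 0 *\<^sub>R z + a *\<^sub>R w))"
      using \<open>s > 0\<close> by (intro MVT2 DERIV_diff has_real_derivative_along_line f' inU) auto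
    then obtain a where a: "0 < a" "a < s" "f (x + s *\<^sub>R z + s *\<^sub>R w) - f (x + s *\<^sub>R w)
        - (f (x + s *\<^sub>R z) - f x) = s * (D w (x + a *\<^sub>R w + s *\<^sub>R z) - D w (x + a *\<^sub>R w))"
      by (auto simp: add_ac)
    have "\<exists>b. 0 < b \<and> b < s \<and> D w (x + a *\<^sub>R w + s *\<^sub>R z) - D w (x + a *\<^sub>R w + 0 *\<^sub>R z)
        = (s - 0) * DD w z (x + a *\<^sub>R w + b *\<^sub>R z)"
      using \<open>s > 0\<close> a by (intro MVT2 has_real_derivative_along_line f'' inU) auto
    then obtain b where "0 < b" "b < s"
      "D w (x + a *\<^sub>R w + s *\<^sub>R z) - D w (x + a *\<^sub>R w) = s * DD w z (x + a *\<^sub>R w + b *\<^sub>R z)" by auto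
    with a small show ?thesis
      by (intro exI[of _ "x + a *\<^sub>R w + b *\<^sub>R z"]) auto
  qed
  obtain y1 where y1: "dist y1 x < min d1 d2"
    "f (x + s *\<^sub>R v + s *\<^sub>R u) - f (x + s *\<^sub>R u) - (f (x + s *\<^sub>R v) - f x) = s * (s * DD u v y1)"
    using mvt[of u v] N by blast
  obtain y2 where y2: "dist y2 x < min d1 d2"
    "f (x + s *\<^sub>R u + s *\<^sub>R v) - f (x + s *\<^sub>R v) - (f (x + s *\<^sub>R u) - f x) = s * (s * DD v u y2)"
    using mvt[of v u] N by blast
  have "s * (s * DD u v y1) = s * (s * DD v u y2)"
    unfolding y1(2)[symmetric] y2(2)[symmetric] by (simp add: add_ac)
  then have "DD u v y1 = DD v u y2" using \<open>s > 0\<close> by simp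
  moreover have "\<bar>DD v u y2 - DD v u x\<bar> < e" "\<bar>DD u v y1 - DD u v x\<bar> < e"
    using d1 d2 y1 y2 by auto
  ultimately have "\<bar>DD v u x - DD u v x\<bar> < e + e" by linarith
  then show False unfolding e_def by simp
qed

lemma Ck_within_bounded_linear:
  assumes "bounded_linear h" and "Ck_within k S f"
  shows "Ck_within k S (\<lambda>x. h (f x))"
  using assms(2)
proof (induction k arbitrary: f)
  case 0
  then show ?case by (simp add: bounded_linear.continuous_on[OF assms(1)])
next
  case (Suc k)
  then obtain f' where "\<forall>x\<in>S. (f has_derivative f' x) (at x within S)" "\<forall>v. Ck_within k S (\<lambda>x. f' x v)"
    by auto
  then have "\<forall>x\<in>S. ((\<lambda>x. h (f x)) has_derivative (\<lambda>v. h (f' x v))) (at x within S)"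
      "\<forall>v. Ck_within k S (\<lambda>x. h (f' x v))"
    using bounded_linear.has_derivative[OF assms(1)] Suc.IH by blast+
  then show ?case unfolding Ck_within.simps by (intro exI[of _ "\<lambda>x v. h (f' x v)"]) simp
qed

lemma frechet_derivative_inner_left:
  assumes "f differentiable (at x)"
  shows "frechet_derivative (\<lambda>y. f y \<bullet> b) (at x) v = frechet_derivative f (at x) v \<bullet> b"
proof -
  have "((\<lambda>y. f y \<bullet> b) has_derivative (\<lambda>v. frechet_derivative f (at x) v \<bullet> b)) (at x)"
    using assms by (intro has_derivative_inner_left) (simp add: frechet_derivative_works[symmetric])
  from frechet_derivative_at[OF this] show ?thesis by metis
qed

lemma second_derivative_symmetric:
  fixes f :: "'v::real_normed_vector \<Rightarrow> 'w::euclidean_space"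
  assumes U: "open U" "x \<in> U" and f: "Ck_within 2 U f"
  shows "frechet_derivative (\<lambda>y. frechet_derivative f (at y) v) (at x) u
       = frechet_derivative (\<lambda>y. frechet_derivative f (at y) u) (at x) v"
proof (rule euclidean_eqI)
  fix b :: 'w
  assume "b \<in> Basis"
  have f2: "Ck_within (Suc (Suc 0)) U f" using f by (simp add: numeral_2_eq_2)
  have d1: "f differentiable (at y)" if "y \<in> U" for y
    using f2 that unfolding Ck_within_Suc_open[OF U(1)] by blast
  have "Ck_within (Suc 0) U (\<lambda>y. frechet_derivative f (at y) w)" for w
    using f2 unfolding Ck_within_Suc_open[OF U(1), of "Suc 0"] by blast
  then have d2: "(\<lambda>y. frechet_derivative f (at y) w) differentiable (at x)" for w
    using U unfolding Ck_within_Suc_open[OF U(1)] by blast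
  have *: "frechet_derivative (\<lambda>y. frechet_derivative (\<lambda>y. f y \<bullet> b) (at y) w) (at x) z
    = frechet_derivative (\<lambda>y. frechet_derivative f (at y) w) (at x) z \<bullet> b" for w z
  proof -
    have "frechet_derivative (\<lambda>y. frechet_derivative (\<lambda>y. f y \<bullet> b) (at y) w) (at x)
      = frechet_derivative (\<lambda>y. frechet_derivative f (at y) w \<bullet> b) (at x)"
    proof (rule frechet_derivative_transform_within_open[OF _ U])
      show "frechet_derivative (\<lambda>y. f y \<bullet> b) (at y) w = frechet_derivative f (at y) w \<bullet> b" if "y \<in> U" for y
        using frechet_derivative_inner_left[OF d1[OF that]] .
      note eq = this
      have "((\<lambda>y. frechet_derivative f (at y) w \<bullet> b) has_derivative
          (\<lambda>z. frechet_derivative (\<lambda>y. frechet_derivative f (at y) w) (at x) z \<bullet> b)) (at x)"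
        using d2[of w] by (intro has_derivative_inner_left) (simp add: frechet_derivative_works[symmetric])
      then show "(\<lambda>y. frechet_derivative (\<lambda>y. f y \<bullet> b) (at y) w) differentiable at x"
        by (rule differentiableI[OF has_derivative_transform_within_open[OF _ U]]) (simp add: eq)
    qed
    then show ?thesis using frechet_derivative_inner_left[OF d2] by simp
  qed
  have "Ck_within 2 U (\<lambda>y. f y \<bullet> b)"
    by (rule Ck_within_bounded_linear[OF bounded_linear_inner_left f])
  from second_derivative_symmetric_real[OF U this, of v u]
  show "frechet_derivative (\<lambda>y. frechet_derivative f (at y) v) (at x) u \<bullet> b
       = frechet_derivative (\<lambda>y. frechet_derivative f (at y) u) (at x) v \<bullet> b"
    unfolding * .
qed

section \<open>Families of multilinear maps\<close>

lemma has_derivative_bilin_apply: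
  fixes B :: "'v::real_normed_vector \<Rightarrow> 'e::euclidean_space \<Rightarrow> 'f::euclidean_space \<Rightarrow> 'w::real_normed_vector"
  assumes bil: "\<And>x. x \<in> S \<Longrightarrow> bilinear (B x)" and "x0 \<in> S"
    and B: "\<And>a b. ((\<lambda>x. B x a b) has_derivative B' a b) (at x0 within S)"
    and u: "(u has_derivative u') (at x0 within S)" and v: "(v has_derivative v') (at x0 within S)"
  shows "((\<lambda>x. B x (u x) (v x)) has_derivative
    (\<lambda>h. B' (u x0) (v x0) h + B x0 (u' h) (v x0) + B x0 (u x0) (v' h))) (at x0 within S)"
proof (rule has_derivative_lin_apply[where L = "\<lambda>x b. B x (u x) b" and
      L' = "\<lambda>b h. B' (u x0) b h + B x0 (u' h) b", OF _ \<open>x0 \<in> S\<close> _ v])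
  show "linear (B x (u x))" if "x \<in> S" for x
    using bil[OF that] by (simp add: bilinear_def)
  show "((\<lambda>x. B x (u x) b) has_derivative (\<lambda>h. B' (u x0) b h + B x0 (u' h) b)) (at x0 within S)" for b
    by (rule has_derivative_lin_apply[where L = "\<lambda>x a. B x a b" and L' = "\<lambda>a. B' a b", OF _ \<open>x0 \<in> S\<close> B u])
      (use bil in \<open>simp add: bilinear_def\<close>)
qed

lemma Ck_within_bilin_apply:
  fixes B :: "'v::real_normed_vector \<Rightarrow> 'e::euclidean_space \<Rightarrow> 'f::euclidean_space \<Rightarrow> 'w::real_normed_vector"
  assumes bil: "\<And>x. x \<in> S \<Longrightarrow> bilinear (B x)" and B: "\<And>a b. Ck_within k S (\<lambda>x. B x a b)"
    and u: "Ck_within k S u" and v: "Ck_within k S v"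
  shows "Ck_within k S (\<lambda>x. B x (u x) (v x))"
proof (rule Ck_within_lin_apply[where L = "\<lambda>x b. B x (u x) b", OF _ _ v])
  show "linear (B x (u x))" if "x \<in> S" for x
    using bil[OF that] by (simp add: bilinear_def)
  show "Ck_within k S (\<lambda>x. B x (u x) b)" for b
    by (rule Ck_within_lin_apply[where L = "\<lambda>x a. B x a b", OF _ B u])
      (use bil in \<open>simp add: bilinear_def\<close>)
qed

definition trilinear :: "('e::real_vector \<Rightarrow> 'f::real_vector \<Rightarrow> 'g::real_vector \<Rightarrow> 'w::real_vector) \<Rightarrow> bool"
  where "trilinear S \<longleftrightarrow> (\<forall>u. bilinear (S u)) \<and> (\<forall>v w. linear (\<lambda>u. S u v w))"

lemma trilinearD:
  assumes "trilinear S"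
  shows "S (u + u') v w = S u v w + S u' v w" "S (r *\<^sub>R u) v w = r *\<^sub>R S u v w"
    "S u (v + v') w = S u v w + S u v' w" "S u (r *\<^sub>R v) w = r *\<^sub>R S u v w"
    "S u v (w + w') = S u v w + S u v w'" "S u v (r *\<^sub>R w) = r *\<^sub>R S u v w"
  using assms by (auto simp: trilinear_def bilinear_def linear_iff)

lemma has_derivative_trilin_apply:
  fixes B :: "'v::real_normed_vector \<Rightarrow> 'e::euclidean_space \<Rightarrow> 'f::euclidean_space \<Rightarrow> 'g::euclidean_space
     \<Rightarrow> 'w::real_normed_vector"
  assumes tri: "\<And>x. x \<in> S \<Longrightarrow> trilinear (B x)" and "x0 \<in> S"
    and B: "\<And>a b c. ((\<lambda>x. B x a b c) has_derivative B' a b c) (at x0 within S)"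
    and u: "(u has_derivative u') (at x0 within S)" and v: "(v has_derivative v') (at x0 within S)"
    and w: "(w has_derivative w') (at x0 within S)"
  shows "((\<lambda>x. B x (u x) (v x) (w x)) has_derivative
    (\<lambda>h. B' (u x0) (v x0) (w x0) h + B x0 (u' h) (v x0) (w x0) + B x0 (u x0) (v' h) (w x0)
      + B x0 (u x0) (v x0) (w' h))) (at x0 within S)"
proof (rule has_derivative_bilin_apply[where B = "\<lambda>x b c. B x (u x) b c" and
      B' = "\<lambda>b c h. B' (u x0) b c h + B x0 (u' h) b c", OF _ \<open>x0 \<in> S\<close> _ v w])
  show "bilinear (B x (u x))" if "x \<in> S" for x
    using tri[OF that] by (simp add: trilinear_def)
  show "((\<lambda>x. B x (u x) b c) has_derivative (\<lambda>h. B' (u x0) b c h + B x0 (u' h) b c)) (at x0 within S)" for b c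
    by (rule has_derivative_lin_apply[where L = "\<lambda>x a. B x a b c" and L' = "\<lambda>a. B' a b c", OF _ \<open>x0 \<in> S\<close> B u])
      (use tri in \<open>simp add: trilinear_def\<close>)
qed

lemma Ck_within_trilin_apply:
  fixes B :: "'v::real_normed_vector \<Rightarrow> 'e::euclidean_space \<Rightarrow> 'f::euclidean_space \<Rightarrow> 'g::euclidean_space
     \<Rightarrow> 'w::real_normed_vector"
  assumes tri: "\<And>x. x \<in> S \<Longrightarrow> trilinear (B x)" and B: "\<And>a b c. Ck_within k S (\<lambda>x. B x a b c)"
    and u: "Ck_within k S u" and v: "Ck_within k S v" and w: "Ck_within k S w"
  shows "Ck_within k S (\<lambda>x. B x (u x) (v x) (w x))"
proof (rule Ck_within_bilin_apply[where B = "\<lambda>x b c. B x (u x) b c", OF _ _ v w])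
  show "bilinear (B x (u x))" if "x \<in> S" for x
    using tri[OF that] by (simp add: trilinear_def)
  show "Ck_within k S (\<lambda>x. B x (u x) b c)" for b c
    by (rule Ck_within_lin_apply[where L = "\<lambda>x a. B x a b c", OF _ B u])
      (use tri in \<open>simp add: trilinear_def\<close>)
qed

text \<open>Sums and multiples of derivatives are derivatives. Uniqueness is a premise because this is used both in open sets and in intervals including the end points.\<close>

lemma linear_derivative:
  fixes L :: "'v::real_normed_vector \<Rightarrow> 'f::real_vector \<Rightarrow> 'w::real_normed_vector"
  assumes x0: "x0 \<in> S"
    and unique: "\<And>(f :: 'v \<Rightarrow> 'w) f' f''. (f has_derivative f') (at x0 within S) \<Longrightarrow>
      (f has_derivative f'') (at x0 within S) \<Longrightarrow> f' = f''"
    and lin: "\<And>x. x \<in> S \<Longrightarrow> linear (L x)"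
    and L: "\<And>a. ((\<lambda>x. L x a) has_derivative L' a) (at x0 within S)"
  shows "linear (\<lambda>a. L' a h)"
proof (rule linearI)
  fix a b and r :: real
  have "((\<lambda>x. L x (a + b)) has_derivative (\<lambda>h. L' a h + L' b h)) (at x0 within S)"
    by (rule has_derivative_transform[OF x0 _ has_derivative_add[OF L L]]) (rule linear_add[OF lin])
  from fun_cong[OF unique[OF L this], of h] show "L' (a + b) h = L' a h + L' b h" .
  have "((\<lambda>x. L x (r *\<^sub>R a)) has_derivative (\<lambda>h. r *\<^sub>R L' a h)) (at x0 within S)"
    by (rule has_derivative_transform[OF x0 _ has_derivative_scaleR_right[OF L]]) (rule linear_cmul[OF lin])
  from fun_cong[OF unique[OF L this], of h] show "L' (r *\<^sub>R a) h = r *\<^sub>R L' a h" .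
qed

lemma trilinear_derivative:
  fixes B :: "'v::real_normed_vector \<Rightarrow> 'e::real_vector \<Rightarrow> 'f::real_vector \<Rightarrow> 'g::real_vector
    \<Rightarrow> 'w::real_normed_vector"
  assumes x0: "x0 \<in> S"
    and unique: "\<And>(f :: 'v \<Rightarrow> 'w) f' f''. (f has_derivative f') (at x0 within S) \<Longrightarrow>
      (f has_derivative f'') (at x0 within S) \<Longrightarrow> f' = f''"
    and tri: "\<And>x. x \<in> S \<Longrightarrow> trilinear (B x)"
    and B: "\<And>a b c. ((\<lambda>x. B x a b c) has_derivative B' a b c) (at x0 within S)"
  shows "trilinear (\<lambda>a b c. B' a b c h)"
  unfolding trilinear_def bilinear_def
proof (intro conjI allI)
  show "linear (\<lambda>c. B' a b c h)" for a b
    by (rule linear_derivative[where L = "\<lambda>x. B x a b", OF x0 unique _ B])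
      (use tri in \<open>auto simp: trilinear_def bilinear_def\<close>)
  show "linear (\<lambda>b. B' a b c h)" for a c
    by (rule linear_derivative[where L = "\<lambda>x b. B x a b c", OF x0 unique _ B])
      (use tri in \<open>auto simp: trilinear_def bilinear_def\<close>)
  show "linear (\<lambda>a. B' a b c h)" for b c
    by (rule linear_derivative[where L = "\<lambda>x a. B x a b c", OF x0 unique _ B])
      (use tri in \<open>auto simp: trilinear_def\<close>)
qed

lemma has_derivative_unique_open:
  assumes "open U" "x \<in> U" "(f has_derivative f') (at x within U)" "(f has_derivative f'') (at x within U)"
  shows "f' = f''"
  using has_derivative_unique[of f f' x f''] assms(3,4) unfolding at_within_open[OF assms(2,1)] by blast

lemma Ck_within_frechet_derivative:
  assumes "open U" and "Ck_within (Suc k) U f"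
  shows "Ck_within k U (\<lambda>x. frechet_derivative f (at x) v)"
  using assms(2) unfolding Ck_within_Suc_open[OF assms(1)] by blast

lemma Ck_within_has_derivative:
  assumes "open U" and "Ck_within (Suc 0) U f" and "x \<in> U"
  shows "(f has_derivative frechet_derivative f (at x)) (at x)"
  using assms by (metis Ck_within_Suc_open frechet_derivative_works)

lemma frechet_derivative_eqI: "(f has_derivative f') (at x) \<Longrightarrow> frechet_derivative f (at x) = f'"
  using frechet_derivative_at by metis

section \<open>Charts and changes of coordinates\<close>

locale riemannian =
  fixes M :: "('a::{t2_space,second_countable_topology}, 'e::euclidean_space) rmfd"
  assumes riemannian_manifold: "riemannian_manifold M"
begin

abbreviation overlap :: "'a \<Rightarrow> 'a \<Rightarrow> 'e set"
  where "overlap p p' \<equiv> chart M p ` (chart_dom M p \<inter> chart_dom M p')"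

abbreviation trans_map :: "'a \<Rightarrow> 'a \<Rightarrow> 'e \<Rightarrow> 'e"
  where "trans_map p p' \<equiv> chart M p' \<circ> chart_inv M p"

lemma smooth_manifold: "smooth_manifold M"
  using riemannian_manifold by (simp add: riemannian_manifold_def)

lemma in_own_dom [simp, intro]: "p \<in> chart_dom M p"
  using smooth_manifold by (simp add: smooth_manifold_def)

lemma open_chart_dom: "open (chart_dom M p)"
  using smooth_manifold by (simp add: smooth_manifold_def)

lemma open_chart_img: "open (chart_img M p)"
  using smooth_manifold by (simp add: smooth_manifold_def)

lemma chart_homeomorphism:
  "homeomorphism (chart_dom M p) (chart_img M p) (chart M p) (chart_inv M p)"
  using smooth_manifold by (simp add: smooth_manifold_def)

lemma chart_inv_chart [simp]: "r \<in> chart_dom M p \<Longrightarrow> chart_inv M p (chart M p r) = r"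
  using chart_homeomorphism by (meson homeomorphism_apply1)

lemma chart_in_img [simp, intro]: "r \<in> chart_dom M p \<Longrightarrow> chart M p r \<in> chart_img M p"
  by (simp add: chart_img_def)

lemma open_chart_image:
  assumes "open W" shows "open (chart M p ` (chart_dom M p \<inter> W))"
proof -
  have "openin (top_of_set (chart_img M p)) (chart M p ` (chart_dom M p \<inter> W))"
    using assms by (intro homeomorphism_imp_open_map[OF chart_homeomorphism]) (auto simp: openin_open)
  then show ?thesis using open_chart_img openin_open_trans by blast
qed

lemma open_overlap: "open (overlap p p')"
  by (rule open_chart_image[OF open_chart_dom])

lemma Ck_trans_map: "Ck_within k (overlap p p') (trans_map p p')"
  by (rule Ck_on_imp_Ck_within[OF open_overlap])
    (use smooth_manifold in \<open>simp add: smooth_manifold_def smooth_on_def\<close>)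

lemma change_eq: "change M p p' r = frechet_derivative (trans_map p p') (at (chart M p r))"
  by (simp add: change_def fun_eq_iff)

lemma trans_map_has_derivative:
  assumes "r \<in> chart_dom M p" "r \<in> chart_dom M p'"
  shows "(trans_map p p' has_derivative change M p p' r) (at (chart M p r))"
  unfolding change_eq
  by (rule Ck_within_has_derivative[OF open_overlap Ck_trans_map]) (use assms in blast)

lemma linear_change:
  assumes "r \<in> chart_dom M p" "r \<in> chart_dom M p'"
  shows "linear (change M p p' r)"
  using trans_map_has_derivative[OF assms] by (rule has_derivative_linear)

lemma change_change:
  assumes "r \<in> chart_dom M p" "r \<in> chart_dom M p'" "r \<in> chart_dom M p''"
  shows "change M p' p'' r (change M p p' r u) = change M p p'' r u"
proof -
  define W where "W = chart M p ` (chart_dom M p \<inter> (chart_dom M p' \<inter> chart_dom M p''))"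
  have W: "open W" "chart M p r \<in> W"
    unfolding W_def using assms by (auto intro!: open_chart_image open_Int open_chart_dom)
  have "(trans_map p' p'' has_derivative change M p' p'' r) (at (trans_map p p' (chart M p r)))"
    using trans_map_has_derivative[of r p' p''] assms by simp
  from diff_chain_at[OF trans_map_has_derivative[OF assms(1,2)] this]
  have "(trans_map p p'' has_derivative (change M p' p'' r \<circ> change M p p' r)) (at (chart M p r))"
    by (rule has_derivative_transform_within_open[OF _ W]) (auto simp: W_def)
  from has_derivative_unique[OF this trans_map_has_derivative[OF assms(1,3)]]
  show ?thesis by (metis comp_apply)
qed

lemma change_id [simp]:
  assumes "r \<in> chart_dom M p" shows "change M p p r u = u"
proof -
  have "((\<lambda>y. y) has_derivative (\<lambda>u. u)) (at (chart M p r))" by simp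
  then have "(trans_map p p has_derivative (\<lambda>u. u)) (at (chart M p r))"
    by (rule has_derivative_transform_within_open[OF _ open_chart_img[of p]])
      (use assms in \<open>auto simp: chart_img_def\<close>)
  from has_derivative_unique[OF this trans_map_has_derivative[OF assms assms]]
  show ?thesis by metis
qed

lemma change_inverse [simp]:
  assumes "r \<in> chart_dom M p" "r \<in> chart_dom M p'"
  shows "change M p' p r (change M p p' r u) = u"
  using change_change[OF assms(1,2,1)] assms by simp

text \<open>Tensor fields are differentiated in coordinates, so the derivatives of a change of coordinates are
  indexed by the coordinates of the base point in the first chart.\<close>

definition dtrans :: "'a \<Rightarrow> 'a \<Rightarrow> 'e \<Rightarrow> 'e \<Rightarrow> 'e"
  where "dtrans p p' y u = change M p p' (chart_inv M p y) u"

definition hess :: "'a \<Rightarrow> 'a \<Rightarrow> 'e \<Rightarrow> 'e \<Rightarrow> 'e \<Rightarrow> 'e"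
  where "hess p p' y v u = frechet_derivative (\<lambda>z. dtrans p p' z u) (at y) v"

lemma dtrans_eq: "y \<in> overlap p p' \<Longrightarrow> dtrans p p' y u = frechet_derivative (trans_map p p') (at y) u"
  by (auto simp: dtrans_def change_eq)

lemma dtrans_chart: "r \<in> chart_dom M p \<Longrightarrow> dtrans p p' (chart M p r) = change M p p' r"
  by (simp add: dtrans_def fun_eq_iff)

lemma Ck_dtrans: "Ck_within k (overlap p p') (\<lambda>y. dtrans p p' y u)"
  by (rule Ck_within_cong[OF _ Ck_within_frechet_derivative[OF open_overlap Ck_trans_map]])
    (simp add: dtrans_eq)

lemma linear_dtrans: "y \<in> overlap p p' \<Longrightarrow> linear (dtrans p p' y)"
  by (auto simp: dtrans_chart linear_change)

lemma dtrans_has_derivative: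
  "y \<in> overlap p p' \<Longrightarrow> ((\<lambda>z. dtrans p p' z u) has_derivative (\<lambda>v. hess p p' y v u)) (at y)"
  unfolding hess_def by (rule Ck_within_has_derivative[OF open_overlap Ck_dtrans])

lemma Ck_hess: "Ck_within k (overlap p p') (\<lambda>y. hess p p' y v u)"
  unfolding hess_def by (rule Ck_within_frechet_derivative[OF open_overlap Ck_dtrans])

lemma hess_sym:
  assumes "y \<in> overlap p p'" shows "hess p p' y v u = hess p p' y u v"
proof -
  have *: "hess p p' y v u = frechet_derivative (\<lambda>z. frechet_derivative (trans_map p p') (at z) u) (at y) v" for u v
  proof -
    have "((\<lambda>z. frechet_derivative (trans_map p p') (at z) u) has_derivative (\<lambda>v. hess p p' y v u)) (at y)"
      by (rule has_derivative_transform_within_open[OF dtrans_has_derivative[OF assms] open_overlap assms])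
        (simp add: dtrans_eq)
    from frechet_derivative_eqI[OF this] show ?thesis by simp
  qed
  show ?thesis
    unfolding * by (rule second_derivative_symmetric[OF open_overlap assms Ck_trans_map])
qed

section \<open>The metric in coordinates\<close>

lemma bilinear_metric: "bilinear (metric M p)"
  using riemannian_manifold by (simp add: riemannian_manifold_def)

lemma metric_sym: "metric M p u v = metric M p v u"
  using riemannian_manifold unfolding riemannian_manifold_def by blast

lemma metric_pos: "u \<noteq> 0 \<Longrightarrow> 0 < metric M p u u"
  using riemannian_manifold unfolding riemannian_manifold_def by blast

lemma Ck_local_metric: "Ck_within k (chart_img M p) (\<lambda>y. local_metric M p y u v)"
  using riemannian_manifold Ck_on_imp_Ck_within[OF open_chart_img]
  unfolding riemannian_manifold_def smooth_on_def by blast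

lemma local_metric_chart:
  "r \<in> chart_dom M p \<Longrightarrow> local_metric M p (chart M p r) u v = metric M r (change M p r r u) (change M p r r v)"
  by (simp add: local_metric_def)

lemma local_metric_own: "local_metric M p (chart M p p) = metric M p"
  by (simp add: local_metric_chart fun_eq_iff)

lemma bilinear_local_metric: "y \<in> chart_img M p \<Longrightarrow> bilinear (local_metric M p y)"
  using bilinear_metric linear_change
  by (auto simp: chart_img_def bilinear_def local_metric_chart linear_iff)

lemma local_metric_sym: "local_metric M p y u v = local_metric M p y v u"
  by (simp add: local_metric_def metric_sym)

lemma local_metric_pos:
  assumes "y \<in> chart_img M p" "u \<noteq> 0" shows "0 < local_metric M p y u u"
proof -
  obtain r where r: "r \<in> chart_dom M p" "y = chart M p r" using assms(1) by (auto simp: chart_img_def)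
  have "change M p r r u \<noteq> 0"
    using change_inverse[OF r(1) in_own_dom, of u] linear_0[OF linear_change[OF in_own_dom r(1)]] assms(2)
    by (metis (full_types))
  then show ?thesis using r by (simp add: local_metric_chart metric_pos)
qed

lemma local_metric_change:
  assumes "r \<in> chart_dom M p" "r \<in> chart_dom M p'"
  shows "local_metric M p' (chart M p' r) (change M p p' r u) (change M p p' r v) = local_metric M p (chart M p r) u v"
  using assms by (simp add: local_metric_chart change_change)

lemma local_metric_eqD:
  assumes y: "y \<in> chart_img M p" and eq: "\<And>w. local_metric M p y z w = local_metric M p y z' w"
  shows "z = z'"
proof (rule ccontr)
  assume "z \<noteq> z'"
  then have "0 < local_metric M p y (z - z') (z - z')" using local_metric_pos[OF y] by simp
  also have "\<dots> = 0" using eq bilinear_lsub[OF bilinear_local_metric[OF y]] by simp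
  finally show False by simp
qed

lemma Ck_local_metric_apply:
  "Ck_within k (chart_img M p) u \<Longrightarrow> Ck_within k (chart_img M p) v \<Longrightarrow>
    Ck_within k (chart_img M p) (\<lambda>y. local_metric M p y (u y) (v y))"
  by (rule Ck_within_bilin_apply[OF bilinear_local_metric Ck_local_metric])

text \<open>A smooth orthogonal frame solves linear equations \<open>g(Z,w) = L(w)\<close> by an explicit formula that is
  smooth in the base point. This is how the Christoffel symbols and the gradient, which are defined by such
  equations, are seen to exist and to be smooth.\<close>

definition orthogonal_frame :: "'a \<Rightarrow> 'e set \<Rightarrow> ('e \<Rightarrow> 'e \<Rightarrow> 'e) \<Rightarrow> bool"
  where "orthogonal_frame p B e \<longleftrightarrow> (\<forall>b\<in>B. \<forall>k. Ck_within k (chart_img M p) (e b)) \<and>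
    (\<forall>y\<in>chart_img M p. (\<forall>b\<in>B. e b y \<noteq> 0) \<and>
      (\<forall>b\<in>B. \<forall>c\<in>B. b \<noteq> c \<longrightarrow> local_metric M p y (e b y) (e c y) = 0) \<and>
      span ((\<lambda>b. e b y) ` B) = span B)"

text \<open>Gram-Schmidt orthogonalization of the standard basis. The vectors are not normalized, so only
  division by nonvanishing smooth functions is used.\<close>

lemma orthogonal_frame_exists:
  assumes "B \<subseteq> Basis" shows "\<exists>e. orthogonal_frame p B e"
  using finite_subset[OF assms finite_Basis] assms
proof (induction B rule: finite_induct)
  case empty
  then show ?case by (simp add: orthogonal_frame_def)
next
  case (insert b B)
  then obtain e where e: "orthogonal_frame p B e" by auto
  define s where "s y = (\<Sum>d\<in>B. (local_metric M p y b (e d y) * inverse (local_metric M p y (e d y) (e d y))) *\<^sub>R e d y)" for y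
  define e' where "e' d y = (if d = b then b - s y else e d y)" for d y
  have ne: "e d y \<noteq> 0" if "d \<in> B" "y \<in> chart_img M p" for d y
    using e that unfolding orthogonal_frame_def by blast
  have orth: "local_metric M p y (e d y) (e c y) = 0" if "d \<in> B" "c \<in> B" "d \<noteq> c" "y \<in> chart_img M p" for c d y
    using e that unfolding orthogonal_frame_def by blast
  have sp: "span ((\<lambda>b. e b y) ` B) = span B" if "y \<in> chart_img M p" for y
    using e that unfolding orthogonal_frame_def by blast
  have Ce: "Ck_within k (chart_img M p) (e d)" if "d \<in> B" for d k
    using e that unfolding orthogonal_frame_def by blast
  have gne: "local_metric M p y (e d y) (e d y) \<noteq> 0" if "d \<in> B" "y \<in> chart_img M p" for d y
    using local_metric_pos[OF that(2) ne[OF that]] by simp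
  have Cs: "Ck_within k (chart_img M p) s" for k
    unfolding s_def
    by (intro Ck_within_sum Ck_within_scaleR Ck_within_mult Ck_within_inverse Ck_local_metric_apply Ck_within_const Ce gne)
  have s_span: "s y \<in> span B" if "y \<in> chart_img M p" for y
    unfolding s_def sp[OF that, symmetric] by (intro span_sum span_scale span_base) auto
  have gs: "local_metric M p y (b - s y) (e c y) = 0" if "c \<in> B" "y \<in> chart_img M p" for c y
  proof -
    note bl = bilinear_local_metric[OF that(2)]
    then have lin: "linear (\<lambda>x. local_metric M p y x (e c y))" by (simp add: bilinear_def)
    have "local_metric M p y (s y) (e c y) = (\<Sum>d\<in>B. (local_metric M p y b (e d y) * inverse (local_metric M p y (e d y) (e d y))) *
        local_metric M p y (e d y) (e c y))"
      unfolding s_def by (simp add: linear_sum[OF lin] linear_cmul[OF lin])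
    also have "\<dots> = (\<Sum>d\<in>B. if d = c then local_metric M p y b (e c y) else 0)"
      using gne[OF that] orth[OF _ that(1) _ that(2)] by (intro sum.cong) auto
    also have "\<dots> = local_metric M p y b (e c y)" using that insert.hyps by simp
    finally show ?thesis using bilinear_lsub[OF bl] by simp
  qed
  have "orthogonal_frame p (insert b B) e'"
    unfolding orthogonal_frame_def
  proof (intro conjI ballI allI impI)
    fix d k assume "d \<in> insert b B"
    then show "Ck_within k (chart_img M p) (e' d)"
      using Ce Cs insert.hyps unfolding e'_def by (cases "d = b") (auto intro: Ck_within_diff Ck_within_const)
  next
    fix y d assume y: "y \<in> chart_img M p" and d: "d \<in> insert b B"
    have "b \<notin> span B"
      using insert.prems insert.hyps independent_Basis independent_mono[OF independent_Basis insert.prems]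
      by (simp add: independent_insert)
    then have "b - s y \<noteq> 0" using s_span[OF y] by auto
    then show "e' d y \<noteq> 0" using d ne y by (auto simp: e'_def)
  next
    fix y d c assume "y \<in> chart_img M p" "d \<in> insert b B" "c \<in> insert b B" "d \<noteq> c"
    then show "local_metric M p y (e' d y) (e' c y) = 0"
      using orth gs local_metric_sym by (auto simp: e'_def)
  next
    fix y assume y: "y \<in> chart_img M p"
    have "(\<lambda>d. e' d y) ` insert b B = insert (b - s y) ((\<lambda>d. e d y) ` B)"
      using insert.hyps by (auto simp: e'_def)
    moreover have "span (insert (b - s y) ((\<lambda>d. e d y) ` B)) = span (insert b B)"
    proof -
      have "x - k *\<^sub>R (b - s y) \<in> span B \<longleftrightarrow> x - k *\<^sub>R b \<in> span B" for x k
      proof -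
        have eq: "x - k *\<^sub>R (b - s y) = (x - k *\<^sub>R b) + k *\<^sub>R s y" by (simp add: algebra_simps)
        show ?thesis
          unfolding eq by (rule span_add_eq2[OF span_scale[OF s_span[OF y]]])
      qed
      then show ?thesis unfolding span_insert sp[OF y] by simp
    qed
    ultimately show "span ((\<lambda>d. e' d y) ` insert b B) = span (insert b B)" by simp
  qed
  then show ?case by blast
qed

definition frame :: "'a \<Rightarrow> 'e \<Rightarrow> 'e \<Rightarrow> 'e"
  where "frame p = (SOME e. orthogonal_frame p Basis e)"

lemma orthogonal_frame_frame: "orthogonal_frame p Basis (frame p)"
  unfolding frame_def by (rule someI_ex[OF orthogonal_frame_exists]) simp

lemma Ck_frame: "b \<in> Basis \<Longrightarrow> Ck_within k (chart_img M p) (frame p b)"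
  using orthogonal_frame_frame unfolding orthogonal_frame_def by blast

lemma frame_metric_pos: "b \<in> Basis \<Longrightarrow> y \<in> chart_img M p \<Longrightarrow> 0 < local_metric M p y (frame p b y) (frame p b y)"
  using orthogonal_frame_frame local_metric_pos unfolding orthogonal_frame_def by blast

definition riesz :: "'a \<Rightarrow> 'e \<Rightarrow> ('e \<Rightarrow> real) \<Rightarrow> 'e"
  where "riesz p y L = (\<Sum>b\<in>Basis. (L (frame p b y) * inverse (local_metric M p y (frame p b y) (frame p b y))) *\<^sub>R frame p b y)"

lemma riesz:
  assumes y: "y \<in> chart_img M p" and L: "linear L"
  shows "local_metric M p y (riesz p y L) w = L w"
proof -
  note bl = bilinear_local_metric[OF y]
  have lin1: "linear (\<lambda>x. local_metric M p y x w)" and lin2: "linear (local_metric M p y x)" for x w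
    using bl by (auto simp: bilinear_def)
  have "local_metric M p y (riesz p y L) (frame p c y) = L (frame p c y)" if c: "c \<in> Basis" for c
  proof -
    have "local_metric M p y (riesz p y L) (frame p c y) = (\<Sum>b\<in>Basis.
      (L (frame p b y) * inverse (local_metric M p y (frame p b y) (frame p b y))) * local_metric M p y (frame p b y) (frame p c y))"
      unfolding riesz_def by (simp add: linear_sum[OF lin1] linear_cmul[OF lin1])
    also have "\<dots> = (\<Sum>b\<in>Basis. if b = c then L (frame p c y) else 0)"
      using frame_metric_pos[OF c y] orthogonal_frame_frame[of p] y c unfolding orthogonal_frame_def
      by (intro sum.cong) auto
    also have "\<dots> = L (frame p c y)" using c by simp
    finally show ?thesis .
  qed
  moreover have "w \<in> span ((\<lambda>b. frame p b y) ` Basis)"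
    using orthogonal_frame_frame[of p] y unfolding orthogonal_frame_def by simp
  ultimately show ?thesis
    using linear_eq_on_span[OF lin2 L, of "(\<lambda>b. frame p b y) ` Basis"] by blast
qed

lemma Ck_riesz:
  assumes "\<And>y. y \<in> chart_img M p \<Longrightarrow> linear (L y)" and "\<And>u. Ck_within k (chart_img M p) (\<lambda>y. L y u)"
  shows "Ck_within k (chart_img M p) (\<lambda>y. riesz p y (L y))"
  unfolding riesz_def
proof (intro Ck_within_sum Ck_within_scaleR Ck_within_mult Ck_within_inverse Ck_local_metric_apply Ck_frame)
  show "Ck_within k (chart_img M p) (\<lambda>y. L y (frame p b y))" if "b \<in> Basis" for b
    by (rule Ck_within_lin_apply[OF assms Ck_frame[OF that]])
  show "local_metric M p y (frame p b y) (frame p b y) \<noteq> 0" if "b \<in> Basis" "y \<in> chart_img M p" for b y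
    using frame_metric_pos[OF that] by simp
qed

section \<open>The Levi-Civita connection\<close>

definition dmetric :: "'a \<Rightarrow> 'e \<Rightarrow> 'e \<Rightarrow> 'e \<Rightarrow> 'e \<Rightarrow> real"
  where "dmetric p y u v w = frechet_derivative (\<lambda>z. local_metric M p z v w) (at y) u"

lemma local_metric_has_derivative:
  "y \<in> chart_img M p \<Longrightarrow> ((\<lambda>z. local_metric M p z v w) has_derivative (\<lambda>u. dmetric p y u v w)) (at y)"
  unfolding dmetric_def by (rule Ck_within_has_derivative[OF open_chart_img Ck_local_metric])

lemma Ck_dmetric: "Ck_within k (chart_img M p) (\<lambda>y. dmetric p y u v w)"
  unfolding dmetric_def by (rule Ck_within_frechet_derivative[OF open_chart_img Ck_local_metric])

lemma dmetric_sym: "dmetric p y u v w = dmetric p y u w v"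
  unfolding dmetric_def by (subst local_metric_sym) simp

lemma linear_dmetric1: "y \<in> chart_img M p \<Longrightarrow> linear (\<lambda>u. dmetric p y u v w)"
  using local_metric_has_derivative by (rule has_derivative_linear)

lemma linear_dmetric3:
  assumes y: "y \<in> chart_img M p" shows "linear (dmetric p y u v)"
  by (rule linear_derivative[where L = "\<lambda>z. local_metric M p z v", OF y has_derivative_unique_open[OF open_chart_img y]])
    (use bilinear_local_metric local_metric_has_derivative[OF y] in
      \<open>auto simp: bilinear_def at_within_open[OF y open_chart_img]\<close>)

lemma linear_dmetric2: "y \<in> chart_img M p \<Longrightarrow> linear (\<lambda>v. dmetric p y u v w)"
  using linear_dmetric3[of y p u w] by (simp add: dmetric_sym[of p y u _ w])

text \<open>Half the right-hand side of the Koszul formula for fields with constant components.\<close>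

definition koszul :: "'a \<Rightarrow> 'e \<Rightarrow> 'e \<Rightarrow> 'e \<Rightarrow> 'e \<Rightarrow> real"
  where "koszul p y u v w = (dmetric p y u v w + dmetric p y v u w - dmetric p y w u v) / 2"

definition levi_civita :: "'a \<Rightarrow> 'e \<Rightarrow> ('e \<Rightarrow> 'e \<Rightarrow> 'e) \<Rightarrow> bool"
  where "levi_civita p y \<Gamma> \<longleftrightarrow> (\<forall>u v. \<Gamma> u v = \<Gamma> v u) \<and> (\<forall>u v w. dmetric p y u v w =
      local_metric M p y (\<Gamma> u v) w + local_metric M p y v (\<Gamma> u w))"

text \<open>Compatibility for the three cyclic permutations of \<open>u\<close>, \<open>v\<close>, \<open>w\<close>; by symmetry all terms but one
  cancel in the alternating sum.\<close>

lemma levi_civita_koszul: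
  assumes "levi_civita p y \<Gamma>"
  shows "local_metric M p y (\<Gamma> u v) w = koszul p y u v w"
proof -
  have s: "\<Gamma> u v = \<Gamma> v u" for u v using assms by (simp add: levi_civita_def)
  have c: "dmetric p y u v w = local_metric M p y (\<Gamma> u v) w + local_metric M p y v (\<Gamma> u w)" for u v w
    using assms by (simp add: levi_civita_def)
  show ?thesis
    unfolding koszul_def c s[of v u] s[of w u] s[of w v]
      local_metric_sym[of p y v "\<Gamma> u w"] local_metric_sym[of p y u "\<Gamma> v w"] by simp
qed

lemma levi_civita_unique:
  assumes "y \<in> chart_img M p" "levi_civita p y \<Gamma>" "levi_civita p y \<Gamma>'" shows "\<Gamma> = \<Gamma>'"
  using levi_civita_koszul[OF assms(2)] levi_civita_koszul[OF assms(3)] local_metric_eqD[OF assms(1)]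
  by (metis ext)

lemma linear_koszul3: "y \<in> chart_img M p \<Longrightarrow> linear (koszul p y u v)"
  unfolding koszul_def using linear_dmetric1 linear_dmetric2 linear_dmetric3
  by (auto simp: linear_iff algebra_simps add_divide_distrib diff_divide_distrib)

lemma levi_civita_exists:
  assumes y: "y \<in> chart_img M p" shows "levi_civita p y (\<lambda>u v. riesz p y (koszul p y u v))"
  unfolding levi_civita_def
proof (intro conjI allI)
  fix u v w
  have "koszul p y u v = koszul p y v u" for u v
    by (simp add: koszul_def fun_eq_iff dmetric_sym[of p y _ u v])
  then show "riesz p y (koszul p y u v) = riesz p y (koszul p y v u)" by simp
  show "dmetric p y u v w = local_metric M p y (riesz p y (koszul p y u v)) w
     + local_metric M p y v (riesz p y (koszul p y u w))"
    unfolding local_metric_sym[of p y v] riesz[OF y linear_koszul3[OF y]] koszul_def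
      dmetric_sym[of p y _ w v] dmetric_sym[of p y _ w u] dmetric_sym[of p y _ v u]
    by (simp add: field_simps)
qed

lemma levi_civita_christoffel:
  assumes y: "y \<in> chart_img M p" shows "levi_civita p y (christoffel M p y)"
proof -
  have "christoffel M p y = (THE \<Gamma>. levi_civita p y \<Gamma>)"
    unfolding christoffel_def levi_civita_def dmetric_def ..
  moreover have "levi_civita p y (THE \<Gamma>. levi_civita p y \<Gamma>)"
    by (rule theI[where P = "levi_civita p y", OF levi_civita_exists[OF y]])
      (rule levi_civita_unique[OF y _ levi_civita_exists[OF y]])
  ultimately show ?thesis by simp
qed

lemma christoffel_eq: "y \<in> chart_img M p \<Longrightarrow> christoffel M p y u v = riesz p y (koszul p y u v)"
  using levi_civita_unique[OF _ levi_civita_christoffel levi_civita_exists] by metis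

lemma christoffel_sym: "y \<in> chart_img M p \<Longrightarrow> christoffel M p y u v = christoffel M p y v u"
  using levi_civita_christoffel unfolding levi_civita_def by blast

lemma christoffel_compat: "y \<in> chart_img M p \<Longrightarrow> dmetric p y u v w =
      local_metric M p y (christoffel M p y u v) w + local_metric M p y v (christoffel M p y u w)"
  using levi_civita_christoffel unfolding levi_civita_def by blast

lemma Ck_christoffel: "Ck_within k (chart_img M p) (\<lambda>y. christoffel M p y u v)"
proof (rule Ck_within_cong[OF christoffel_eq[symmetric]])
  have "Ck_within k (chart_img M p) (\<lambda>y. koszul p y u v w)" for w
    unfolding koszul_def divide_inverse
    by (intro Ck_within_mult Ck_within_add Ck_within_diff Ck_dmetric Ck_within_const)
  then show "Ck_within k (chart_img M p) (\<lambda>y. riesz p y (koszul p y u v))"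
    by (intro Ck_riesz linear_koszul3)
qed

lemma bilinear_christoffel:
  assumes y: "y \<in> chart_img M p" shows "bilinear (christoffel M p y)"
proof -
  have k: "local_metric M p y (christoffel M p y u v) w = koszul p y u v w" for u v w
    using levi_civita_koszul[OF levi_civita_christoffel[OF y]] .
  note bl = bilinear_local_metric[OF y]
  have "linear (\<lambda>u. koszul p y u v w)" for v w
    unfolding koszul_def using linear_dmetric1[OF y] linear_dmetric2[OF y] linear_dmetric3[OF y]
    by (auto simp: linear_iff algebra_simps add_divide_distrib diff_divide_distrib)
  note kl = this
  have "linear (\<lambda>u. christoffel M p y u v)" for v
    by (intro linearI local_metric_eqD[OF y])
      (simp_all add: k bilinear_ladd[OF bl] bilinear_lmul[OF bl] linear_add[OF kl] linear_cmul[OF kl])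
  moreover have "christoffel M p y u = (\<lambda>v. christoffel M p y v u)" for u
    using christoffel_sym[OF y] by (rule ext)
  ultimately show ?thesis
    unfolding bilinear_def by metis
qed

end

context riemannian
begin

section \<open>Covariance of the connection and of the curvature\<close>

lemma overlap_imgD: "y \<in> overlap p p' \<Longrightarrow> y \<in> chart_img M p"
  by (auto simp: chart_img_def)

lemma trans_map_img: "y \<in> overlap p p' \<Longrightarrow> trans_map p p' y \<in> chart_img M p'"
  by (auto simp: chart_img_def)

lemma trans_map_has_derivative':
  "y \<in> overlap p p' \<Longrightarrow> (trans_map p p' has_derivative dtrans p p' y) (at y)"
  using trans_map_has_derivative by (auto simp: dtrans_chart)

lemma dtrans_inverse:
  "y \<in> overlap p p' \<Longrightarrow> dtrans p p' y (dtrans p' p (trans_map p p' y) u) = u"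
  by (auto simp: dtrans_chart)

lemma local_metric_dtrans: "y \<in> overlap p p' \<Longrightarrow>
   local_metric M p' (trans_map p p' y) (dtrans p p' y u) (dtrans p p' y v) = local_metric M p y u v"
  by (auto simp: dtrans_chart local_metric_change)

lemma has_derivative_pullback:
  assumes "y \<in> overlap p p'" and "(f has_derivative f') (at (trans_map p p' y))"
  shows "((\<lambda>z. f (trans_map p p' z)) has_derivative (\<lambda>h. f' (dtrans p p' y h))) (at y)"
  using has_derivative_compose[OF trans_map_has_derivative'[OF assms(1)] assms(2)] .

lemma dtrans_apply_has_derivative:
  assumes y: "y \<in> overlap p p'" and Z: "(Z has_derivative Z') (at y)"
  shows "((\<lambda>z. dtrans p p' z (Z z)) has_derivative (\<lambda>h. hess p p' y h (Z y) + dtrans p p' y (Z' h))) (at y)"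
  using has_derivative_lin_apply[where L = "dtrans p p'" and L' = "\<lambda>a h. hess p p' y h a",
      OF linear_dtrans y, of Z Z'] dtrans_has_derivative[OF y] Z
  by (simp only: at_within_open[OF y open_overlap])

text \<open>Solving this law for the Christoffel symbols of the first chart defines a symmetric map.
  Differentiating the invariance of the metric shows that this map is compatible with the metric, so it
  is the Levi-Civita connection by uniqueness.\<close>

lemma christoffel_change:
  assumes y: "y \<in> overlap p p'"
  shows "dtrans p p' y (christoffel M p y u v)
    = christoffel M p' (trans_map p p' y) (dtrans p p' y u) (dtrans p p' y v) + hess p p' y u v"
proof -
  let ?A = "dtrans p p' y" and ?B = "dtrans p' p (trans_map p p' y)"
  let ?\<Gamma>' = "christoffel M p' (trans_map p p' y)"
  define G where "G u v = ?B (?\<Gamma>' (?A u) (?A v) + hess p p' y u v)" for u v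
  have AG: "?A (G u v) = ?\<Gamma>' (?A u) (?A v) + hess p p' y u v" for u v
    unfolding G_def using dtrans_inverse[OF y] .
  have "levi_civita p y G"
    unfolding levi_civita_def
  proof (intro conjI allI)
    show "G u v = G v u" for u v
      unfolding G_def using christoffel_sym[OF trans_map_img[OF y]] hess_sym[OF y] by metis
    fix u v w
    let ?g = "local_metric M p' (trans_map p p' y)"
    have "((\<lambda>z. local_metric M p' (trans_map p p' z) (dtrans p p' z v) (dtrans p p' z w)) has_derivative
        (\<lambda>h. dmetric p' (trans_map p p' y) (?A h) (?A v) (?A w) + ?g (hess p p' y h v) (?A w) + ?g (?A v) (hess p p' y h w)))
        (at y within overlap p p')"
      by (rule has_derivative_bilin_apply[where S = "overlap p p'" and
          B' = "\<lambda>v w h. dmetric p' (trans_map p p' y) (?A h) v w", OF bilinear_local_metric[OF trans_map_img] y])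
        (use y in \<open>auto simp only: at_within_open[OF y open_overlap]
            intro!: has_derivative_pullback local_metric_has_derivative trans_map_img dtrans_has_derivative\<close>)
    then have "((\<lambda>z. local_metric M p z v w) has_derivative
        (\<lambda>h. dmetric p' (trans_map p p' y) (?A h) (?A v) (?A w) + ?g (hess p p' y h v) (?A w) + ?g (?A v) (hess p p' y h w)))
        (at y)"
      unfolding at_within_open[OF y open_overlap]
      by (rule has_derivative_transform_within_open[OF _ open_overlap y]) (rule local_metric_dtrans)
    from frechet_derivative_eqI[OF this]
    have "dmetric p y u v w = dmetric p' (trans_map p p' y) (?A u) (?A v) (?A w)
        + ?g (hess p p' y u v) (?A w) + ?g (?A v) (hess p p' y u w)"
      by (simp add: dmetric_def)
    also have "\<dots> = ?g (?A (G u v)) (?A w) + ?g (?A v) (?A (G u w))"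
      unfolding AG christoffel_compat[OF trans_map_img[OF y]]
        bilinear_ladd[OF bilinear_local_metric[OF trans_map_img[OF y]]]
        bilinear_radd[OF bilinear_local_metric[OF trans_map_img[OF y]]] by simp
    also have "\<dots> = local_metric M p y (G u v) w + local_metric M p y v (G u w)"
      by (simp only: local_metric_dtrans[OF y])
    finally show "dmetric p y u v w = local_metric M p y (G u v) w + local_metric M p y v (G u w)" .
  qed
  then have "christoffel M p y = G"
    by (rule levi_civita_unique[OF overlap_imgD[OF y] levi_civita_christoffel[OF overlap_imgD[OF y]]])
  then show ?thesis using AG by simp
qed

definition dchr :: "'a \<Rightarrow> 'e \<Rightarrow> 'e \<Rightarrow> 'e \<Rightarrow> 'e \<Rightarrow> 'e"
  where "dchr p y u v w = frechet_derivative (\<lambda>z. christoffel M p z v w) (at y) u"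

lemma christoffel_has_derivative:
  "y \<in> chart_img M p \<Longrightarrow> ((\<lambda>z. christoffel M p z v w) has_derivative (\<lambda>u. dchr p y u v w)) (at y)"
  unfolding dchr_def by (rule Ck_within_has_derivative[OF open_chart_img Ck_christoffel])

lemma Ck_dchr: "Ck_within k (chart_img M p) (\<lambda>y. dchr p y u v w)"
  unfolding dchr_def by (rule Ck_within_frechet_derivative[OF open_chart_img Ck_christoffel])

lemma nabla_const: "nabla M p X (\<lambda>_. w) y = christoffel M p y (X y) w"
  by (simp add: nabla_def frechet_derivative_eqI[OF has_derivative_const])

lemma local_curv_eq:
  assumes y: "y \<in> chart_img M p"
  shows "local_curv M p y u v w = dchr p y u v w + christoffel M p y u (christoffel M p y v w)
     - (dchr p y v u w + christoffel M p y v (christoffel M p y u w))"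
proof -
  have "nabla M p (\<lambda>_. v) (\<lambda>_. w) = (\<lambda>z. christoffel M p z v w)" for v w
    by (rule ext) (rule nabla_const)
  then show ?thesis
    unfolding local_curv_def curv_op_def lie_bracket_def
    by (simp add: nabla_const frechet_derivative_eqI[OF has_derivative_const] bilinear_lzero[OF bilinear_christoffel[OF y]])
      (simp add: nabla_def dchr_def)
qed

lemma Ck_christoffel_apply:
  assumes "Ck_within k (chart_img M p) u" "Ck_within k (chart_img M p) v"
  shows "Ck_within k (chart_img M p) (\<lambda>y. christoffel M p y (u y) (v y))"
  by (rule Ck_within_bilin_apply[OF bilinear_christoffel Ck_christoffel assms])

lemma Ck_local_curv: "Ck_within k (chart_img M p) (\<lambda>y. local_curv M p y u v w)"
  by (rule Ck_within_cong[OF local_curv_eq[symmetric]])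
    (auto intro!: Ck_within_add Ck_within_diff Ck_dchr Ck_christoffel_apply Ck_within_const Ck_christoffel)

lemma dchr_linear1: "y \<in> chart_img M p \<Longrightarrow> linear (\<lambda>u. dchr p y u v w)"
  using christoffel_has_derivative by (rule has_derivative_linear)

lemma dchr_linear2:
  assumes y: "y \<in> chart_img M p" shows "linear (\<lambda>v. dchr p y u v w)"
  by (rule linear_derivative[where L = "\<lambda>z v. christoffel M p z v w", OF y has_derivative_unique_open[OF open_chart_img y]])
    (use bilinear_christoffel christoffel_has_derivative[OF y] in
      \<open>auto simp: bilinear_def at_within_open[OF y open_chart_img]\<close>)

lemma dchr_sym: 
  assumes y: "y \<in> chart_img M p" shows "dchr p y u v w = dchr p y u w v"
proof -
  have "((\<lambda>z. christoffel M p z v w) has_derivative (\<lambda>u. dchr p y u w v)) (at y)"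
    by (rule has_derivative_transform_within_open[OF christoffel_has_derivative[OF y] open_chart_img y])
      (rule christoffel_sym)
  from frechet_derivative_eqI[OF this] show ?thesis by (simp add: dchr_def)
qed

lemma dchr_linear3: "y \<in> chart_img M p \<Longrightarrow> linear (dchr p y u v)"
  by (subst ext[where g = "\<lambda>w. dchr p y u w v", OF dchr_sym]) (auto intro: dchr_linear2)

lemma trilinear_local_curv:
  assumes y: "y \<in> chart_img M p" shows "trilinear (local_curv M p y)"
proof -
  note b = bilinear_christoffel[OF y]
  note l = linear_add[OF dchr_linear1[OF y]] linear_add[OF dchr_linear2[OF y]] linear_add[OF dchr_linear3[OF y]]
    linear_cmul[OF dchr_linear1[OF y]] linear_cmul[OF dchr_linear2[OF y]] linear_cmul[OF dchr_linear3[OF y]]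
    bilinear_ladd[OF b] bilinear_radd[OF b] bilinear_lmul[OF b] bilinear_rmul[OF b]
  show ?thesis
    unfolding trilinear_def bilinear_def linear_iff local_curv_eq[OF y]
    by (simp add: l algebra_simps)
qed

text \<open>Differentiating the transformation law of the Christoffel symbols expresses
  \<open>\<partial>\<^sub>u \<Gamma>(v,w) + \<Gamma>(u,\<Gamma>(v,w))\<close> in the second chart up to terms that involve the second and third
  derivatives of the change of coordinates. These are symmetric in \<open>u\<close> and \<open>v\<close> and drop out of the
  curvature.\<close>

lemma local_curv_change:
  assumes y: "y \<in> overlap p p'"
  shows "dtrans p p' y (local_curv M p y u v w)
    = local_curv M p' (trans_map p p' y) (dtrans p p' y u) (dtrans p p' y v) (dtrans p p' y w)"
proof -
  let ?A = "dtrans p p' y" and ?H = "hess p p' y"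
  let ?y' = "trans_map p p' y"
  let ?\<Gamma>' = "christoffel M p' ?y'" and ?\<Gamma> = "christoffel M p y"
  note yi = overlap_imgD[OF y] and yi' = trans_map_img[OF y]
  note bl = bilinear_christoffel[OF yi']
  define h3 where "h3 u v w = frechet_derivative (\<lambda>z. hess p p' z v w) (at y) u" for u v w
  have h3: "((\<lambda>z. hess p p' z v w) has_derivative (\<lambda>u. h3 u v w)) (at y)" for v w
    unfolding h3_def by (rule Ck_within_has_derivative[OF open_overlap Ck_hess y])
  have h3_sym: "h3 u v w = h3 v u w" for u v w
    unfolding h3_def hess_def by (rule second_derivative_symmetric[OF open_overlap y Ck_dtrans])
  have key: "?A (dchr p y u v w + ?\<Gamma> u (?\<Gamma> v w)) =
     dchr p' ?y' (?A u) (?A v) (?A w) + ?\<Gamma>' (?A u) (?\<Gamma>' (?A v) (?A w))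
     + (?\<Gamma>' (?H u v) (?A w) + ?\<Gamma>' (?A v) (?H u w) + ?\<Gamma>' (?A u) (?H v w) + h3 u v w)" for u v w
  proof -
    note d1 = dtrans_apply_has_derivative[OF y christoffel_has_derivative[OF yi]]
    have "((\<lambda>z. christoffel M p' (trans_map p p' z) (dtrans p p' z v) (dtrans p p' z w)) has_derivative
        (\<lambda>h. dchr p' ?y' (?A h) (?A v) (?A w) + ?\<Gamma>' (?H h v) (?A w) + ?\<Gamma>' (?A v) (?H h w)))
        (at y within overlap p p')"
      by (rule has_derivative_bilin_apply[where S = "overlap p p'" and
          B' = "\<lambda>v w h. dchr p' ?y' (?A h) v w", OF bilinear_christoffel[OF trans_map_img] y])
        (use y in \<open>auto simp only: at_within_open[OF y open_overlap]
            intro!: has_derivative_pullback christoffel_has_derivative trans_map_img dtrans_has_derivative\<close>)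
    from has_derivative_add[OF this[unfolded at_within_open[OF y open_overlap]] h3]
    have "((\<lambda>z. dtrans p p' z (christoffel M p z v w)) has_derivative
        (\<lambda>h. dchr p' ?y' (?A h) (?A v) (?A w) + ?\<Gamma>' (?H h v) (?A w) + ?\<Gamma>' (?A v) (?H h w) + h3 h v w)) (at y)"
      by (rule has_derivative_transform_within_open[OF _ open_overlap y]) (simp only: christoffel_change)
    from fun_cong[OF has_derivative_unique[OF d1 this], of u]
    have e: "?H u (?\<Gamma> v w) + ?A (dchr p y u v w) = dchr p' ?y' (?A u) (?A v) (?A w) + ?\<Gamma>' (?H u v) (?A w) + ?\<Gamma>' (?A v) (?H u w) + h3 u v w" .
    have "?A (?\<Gamma> u (?\<Gamma> v w)) = ?\<Gamma>' (?A u) (?\<Gamma>' (?A v) (?A w)) + ?\<Gamma>' (?A u) (?H v w) + ?H u (?\<Gamma> v w)"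
      unfolding christoffel_change[OF y] bilinear_radd[OF bl] by simp
    then show ?thesis
      unfolding linear_add[OF linear_dtrans[OF y]] using e by (simp add: algebra_simps)
  qed
  show ?thesis
    unfolding local_curv_eq[OF yi] local_curv_eq[OF yi'] linear_diff[OF linear_dtrans[OF y]] key
      hess_sym[OF y, of v u] h3_sym[of v u]
    by (simp add: algebra_simps)
qed

section \<open>Covariant derivatives of tensor fields\<close>

definition tensor_field :: "('a \<Rightarrow> 'e \<Rightarrow> 'e \<Rightarrow> 'e \<Rightarrow> 'e \<Rightarrow> 'e) \<Rightarrow> bool"
  where "tensor_field S \<longleftrightarrow> (\<forall>p. \<forall>y\<in>chart_img M p. trilinear (S p y)) \<and>
    (\<forall>p u v w k. Ck_within k (chart_img M p) (\<lambda>y. S p y u v w)) \<and>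
    (\<forall>p p' u v w. \<forall>y\<in>overlap p p'. dtrans p p' y (S p y u v w)
      = S p' (trans_map p p' y) (dtrans p p' y u) (dtrans p p' y v) (dtrans p p' y w))"

lemma tensor_field_local_curv: "tensor_field (local_curv M)"
  unfolding tensor_field_def using trilinear_local_curv Ck_local_curv local_curv_change by blast

definition nabla_tensor :: "('a \<Rightarrow> 'e \<Rightarrow> 'e \<Rightarrow> 'e \<Rightarrow> 'e \<Rightarrow> 'e) \<Rightarrow> 'a \<Rightarrow> 'e \<Rightarrow> 'e \<Rightarrow> 'e \<Rightarrow> 'e \<Rightarrow> 'e \<Rightarrow> 'e"
  where "nabla_tensor S p y a u v w =
    frechet_derivative (\<lambda>z. S p z u v w) (at y) a + christoffel M p y a (S p y u v w)
     - S p y (christoffel M p y a u) v w - S p y u (christoffel M p y a v) w - S p y u v (christoffel M p y a w)"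

lemma nabla_curv_eq: "nabla_curv M p a u v w = nabla_tensor (local_curv M) p (chart M p p) a u v w"
  by (simp add: nabla_curv_def Let_def nabla_tensor_def nabla_const) (simp add: nabla_def)

text \<open>The second derivatives of the change of coordinates that arise from differentiating the
  transformation law of the tensor are compensated by those in the law of the Christoffel symbols.\<close>

lemma nabla_tensor_change:
  assumes S: "tensor_field S" and y: "y \<in> overlap p p'"
  shows "dtrans p p' y (nabla_tensor S p y a u v w)
    = nabla_tensor S p' (trans_map p p' y) (dtrans p p' y a) (dtrans p p' y u) (dtrans p p' y v) (dtrans p p' y w)"
proof -
  let ?A = "dtrans p p' y" and ?H = "hess p p' y"
  let ?y' = "trans_map p p' y"
  let ?\<Gamma>' = "christoffel M p' ?y'" and ?\<Gamma> = "christoffel M p y"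
  note yi = overlap_imgD[OF y] and yi' = trans_map_img[OF y]
  have tri: "trilinear (S p y)" if "y \<in> chart_img M p" for p y using S that by (simp add: tensor_field_def)
  have Ck: "Ck_within k (chart_img M p) (\<lambda>y. S p y u v w)" for k p u v w using S by (simp add: tensor_field_def)
  have ch: "dtrans p p' y (S p y u v w) = S p' (trans_map p p' y) (dtrans p p' y u) (dtrans p p' y v) (dtrans p p' y w)"
    if "y \<in> overlap p p'" for y u v w
    using S that unfolding tensor_field_def by blast
  define dS where "dS p y a u v w = frechet_derivative (\<lambda>z. S p z u v w) (at y) a" for p y a u v w
  have dS: "((\<lambda>z. S p z u v w) has_derivative (\<lambda>a. dS p y a u v w)) (at y)" if "y \<in> chart_img M p" for p y u v w
    unfolding dS_def by (rule Ck_within_has_derivative[OF open_chart_img Ck that])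
  note d1 = dtrans_apply_has_derivative[OF y dS[OF yi]]
  have "((\<lambda>z. S p' (trans_map p p' z) (dtrans p p' z u) (dtrans p p' z v) (dtrans p p' z w)) has_derivative
      (\<lambda>h. dS p' ?y' (?A h) (?A u) (?A v) (?A w) + S p' ?y' (?H h u) (?A v) (?A w) + S p' ?y' (?A u) (?H h v) (?A w)
        + S p' ?y' (?A u) (?A v) (?H h w)))
      (at y within overlap p p')"
    by (rule has_derivative_trilin_apply[where S = "overlap p p'" and
        B' = "\<lambda>u v w h. dS p' ?y' (?A h) u v w", OF tri[OF trans_map_img] y])
      (use y in \<open>auto simp only: at_within_open[OF y open_overlap]
          intro!: has_derivative_pullback dS trans_map_img dtrans_has_derivative\<close>)
  then have "((\<lambda>z. dtrans p p' z (S p z u v w)) has_derivative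
      (\<lambda>h. dS p' ?y' (?A h) (?A u) (?A v) (?A w) + S p' ?y' (?H h u) (?A v) (?A w) + S p' ?y' (?A u) (?H h v) (?A w)
        + S p' ?y' (?A u) (?A v) (?H h w))) (at y)"
    unfolding at_within_open[OF y open_overlap]
    by (rule has_derivative_transform_within_open[OF _ open_overlap y]) (simp only: ch)
  from fun_cong[OF has_derivative_unique[OF d1 this], of a]
  have e: "?A (dS p y a u v w) = dS p' ?y' (?A a) (?A u) (?A v) (?A w) + S p' ?y' (?H a u) (?A v) (?A w)
     + S p' ?y' (?A u) (?H a v) (?A w) + S p' ?y' (?A u) (?A v) (?H a w) - ?H a (S p y u v w)"
    by (simp add: algebra_simps)
  note t = trilinearD(1,3,5)[OF tri[OF yi']]
  show ?thesis
    unfolding nabla_tensor_def dS_def[symmetric] linear_add[OF linear_dtrans[OF y]] linear_diff[OF linear_dtrans[OF y]]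
      ch[OF y] christoffel_change[OF y] t e
    by (simp add: algebra_simps)
qed

lemma Ck_nabla_tensor:
  assumes S: "tensor_field S"
  shows "Ck_within k (chart_img M p) (\<lambda>y. nabla_tensor S p y a u v w)"
proof -
  have tri: "trilinear (S p y)" if "y \<in> chart_img M p" for p y using S that by (simp add: tensor_field_def)
  have Ck: "Ck_within k (chart_img M p) (\<lambda>y. S p y u v w)" for k p u v w using S by (simp add: tensor_field_def)
  show ?thesis
    unfolding nabla_tensor_def
    by (intro Ck_within_add Ck_within_diff Ck_within_frechet_derivative[OF open_chart_img] Ck
      Ck_christoffel_apply Ck_within_const Ck_within_trilin_apply[OF tri Ck])
qed

lemma linear_nabla_tensor:
  assumes S: "tensor_field S" and y: "y \<in> chart_img M p"
  shows "linear (\<lambda>a. nabla_tensor S p y a u v w)"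
proof -
  have tri: "trilinear (S p y)" using S y by (simp add: tensor_field_def)
  have "Ck_within (Suc 0) (chart_img M p) (\<lambda>y. S p y u v w)" using S unfolding tensor_field_def by blast
  from has_derivative_linear[OF Ck_within_has_derivative[OF open_chart_img this y]]
  have l: "linear (frechet_derivative (\<lambda>z. S p z u v w) (at y))" .
  note t = trilinearD[OF tri]
  note b = bilinear_christoffel[OF y]
  show ?thesis
    by (rule linearI) (simp_all add: nabla_tensor_def linear_add[OF l] linear_cmul[OF l] t bilinear_ladd[OF b] bilinear_lmul[OF b] algebra_simps)
qed

section \<open>Gradient and Hessian\<close>

definition local_grad :: "('a \<Rightarrow> real) \<Rightarrow> 'a \<Rightarrow> 'e \<Rightarrow> 'e"
  where "local_grad V p y = change M (chart_inv M p y) p (chart_inv M p y) (grad M V (chart_inv M p y))"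

lemma local_grad_change:
  "y \<in> overlap p p' \<Longrightarrow> dtrans p p' y (local_grad V p y) = local_grad V p' (trans_map p p' y)"
  by (auto simp: local_grad_def dtrans_chart change_change)

lemma Ck_function:
  assumes "smooth_function M V"
  shows "Ck_within k (chart_img M p) (V \<circ> chart_inv M p)"
  using assms Ck_on_imp_Ck_within[OF open_chart_img] unfolding smooth_function_def smooth_on_def by blast

text \<open>In the chart at the base point itself this is the definition of the gradient; the chain rule
  carries the characterizing equation over to any other chart.\<close>

lemma local_grad_eq:
  assumes V: "smooth_function M V" and y: "y \<in> chart_img M p"
  shows "local_grad V p y = riesz p y (frechet_derivative (V \<circ> chart_inv M p) (at y))"
proof (rule local_metric_eqD[OF y])
  fix w
  obtain r where r: "r \<in> chart_dom M p" "y = chart M p r" using y by (auto simp: chart_img_def)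
  have d: "((V \<circ> chart_inv M p) has_derivative frechet_derivative (V \<circ> chart_inv M p) (at y)) (at y)" if "y \<in> chart_img M p" for p y
    by (rule Ck_within_has_derivative[OF open_chart_img Ck_function[OF V] that])
  let ?d = "frechet_derivative (V \<circ> chart_inv M r) (at (chart M r r))"
  let ?P = "\<lambda>z. \<forall>w. metric M r z w = ?d w"
  have ex: "?P (riesz r (chart M r r) ?d)"
    using riesz[OF _ has_derivative_linear[OF d]] by (simp add: local_metric_own[symmetric])
  have "?P (THE z. ?P z)"
  proof (rule theI[where P = ?P, OF ex])
    show "z = riesz r (chart M r r) ?d" if "?P z" for z
      by (rule local_metric_eqD[of "chart M r r" r]) (use that ex in \<open>auto simp: local_metric_own\<close>)
  qed
  then have g: "metric M r (grad M V r) w = ?d w" for w by (simp add: grad_def)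
  have yo: "y \<in> overlap p r" using r by auto
  have "((\<lambda>z. (V \<circ> chart_inv M r) (trans_map p r z)) has_derivative (\<lambda>h. ?d (dtrans p r y h))) (at y)"
    by (rule has_derivative_pullback[OF yo])
      (use d[OF chart_in_img[OF in_own_dom], of r] r in \<open>simp add: comp_def\<close>)
  then have "((V \<circ> chart_inv M p) has_derivative (\<lambda>h. ?d (dtrans p r y h))) (at y)"
    by (rule has_derivative_transform_within_open[OF _ open_overlap yo]) auto
  from frechet_derivative_eqI[OF this]
  have "frechet_derivative (V \<circ> chart_inv M p) (at y) w = ?d (dtrans p r y w)" by simp
  also have "\<dots> = local_metric M p y (local_grad V p y) w"
    using r by (simp add: local_grad_def local_metric_chart g dtrans_chart)
  finally show "local_metric M p y (local_grad V p y) w = local_metric M p y (riesz p y (frechet_derivative (V \<circ> chart_inv M p) (at y))) w"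
    by (simp add: riesz[OF y has_derivative_linear[OF d[OF y]]])
qed

lemma Ck_local_grad:
  assumes V: "smooth_function M V"
  shows "Ck_within k (chart_img M p) (local_grad V p)"
proof (rule Ck_within_cong[OF local_grad_eq[OF V, symmetric]])
  show "Ck_within k (chart_img M p) (\<lambda>y. riesz p y (frechet_derivative (V \<circ> chart_inv M p) (at y)))"
    by (rule Ck_riesz[OF has_derivative_linear[OF Ck_within_has_derivative[OF open_chart_img Ck_function[OF V]]]])
      (auto intro: Ck_within_frechet_derivative[OF open_chart_img Ck_function[OF V]])
qed

definition local_nabla_grad :: "('a \<Rightarrow> real) \<Rightarrow> 'a \<Rightarrow> 'e \<Rightarrow> 'e \<Rightarrow> 'e"
  where "local_nabla_grad V p y a = frechet_derivative (local_grad V p) (at y) a + christoffel M p y a (local_grad V p y)"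

lemma nabla_grad_eq: "nabla_grad M V p a = local_nabla_grad V p (chart M p p) a"
  unfolding nabla_grad_def local_nabla_grad_def nabla_def Let_def local_grad_def[abs_def] ..

lemma Ck_local_nabla_grad:
  assumes V: "smooth_function M V"
  shows "Ck_within k (chart_img M p) (\<lambda>y. local_nabla_grad V p y a)"
  unfolding local_nabla_grad_def
  by (intro Ck_within_add Ck_within_frechet_derivative[OF open_chart_img] Ck_local_grad[OF V] Ck_christoffel_apply Ck_within_const)

lemma linear_local_nabla_grad:
  assumes V: "smooth_function M V" and y: "y \<in> chart_img M p"
  shows "linear (local_nabla_grad V p y)"
  unfolding local_nabla_grad_def
  using has_derivative_linear[OF Ck_within_has_derivative[OF open_chart_img Ck_local_grad[OF V] y]] bilinear_christoffel[OF y]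
  by (intro linear_compose_add) (auto simp: bilinear_def)

lemma local_nabla_grad_change:
  assumes V: "smooth_function M V" and y: "y \<in> overlap p p'"
  shows "dtrans p p' y (local_nabla_grad V p y a) = local_nabla_grad V p' (trans_map p p' y) (dtrans p p' y a)"
proof -
  let ?A = "dtrans p p' y" and ?H = "hess p p' y"
  note yi = overlap_imgD[OF y] and yi' = trans_map_img[OF y]
  have d: "(local_grad V p has_derivative frechet_derivative (local_grad V p) (at y)) (at y)" if "y \<in> chart_img M p" for p y
    by (rule Ck_within_has_derivative[OF open_chart_img Ck_local_grad[OF V] that])
  note d1 = dtrans_apply_has_derivative[OF y d[OF yi]]
  have "((\<lambda>z. dtrans p p' z (local_grad V p z)) has_derivative (\<lambda>h. frechet_derivative (local_grad V p') (at (trans_map p p' y)) (?A h))) (at y)"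
    by (rule has_derivative_transform_within_open[OF has_derivative_pullback[OF y d[OF yi']] open_overlap y])
      (simp only: local_grad_change)
  from fun_cong[OF has_derivative_unique[OF d1 this], of a]
  show ?thesis
    unfolding local_nabla_grad_def linear_add[OF linear_dtrans[OF y]] christoffel_change[OF y] local_grad_change[OF y]
    by (simp add: algebra_simps)
qed

end

section \<open>Fields and tensors along a curve\<close>

context riemannian
begin

abbreviation chart_times :: "real set \<Rightarrow> (real \<Rightarrow> 'a) \<Rightarrow> 'a \<Rightarrow> real set"
  where "chart_times K q p \<equiv> {t \<in> K. q t \<in> chart_dom M p}"

definition Ck_field :: "nat \<Rightarrow> real set \<Rightarrow> (real \<Rightarrow> 'a) \<Rightarrow> (real \<Rightarrow> 'e) \<Rightarrow> bool"
  where "Ck_field k K q X \<longleftrightarrow> (\<forall>p. Ck_within k (chart_times K q p) (field_comp M q p X))"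

text \<open>Regularity of a field or tensor along \<open>q\<close> is regularity of its components in each fixed chart; the
  values themselves are components in the chart at \<open>q t\<close>, which need not vary continuously.\<close>

definition tensor_comp :: "(real \<Rightarrow> 'a) \<Rightarrow> 'a \<Rightarrow> (real \<Rightarrow> 'e \<Rightarrow> 'e \<Rightarrow> 'e \<Rightarrow> 'e) \<Rightarrow> real \<Rightarrow> 'e \<Rightarrow> 'e \<Rightarrow> 'e \<Rightarrow> 'e"
  where "tensor_comp q p S t u v w =
    change M (q t) p (q t) (S t (change M p (q t) (q t) u) (change M p (q t) (q t) v) (change M p (q t) (q t) w))"

definition Ck_tensor :: "nat \<Rightarrow> real set \<Rightarrow> (real \<Rightarrow> 'a) \<Rightarrow> (real \<Rightarrow> 'e \<Rightarrow> 'e \<Rightarrow> 'e \<Rightarrow> 'e) \<Rightarrow> bool"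
  where "Ck_tensor k K q S \<longleftrightarrow> (\<forall>t\<in>K. trilinear (S t)) \<and>
    (\<forall>p u v w. Ck_within k (chart_times K q p) (\<lambda>t. tensor_comp q p S t u v w))"

text \<open>Continuity is tested on fields over arbitrary sets of times. Closed pieces of the interval are needed for
  admissible fields, the times spent in a chart for frames.\<close>

definition cont_endo :: "real set \<Rightarrow> (real \<Rightarrow> 'a) \<Rightarrow> (real \<Rightarrow> 'e \<Rightarrow> 'e) \<Rightarrow> bool"
  where "cont_endo K q A \<longleftrightarrow> (\<forall>t\<in>K. linear (A t)) \<and>
    (\<forall>K' X. K' \<subseteq> K \<longrightarrow> Ck_field 0 K' q X \<longrightarrow> Ck_field 0 K' q (\<lambda>t. A t (X t)))"

lemma Ck_field_subset: "Ck_field k K q X \<Longrightarrow> K' \<subseteq> K \<Longrightarrow> Ck_field k K' q X"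
  unfolding Ck_field_def by (intro allI, erule allE, erule Ck_within_subset) auto

lemma Ck_tensor_subset: "Ck_tensor k K q S \<Longrightarrow> K' \<subseteq> K \<Longrightarrow> Ck_tensor k K' q S"
  unfolding Ck_tensor_def
proof (intro conjI allI)
  fix p u v w
  assume "(\<forall>t\<in>K. trilinear (S t)) \<and> (\<forall>p u v w. Ck_within k (chart_times K q p) (\<lambda>t. tensor_comp q p S t u v w))"
    and sub: "K' \<subseteq> K"
  then have "Ck_within k (chart_times K q p) (\<lambda>t. tensor_comp q p S t u v w)" by blast
  then show "Ck_within k (chart_times K' q p) (\<lambda>t. tensor_comp q p S t u v w)"
    by (rule Ck_within_subset) (use sub in auto)
qed blast

lemma Ck_field_mono: "Ck_field k K q X \<Longrightarrow> j \<le> k \<Longrightarrow> Ck_field j K q X"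
  unfolding Ck_field_def using Ck_within_mono by blast

lemma field_comp_own: "field_comp M q (q t) X t = X t"
  by (simp add: field_comp_def)

lemma field_comp_inverse: "q t \<in> chart_dom M p \<Longrightarrow> change M p (q t) (q t) (field_comp M q p X t) = X t"
  by (simp add: field_comp_def)

lemma field_comp_change:
  assumes "q t \<in> chart_dom M p" "q t \<in> chart_dom M p'"
  shows "field_comp M q p' X t = dtrans p p' (chart M p (q t)) (field_comp M q p X t)"
  using assms by (simp add: field_comp_def dtrans_chart change_change)

lemma metric_field_comp:
  assumes "q t \<in> chart_dom M p"
  shows "metric M (q t) (X t) (Y t)
    = local_metric M p (chart M p (q t)) (field_comp M q p X t) (field_comp M q p Y t)"
  using assms by (simp add: local_metric_chart field_comp_inverse)

lemma tensor_comp_own: "tensor_comp q (q t) S t u v w = S t u v w"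
  by (simp add: tensor_comp_def)

lemma field_comp_tensor:
  assumes "q t \<in> chart_dom M p"
  shows "field_comp M q p (\<lambda>t. S t (X t) (Y t) (Z t)) t
    = tensor_comp q p S t (field_comp M q p X t) (field_comp M q p Y t) (field_comp M q p Z t)"
  using assms by (simp add: tensor_comp_def field_comp_inverse) (simp add: field_comp_def)

lemma trilinear_tensor_comp:
  assumes "trilinear (S t)" "q t \<in> chart_dom M p"
  shows "trilinear (tensor_comp q p S t)"
  using assms linear_change[of "q t" p "q t"] linear_change[of "q t" "q t" p]
  by (auto simp: trilinear_def bilinear_def linear_iff tensor_comp_def)

lemma Ck_tensor_apply:
  assumes S: "Ck_tensor k K q S" and "Ck_field k K q X" "Ck_field k K q Y" "Ck_field k K q Z"
  shows "Ck_field k K q (\<lambda>t. S t (X t) (Y t) (Z t))"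
  unfolding Ck_field_def
proof
  fix p
  have "Ck_within k (chart_times K q p)
      (\<lambda>t. tensor_comp q p S t (field_comp M q p X t) (field_comp M q p Y t) (field_comp M q p Z t))"
  proof (rule Ck_within_trilin_apply[where B = "tensor_comp q p S"])
    show "trilinear (tensor_comp q p S t)" if "t \<in> chart_times K q p" for t
      using S that by (auto simp: Ck_tensor_def intro!: trilinear_tensor_comp)
    show "Ck_within k (chart_times K q p) (\<lambda>t. tensor_comp q p S t u v w)" for u v w
      using S unfolding Ck_tensor_def by blast
  qed (use assms(2-4) in \<open>simp_all only: Ck_field_def\<close>)
  then show "Ck_within k (chart_times K q p) (field_comp M q p (\<lambda>t. S t (X t) (Y t) (Z t)))"
    by (rule Ck_within_cong[rotated]) (simp add: field_comp_tensor)
qed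

lemma Ck_field_add: "Ck_field k K q X \<Longrightarrow> Ck_field k K q Y \<Longrightarrow> Ck_field k K q (\<lambda>t. X t + Y t)"
  unfolding Ck_field_def
proof
  fix p assume "\<forall>p. Ck_within k (chart_times K q p) (field_comp M q p X)"
    "\<forall>p. Ck_within k (chart_times K q p) (field_comp M q p Y)"
  then have "Ck_within k (chart_times K q p) (\<lambda>t. field_comp M q p X t + field_comp M q p Y t)"
    by (simp only: Ck_within_add)
  then show "Ck_within k (chart_times K q p) (field_comp M q p (\<lambda>t. X t + Y t))"
    by (rule Ck_within_cong[rotated]) (simp add: field_comp_def linear_add[OF linear_change])
qed

lemma Ck_field_scale: "Ck_field k K q X \<Longrightarrow> Ck_field k K q (\<lambda>t. r *\<^sub>R X t)"
  unfolding Ck_field_def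
proof
  fix p assume "\<forall>p. Ck_within k (chart_times K q p) (field_comp M q p X)"
  then have "Ck_within k (chart_times K q p) (\<lambda>t. r *\<^sub>R field_comp M q p X t)"
    by (simp only: Ck_within_scaleR Ck_within_const)
  then show "Ck_within k (chart_times K q p) (field_comp M q p (\<lambda>t. r *\<^sub>R X t))"
    by (rule Ck_within_cong[rotated]) (simp add: field_comp_def linear_cmul[OF linear_change])
qed

lemma cont_endo_apply:
  "cont_endo K q A \<Longrightarrow> K' \<subseteq> K \<Longrightarrow> Ck_field 0 K' q X \<Longrightarrow> Ck_field 0 K' q (\<lambda>t. A t (X t))"
  by (simp add: cont_endo_def)

lemma cont_endo_id: "cont_endo K q (\<lambda>t x. x)"
  by (simp add: cont_endo_def linear_iff)

lemma cont_endo_add: "cont_endo K q A \<Longrightarrow> cont_endo K q B \<Longrightarrow> cont_endo K q (\<lambda>t x. A t x + B t x)"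
  by (simp add: cont_endo_def linear_compose_add Ck_field_add)

lemma cont_endo_scale: "cont_endo K q A \<Longrightarrow> cont_endo K q (\<lambda>t x. r *\<^sub>R A t x)"
  by (simp add: cont_endo_def linear_compose_scale_right Ck_field_scale)

lemma cont_endo_tensor:
  assumes A: "cont_endo K q A" and S: "Ck_tensor 0 K q S" and Y: "Ck_field 0 K q Y" and Z: "Ck_field 0 K q Z"
  shows "cont_endo K q (\<lambda>t x. S t (A t x) (Y t) (Z t))"
  unfolding cont_endo_def
proof (intro conjI ballI allI impI)
  show "linear (\<lambda>x. S t (A t x) (Y t) (Z t))" if "t \<in> K" for t
    using linear_compose[of "A t" "\<lambda>u. S t u (Y t) (Z t)"] assms that
    by (simp add: cont_endo_def Ck_tensor_def trilinear_def o_def)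
  show "Ck_field 0 K' q (\<lambda>t. S t (A t (X t)) (Y t) (Z t))" if "K' \<subseteq> K" "Ck_field 0 K' q X" for K' X
    by (rule Ck_tensor_apply[where S = S, OF Ck_tensor_subset[OF S that(1)] cont_endo_apply[OF A that]
          Ck_field_subset[OF Y that(1)] Ck_field_subset[OF Z that(1)]])
qed

end

lemma (in riemannian) trilinear_nabla_tensor:
  assumes S: "tensor_field S" and y: "y \<in> chart_img M p"
  shows "trilinear (nabla_tensor S p y a)"
proof -
  have tri: "trilinear (S p y)" if "y \<in> chart_img M p" for p y using S that by (simp add: tensor_field_def)
  have Ck: "Ck_within (Suc 0) (chart_img M p) (\<lambda>y. S p y u v w)" for u v w using S unfolding tensor_field_def by blast
  define D where "D u v w = frechet_derivative (\<lambda>z. S p z u v w) (at y) a" for u v w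
  have "trilinear D"
    unfolding D_def[abs_def]
    by (rule trilinear_derivative[where B = "S p" and B' = "\<lambda>u v w. frechet_derivative (\<lambda>z. S p z u v w) (at y)",
          OF y has_derivative_unique_open[OF open_chart_img y] tri])
      (simp_all add: at_within_open[OF y open_chart_img] Ck_within_has_derivative[OF open_chart_img Ck y])
  note l = trilinearD[OF this] trilinearD[OF tri[OF y]] bilinear_radd[OF bilinear_christoffel[OF y]]
    bilinear_rmul[OF bilinear_christoffel[OF y]]
  show ?thesis
    unfolding trilinear_def bilinear_def
    by (intro conjI allI linearI; (unfold nabla_tensor_def D_def[symmetric] l); (simp add: algebra_simps)?)
qed

lemma has_derivative_real_eq:
  fixes f :: "real \<Rightarrow> 'w::real_normed_vector"
  assumes "(f has_derivative f') (at t within S)" shows "f' = (\<lambda>h. h *\<^sub>R f' 1)"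
  using linear_cmul[OF has_derivative_linear[OF assms], of _ 1] by (metis mult.right_neutral real_scaleR_def)

lemma has_derivative_imp_has_vector_derivative:
  fixes f :: "real \<Rightarrow> 'w::real_normed_vector"
  assumes "(f has_derivative f') (at t within S)" shows "(f has_vector_derivative f' 1) (at t within S)"
  unfolding has_vector_derivative_def using assms by (subst has_derivative_real_eq[OF assms, symmetric])

text \<open>The parameter interval is arbitrary, since the results are applied both to \<open>[0,T]\<close> and to the pieces
  on which an admissible field is smooth.\<close>

locale riemannian_curve = riemannian M
  for M :: "('a::{t2_space,second_countable_topology}, 'e::euclidean_space) rmfd" +
  fixes q :: "real \<Rightarrow> 'a" and a b :: real
  assumes ab: "a < b" and q: "smooth_curve M {a..b} q"
begin

abbreviation "K \<equiv> {a..b}"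
abbreviation "J \<equiv> chart_times K q"
abbreviation "c p t \<equiv> chart M p (q t)"

lemma continuous_on_q: "continuous_on K q"
  using q by (simp add: smooth_curve_def)

lemma at_within_preimage:
  assumes "open W" "t \<in> K" "q t \<in> W"
  shows "at t within {t \<in> K. q t \<in> W} = at t within K"
proof -
  obtain N where N: "open N" "N \<inter> K = q -` W \<inter> K"
    using iffD1[OF continuous_on_open_invariant continuous_on_q] assms(1) by metis
  have "t \<in> N" using assms(2,3) N(2) by blast
  moreover have "{t \<in> K. q t \<in> W} \<inter> N - {t} = K \<inter> N - {t}" using N(2) by blast
  ultimately show ?thesis using N(1) by (metis at_within_nhd)
qed

lemma at_within_J: "t \<in> J p \<Longrightarrow> at t within J p = at t within K"
  using at_within_preimage[OF open_chart_dom, of t p] by simp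

lemma at_within_K_nontrivial: "t \<in> K \<Longrightarrow> at t within K \<noteq> bot"
  using ab by (simp add: trivial_limit_within islimpt_Icc)

lemma has_derivative_unique_K:
  assumes t: "t \<in> K" and f: "(f has_derivative f') (at t within K)" "(f has_derivative f'') (at t within K)"
  shows "f' = f''"
proof -
  have "f' 1 = f'' 1"
    using vector_derivative_unique_within[OF at_within_K_nontrivial[OF t]]
      f[THEN has_derivative_imp_has_vector_derivative] by blast
  then show ?thesis by (subst has_derivative_real_eq[OF f(1)], subst has_derivative_real_eq[OF f(2)]) simp
qed

lemma has_vector_derivative_J:
  assumes "Ck_within (Suc k) (J p) f" "t \<in> J p"
  shows "(f has_vector_derivative vector_derivative f (at t within K)) (at t within K)"
proof -
  obtain f' where "\<forall>t\<in>J p. (f has_derivative f' t) (at t within J p)"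
    using assms(1) unfolding Ck_within.simps by blast
  then have "(f has_derivative f' t) (at t within J p)" using assms(2) by blast
  from has_derivative_imp_has_vector_derivative[OF this] show ?thesis
    unfolding at_within_J[OF assms(2)] using vector_derivative_works differentiableI_vector by blast
qed

lemma vector_derivative_eqI:
  "t \<in> K \<Longrightarrow> (f has_vector_derivative d) (at t within K) \<Longrightarrow> vector_derivative f (at t within K) = d"
  by (rule vector_derivative_within[OF at_within_K_nontrivial])

lemma Ck_vector_derivative:
  assumes "Ck_within (Suc k) (J p) f"
  shows "Ck_within k (J p) (\<lambda>t. vector_derivative f (at t within K))"
proof -
  obtain f' where f': "\<forall>t\<in>J p. (f has_derivative f' t) (at t within J p)" "\<forall>v. Ck_within k (J p) (\<lambda>t. f' t v)"
    using assms unfolding Ck_within.simps by blast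
  show ?thesis
  proof (rule Ck_within_cong)
    show "Ck_within k (J p) (\<lambda>t. f' t 1)" using f'(2) by blast
    fix t assume t: "t \<in> J p"
    have "(f has_vector_derivative f' t 1) (at t within K)"
      using has_derivative_imp_has_vector_derivative[OF bspec[OF f'(1) t]] unfolding at_within_J[OF t] .
    then show "f' t 1 = vector_derivative f (at t within K)"
      using t vector_derivative_eqI[of t f "f' t 1"] by simp
  qed
qed

definition dc :: "'a \<Rightarrow> real \<Rightarrow> 'e"
  where "dc p t = vector_derivative (c p) (at t within K)"

lemma Ck_c: "Ck_within k (J p) (c p)"
  using q by (intro smooth_curve_on_imp_Ck_within) (simp add: smooth_curve_def)

lemma c_has_derivative: "t \<in> J p \<Longrightarrow> (c p has_derivative (\<lambda>h. h *\<^sub>R dc p t)) (at t within K)"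
  using has_vector_derivative_J[OF Ck_c] by (simp add: dc_def has_vector_derivative_def)

lemma Ck_dc: "Ck_within k (J p) (dc p)"
  unfolding dc_def[abs_def] by (rule Ck_vector_derivative[OF Ck_c])

lemma Ck_along: "Ck_within k (chart_img M p) f \<Longrightarrow> Ck_within k (J p) (\<lambda>t. f (c p t))"
  by (erule Ck_within_compose[OF _ Ck_c]) auto

lemma J_overlap: "t \<in> J p \<Longrightarrow> t \<in> J p' \<Longrightarrow> c p t \<in> overlap p p'"
  by auto

lemma J_img: "t \<in> J p \<Longrightarrow> c p t \<in> chart_img M p"
  by auto

lemma at_within_J_Int:
  assumes "t \<in> J p" "t \<in> J p'" shows "at t within (J p \<inter> J p') = at t within K"
proof -
  have "J p \<inter> J p' = {t \<in> K. q t \<in> chart_dom M p \<inter> chart_dom M p'}" by auto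
  then show ?thesis
    using at_within_preimage[OF open_Int[OF open_chart_dom open_chart_dom], of t p p'] assms by simp
qed

lemma dc_change:
  assumes t: "t \<in> J p" "t \<in> J p'" shows "dc p' t = dtrans p p' (c p t) (dc p t)"
proof -
  have "((\<lambda>s. trans_map p p' (c p s)) has_derivative (\<lambda>h. dtrans p p' (c p t) (h *\<^sub>R dc p t))) (at t within K)"
    by (rule has_derivative_compose[OF c_has_derivative[OF t(1)] trans_map_has_derivative'[OF J_overlap[OF t]]])
  then have "((\<lambda>s. trans_map p p' (c p s)) has_vector_derivative dtrans p p' (c p t) (dc p t)) (at t within J p \<inter> J p')"
    unfolding has_vector_derivative_def at_within_J_Int[OF t]
    by (simp add: linear_cmul[OF linear_dtrans[OF J_overlap[OF t]]])
  then have "(c p' has_vector_derivative dtrans p p' (c p t) (dc p t)) (at t within J p \<inter> J p')"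
    by (rule has_vector_derivative_transform[rotated 2]) (use t in auto)
  then show ?thesis
    unfolding at_within_J_Int[OF t] dc_def[of p'] using t(1) by (intro vector_derivative_eqI) simp_all
qed

lemma velocity_comp:
  assumes "t \<in> J p" shows "field_comp M q p (velocity M K q) t = dc p t"
proof -
  have t: "t \<in> J (q t)" using assms by auto
  have "velocity M K q t = dc (q t) t" by (simp add: velocity_def dc_def)
  then show ?thesis
    using dc_change[OF t assms] by (simp add: field_comp_def dtrans_chart)
qed

lemma Ck_velocity: "Ck_field k K q (velocity M K q)"
  unfolding Ck_field_def
  by (intro allI Ck_within_cong[OF _ Ck_dc]) (simp add: velocity_comp)

text \<open>The transformation law of the Christoffel symbols makes the formula for the covariant
  derivative of a field independent of the chart.\<close>

lemma covD_comp:
  assumes t: "t \<in> J p" and x: "(field_comp M q p X has_vector_derivative x') (at t within K)"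
  shows "field_comp M q p (covD M K q X) t = x' + christoffel M p (c p t) (dc p t) (field_comp M q p X t)"
proof -
  define p' where "p' = q t"
  have t': "t \<in> J p'" using t by (auto simp: p'_def)
  note y = J_overlap[OF t t']
  let ?x = "field_comp M q p X" and ?A = "dtrans p p' (c p t)"
  have "((\<lambda>s. dtrans p p' (c p s) (?x s)) has_derivative
      (\<lambda>h. hess p p' (c p t) (h *\<^sub>R dc p t) (?x t) + ?A (h *\<^sub>R x'))) (at t within J p \<inter> J p')"
  proof (rule has_derivative_lin_apply[where L = "\<lambda>s. dtrans p p' (c p s)" and L' = "\<lambda>u h. hess p p' (c p t) (h *\<^sub>R dc p t) u"])
    show "linear (dtrans p p' (c p s))" if "s \<in> J p \<inter> J p'" for s
      using that by (intro linear_dtrans) auto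
    show "((\<lambda>s. dtrans p p' (c p s) u) has_derivative (\<lambda>h. hess p p' (c p t) (h *\<^sub>R dc p t) u)) (at t within J p \<inter> J p')" for u
      unfolding at_within_J_Int[OF t t']
      by (rule has_derivative_compose[OF c_has_derivative[OF t] dtrans_has_derivative[OF y]])
    show "(?x has_derivative (\<lambda>h. h *\<^sub>R x')) (at t within J p \<inter> J p')"
      using x unfolding at_within_J_Int[OF t t'] has_vector_derivative_def .
  qed (use t t' in auto)
  moreover have "hess p p' (c p t) (h *\<^sub>R dc p t) (?x t) + ?A (h *\<^sub>R x')
      = h *\<^sub>R (hess p p' (c p t) (dc p t) (?x t) + ?A x')" for h
    by (simp add: linear_cmul[OF linear_dtrans[OF y]] linear_cmul[OF has_derivative_linear[OF dtrans_has_derivative[OF y]]] scaleR_add_right)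
  ultimately have "((\<lambda>s. dtrans p p' (c p s) (?x s)) has_vector_derivative
      (hess p p' (c p t) (dc p t) (?x t) + ?A x')) (at t within J p \<inter> J p')"
    by (simp add: has_vector_derivative_def)
  then have "(field_comp M q p' X has_vector_derivative (hess p p' (c p t) (dc p t) (?x t) + ?A x')) (at t within J p \<inter> J p')"
    by (rule has_vector_derivative_transform[rotated 2]) (use t t' in \<open>auto simp: field_comp_change[of q _ p p']\<close>)
  then have vd: "vector_derivative (field_comp M q p' X) (at t within K) = hess p p' (c p t) (dc p t) (?x t) + ?A x'"
    unfolding at_within_J_Int[OF t t'] using t by (intro vector_derivative_eqI) simp_all
  have "covD M K q X t = vector_derivative (field_comp M q p' X) (at t within K) + christoffel M p' (c p' t) (dc p' t) (field_comp M q p' X t)"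
    by (simp add: covD_def p'_def field_comp_own dc_def velocity_def)
  also have "\<dots> = ?A (x' + christoffel M p (c p t) (dc p t) (?x t))"
    unfolding linear_add[OF linear_dtrans[OF y]] christoffel_change[OF y] vd dc_change[OF t t']
    using t t' by (simp add: field_comp_change[of q _ p p'])
  finally have "covD M K q X t = ?A (x' + christoffel M p (c p t) (dc p t) (?x t))" .
  then show ?thesis
    using t t' by (simp add: field_comp_def dtrans_chart p'_def)
qed

lemma Ck_christoffel_along:
  assumes "Ck_within k (J p) f"
  shows "Ck_within k (J p) (\<lambda>t. christoffel M p (c p t) (dc p t) (f t))"
  by (rule Ck_within_bilin_apply[where B = "\<lambda>t. christoffel M p (c p t)",
        OF bilinear_christoffel[OF J_img] Ck_along[OF Ck_christoffel] Ck_dc assms])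

lemma Ck_covD:
  assumes "Ck_field (Suc k) K q X" shows "Ck_field k K q (covD M K q X)"
  unfolding Ck_field_def
proof
  fix p
  have X: "Ck_within (Suc k) (J p) (field_comp M q p X)" using assms by (simp only: Ck_field_def)
  have "Ck_within k (J p) (\<lambda>t. vector_derivative (field_comp M q p X) (at t within K)
      + christoffel M p (c p t) (dc p t) (field_comp M q p X t))"
    by (rule Ck_within_add[OF Ck_vector_derivative[OF X] Ck_christoffel_along[OF Ck_within_SucD[OF X]]])
  then show "Ck_within k (J p) (field_comp M q p (covD M K q X))"
    by (rule Ck_within_cong[rotated]) (rule covD_comp[OF _ has_vector_derivative_J[OF X], symmetric])
qed

lemma continuous_on_metric:
  assumes X: "Ck_field 0 K q X" and Y: "Ck_field 0 K q Y"
  shows "continuous_on K (\<lambda>t. metric M (q t) (X t) (Y t))"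
  unfolding continuous_on_eq_continuous_within
proof
  fix t assume "t \<in> K"
  then have t: "t \<in> J (q t)" by auto
  have "Ck_within 0 (J (q t)) (\<lambda>s. local_metric M (q t) (c (q t) s) (field_comp M q (q t) X s) (field_comp M q (q t) Y s))"
    by (rule Ck_within_bilin_apply[where B = "\<lambda>s. local_metric M (q t) (c (q t) s)",
          OF bilinear_local_metric[OF J_img] Ck_along[OF Ck_local_metric]
            X[unfolded Ck_field_def, rule_format] Y[unfolded Ck_field_def, rule_format]])
  then have "continuous_on (J (q t)) (\<lambda>s. metric M (q s) (X s) (Y s))"
    unfolding Ck_within.simps by (rule continuous_on_eq) (simp add: metric_field_comp[of q _ "q t"])
  then have "continuous (at t within J (q t)) (\<lambda>s. metric M (q s) (X s) (Y s))"
    using t continuous_on_eq_continuous_within by blast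
  then show "continuous (at t within K) (\<lambda>s. metric M (q s) (X s) (Y s))"
    unfolding at_within_J[OF t] .
qed

lemma metric_has_derivative:
  assumes X: "Ck_field 1 K q X" and Y: "Ck_field 1 K q Y" and "t \<in> K"
  shows "((\<lambda>t. metric M (q t) (X t) (Y t)) has_vector_derivative
    (metric M (q t) (covD M K q X t) (Y t) + metric M (q t) (X t) (covD M K q Y t))) (at t within K)"
proof -
  define p where "p = q t"
  have t: "t \<in> J p" using assms(3) by (auto simp: p_def)
  let ?x = "field_comp M q p X" and ?y = "field_comp M q p Y"
  let ?g = "local_metric M p (c p t)"
  have x: "(?x has_vector_derivative vector_derivative ?x (at t within K)) (at t within K)"
    by (rule has_vector_derivative_J[OF _ t, of 0]) (use X in \<open>simp only: Ck_field_def One_nat_def\<close>)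
  have y: "(?y has_vector_derivative vector_derivative ?y (at t within K)) (at t within K)"
    by (rule has_vector_derivative_J[OF _ t, of 0]) (use Y in \<open>simp only: Ck_field_def One_nat_def\<close>)
  define x' where "x' = vector_derivative ?x (at t within K)"
  define y' where "y' = vector_derivative ?y (at t within K)"
  note b = bilinear_local_metric[OF J_img[OF t]]
  have "((\<lambda>s. local_metric M p (c p s) (?x s) (?y s)) has_derivative
      (\<lambda>h. dmetric p (c p t) (h *\<^sub>R dc p t) (?x t) (?y t) + ?g (h *\<^sub>R x') (?y t) + ?g (?x t) (h *\<^sub>R y'))) (at t within J p)"
  proof (rule has_derivative_bilin_apply[where B = "\<lambda>s. local_metric M p (c p s)" and B' = "\<lambda>u v h. dmetric p (c p t) (h *\<^sub>R dc p t) u v"])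
    show "bilinear (local_metric M p (c p s))" if "s \<in> J p" for s
      using that by (intro bilinear_local_metric) auto
    show "((\<lambda>s. local_metric M p (c p s) u v) has_derivative (\<lambda>h. dmetric p (c p t) (h *\<^sub>R dc p t) u v)) (at t within J p)" for u v
      unfolding at_within_J[OF t]
      by (rule has_derivative_compose[OF c_has_derivative[OF t] local_metric_has_derivative[OF J_img[OF t]]])
  qed (use t x y in \<open>auto simp only: at_within_J[OF t] has_vector_derivative_def x'_def y'_def\<close>)
  moreover have "dmetric p (c p t) (h *\<^sub>R dc p t) (?x t) (?y t) + ?g (h *\<^sub>R x') (?y t) + ?g (?x t) (h *\<^sub>R y')
     = h *\<^sub>R (?g (x' + christoffel M p (c p t) (dc p t) (?x t)) (?y t) + ?g (?x t) (y' + christoffel M p (c p t) (dc p t) (?y t)))" for h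
    unfolding bilinear_lmul[OF bilinear_christoffel[OF J_img[OF t]]] bilinear_lmul[OF b] bilinear_rmul[OF b]
      bilinear_ladd[OF b] bilinear_radd[OF b] christoffel_compat[OF J_img[OF t]] real_scaleR_def by (simp add: algebra_simps)
  ultimately have "((\<lambda>s. local_metric M p (c p s) (?x s) (?y s)) has_vector_derivative
      (?g (x' + christoffel M p (c p t) (dc p t) (?x t)) (?y t) + ?g (?x t) (y' + christoffel M p (c p t) (dc p t) (?y t)))) (at t within J p)"
    by (simp add: has_vector_derivative_def)
  also have "x' + christoffel M p (c p t) (dc p t) (?x t) = field_comp M q p (covD M K q X) t"
    unfolding x'_def by (rule covD_comp[OF t x, symmetric])
  also have "y' + christoffel M p (c p t) (dc p t) (?y t) = field_comp M q p (covD M K q Y) t"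
    unfolding y'_def by (rule covD_comp[OF t y, symmetric])
  finally have "((\<lambda>s. local_metric M p (c p s) (?x s) (?y s)) has_vector_derivative
      (metric M (q t) (covD M K q X t) (Y t) + metric M (q t) (X t) (covD M K q Y t))) (at t within J p)"
    using t by (simp only: metric_field_comp[of q t p, symmetric] mem_Collect_eq)
  then have "((\<lambda>t. metric M (q t) (X t) (Y t)) has_vector_derivative
      (metric M (q t) (covD M K q X t) (Y t) + metric M (q t) (X t) (covD M K q Y t))) (at t within J p)"
    by (rule has_vector_derivative_transform[OF t, rotated]) (simp add: metric_field_comp[of q _ p])
  then show ?thesis unfolding at_within_J[OF t] .
qed

text \<open>The tensor is differentiated by the product rule, on fields \<open>E u\<close> whose components are constant
  in the chart at \<open>q t\<close>. In another chart the components \<open>e u\<close> of these fields vary, but their derivatives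
  occur in \<open>D(S(E u, E v, E w))\<close> and in \<open>S(D(E u), E v, E w)\<close> and its analogues alike and cancel.\<close>

lemma covD_tensor_comp:
  assumes S: "Ck_tensor (Suc k) K q S" and t: "t \<in> J p"
  shows "tensor_comp q p (covD_tensor M K q S) t u v w =
    vector_derivative (\<lambda>s. tensor_comp q p S s u v w) (at t within K)
    + christoffel M p (c p t) (dc p t) (tensor_comp q p S t u v w)
    - tensor_comp q p S t (christoffel M p (c p t) (dc p t) u) v w
    - tensor_comp q p S t u (christoffel M p (c p t) (dc p t) v) w
    - tensor_comp q p S t u v (christoffel M p (c p t) (dc p t) w)"
proof -
  define p' where "p' = q t"
  have t': "t \<in> J p'" using t by (auto simp: p'_def)
  define E where "E u s = change M p' (q s) (q s) u" for u s
  define e where "e u = field_comp M q p (E u)" for u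
  note y = J_overlap[OF t' t]
  let ?\<Gamma> = "christoffel M p (c p t) (dc p t)"
  let ?S = "tensor_comp q p S"
  define U where "U = change M p p' (q t) u"
  define V where "V = change M p p' (q t) v"
  define W where "W = change M p p' (q t) w"
  have E_own: "E u t = u" for u by (simp add: E_def p'_def)
  have e_t: "e U t = u" "e V t = v" "e W t = w"
    using t t' by (simp_all add: e_def field_comp_def E_own U_def V_def W_def p'_def)
  have "\<exists>d. (e u has_vector_derivative d) (at t within K)" for u
  proof -
    have "((\<lambda>s. dtrans p' p (c p' s) u) has_derivative (\<lambda>h. hess p' p (c p' t) (h *\<^sub>R dc p' t) u)) (at t within K)"
      by (rule has_derivative_compose[OF c_has_derivative[OF t'] dtrans_has_derivative[OF y]])
    then have "((\<lambda>s. dtrans p' p (c p' s) u) has_vector_derivative hess p' p (c p' t) (dc p' t) u) (at t within J p' \<inter> J p)"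
      unfolding at_within_J_Int[OF t' t] has_vector_derivative_def
      by (simp add: linear_cmul[OF has_derivative_linear[OF dtrans_has_derivative[OF y]]])
    then have "(e u has_vector_derivative hess p' p (c p' t) (dc p' t) u) (at t within J p' \<inter> J p)"
      by (rule has_vector_derivative_transform[rotated 2])
        (use t t' in \<open>auto simp: e_def field_comp_def E_def dtrans_chart change_change\<close>)
    then show ?thesis unfolding at_within_J_Int[OF t' t] by blast
  qed
  then obtain e' where e': "\<And>u. (e u has_vector_derivative e' u) (at t within K)" by metis
  have covE: "field_comp M q p (covD M K q (E u)) t = e' u + ?\<Gamma> (e u t)" for u
    using covD_comp[OF t e'[unfolded e_def]] by (simp add: e_def)
  have tri: "trilinear (?S s)" if "s \<in> J p" for s
    using S that by (intro trilinear_tensor_comp) (auto simp: Ck_tensor_def)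
  define S' where "S' u v w = vector_derivative (\<lambda>s. ?S s u v w) (at t within K)" for u v w
  have S': "((\<lambda>s. ?S s u v w) has_derivative (\<lambda>h. h *\<^sub>R S' u v w)) (at t within K)" for u v w
  proof -
    have "Ck_within (Suc k) (J p) (\<lambda>s. ?S s u v w)" using S unfolding Ck_tensor_def by blast
    from has_vector_derivative_J[OF this t] show ?thesis by (simp add: S'_def has_vector_derivative_def)
  qed
  note lin = trilinearD[OF tri[OF t]]
  have "((\<lambda>s. ?S s (e U s) (e V s) (e W s)) has_derivative
     (\<lambda>h. h *\<^sub>R S' (e U t) (e V t) (e W t) + ?S t (h *\<^sub>R e' U) (e V t) (e W t) + ?S t (e U t) (h *\<^sub>R e' V) (e W t) + ?S t (e U t) (e V t) (h *\<^sub>R e' W)))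
     (at t within J p)"
    by (rule has_derivative_trilin_apply[where B = ?S and B' = "\<lambda>u v w h. h *\<^sub>R S' u v w", OF tri t])
      (use S' e' in \<open>auto simp only: at_within_J[OF t] has_vector_derivative_def\<close>)
  then have "((\<lambda>s. ?S s (e U s) (e V s) (e W s)) has_vector_derivative
     (S' u v w + ?S t (e' U) v w + ?S t u (e' V) w + ?S t u v (e' W))) (at t within J p)"
    by (simp add: has_vector_derivative_def lin e_t scaleR_add_right)
  then have "(field_comp M q p (\<lambda>s. S s (E U s) (E V s) (E W s)) has_vector_derivative
     (S' u v w + ?S t (e' U) v w + ?S t u (e' V) w + ?S t u v (e' W))) (at t within J p)"
    by (rule has_vector_derivative_transform[OF t, rotated]) (simp add: field_comp_tensor e_def)
  from covD_comp[OF t this[unfolded at_within_J[OF t]]]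
  have main: "field_comp M q p (covD M K q (\<lambda>s. S s (E U s) (E V s) (E W s))) t
     = S' u v w + ?S t (e' U) v w + ?S t u (e' V) w + ?S t u v (e' W) + ?\<Gamma> (?S t u v w)"
    using t by (simp add: field_comp_tensor e_def[symmetric] e_t)
  define F where "F X = change M p' p (q t) X" for X
  have F: "field_comp M q p X t = F (X t)" for X by (simp add: F_def p'_def field_comp_def)
  have linF: "linear F" using t t' unfolding F_def[abs_def] by (intro linear_change) auto
  have FS: "F (S t a b d) = ?S t (F a) (F b) (F d)" for a b d
    using t t' by (simp add: F_def tensor_comp_def p'_def)
  have "tensor_comp q p (covD_tensor M K q S) t u v w = F (covD_tensor M K q S t U V W)"
    by (simp add: tensor_comp_def F_def U_def V_def W_def p'_def)
  also have "covD_tensor M K q S t U V W = covD M K q (\<lambda>s. S s (E U s) (E V s) (E W s)) t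
      - S t (covD M K q (E U) t) V W - S t U (covD M K q (E V) t) W - S t U V (covD M K q (E W) t)"
    by (simp add: covD_tensor_def Let_def E_def[abs_def] p'_def)
  also have "F \<dots> = S' u v w + ?S t (e' U) v w + ?S t u (e' V) w + ?S t u v (e' W) + ?\<Gamma> (?S t u v w)
     - ?S t (e' U + ?\<Gamma> u) v w - ?S t u (e' V + ?\<Gamma> v) w - ?S t u v (e' W + ?\<Gamma> w)"
  proof -
    have "F U = u" "F V = v" "F W = w" using e_t by (simp_all add: e_def F E_own)
    then show ?thesis
      unfolding linear_diff[OF linF] FS using main covE by (simp add: F e_t)
  qed
  finally show ?thesis by (simp add: lin S'_def algebra_simps)
qed

lemma Ck_covD_tensor:
  assumes S: "Ck_tensor (Suc k) K q S" shows "Ck_tensor k K q (covD_tensor M K q S)"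
  unfolding Ck_tensor_def
proof (intro conjI ballI allI)
  have tri: "trilinear (tensor_comp q p S t)" if "t \<in> J p" for p t
    using S that by (intro trilinear_tensor_comp) (auto simp: Ck_tensor_def)
  have Ck: "Ck_within (Suc k) (J p) (\<lambda>t. tensor_comp q p S t u v w)" for p u v w
    using S unfolding Ck_tensor_def by blast
  note Ck0 = Ck_within_SucD[OF Ck]
  note tri_apply = Ck_within_trilin_apply[where B = "tensor_comp q p S" for p, OF tri Ck0]
  show "Ck_within k (J p) (\<lambda>t. tensor_comp q p (covD_tensor M K q S) t u v w)" for p u v w
    by (rule Ck_within_cong[OF covD_tensor_comp[OF S, symmetric]], assumption)
      (intro Ck_within_add Ck_within_diff Ck_vector_derivative[OF Ck] Ck_christoffel_along[OF Ck0] tri_apply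
        Ck_christoffel_along[OF Ck_within_const] Ck_within_const)
  fix t assume "t \<in> K"
  then have t: "t \<in> J (q t)" by auto
  let ?S = "tensor_comp q (q t) S"
  let ?D = "\<lambda>u v w. vector_derivative (\<lambda>s. ?S s u v w) (at t within K)"
  have D: "((\<lambda>s. ?S s u v w) has_derivative (\<lambda>h. h *\<^sub>R ?D u v w)) (at t within J (q t))" for u v w
    using has_vector_derivative_J[OF Ck t] unfolding at_within_J[OF t] has_vector_derivative_def .
  have "trilinear (\<lambda>u v w. 1 *\<^sub>R ?D u v w)"
    by (rule trilinear_derivative[where B = ?S, OF t _ tri D]) (simp_all only: at_within_J[OF t] has_derivative_unique_K[OF \<open>t \<in> K\<close>])
  then have "trilinear ?D" by simp
  note l = trilinearD[OF this] trilinearD[OF tri[OF t]] bilinear_radd[OF bilinear_christoffel[OF J_img[OF t]]]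
    bilinear_rmul[OF bilinear_christoffel[OF J_img[OF t]]]
  show "trilinear (covD_tensor M K q S t)"
    unfolding trilinear_def bilinear_def
    by (intro conjI allI linearI;
      (unfold tensor_comp_own[symmetric, where S = "covD_tensor M K q S" and t = t and q = q] covD_tensor_comp[OF S t] l);
      (simp add: algebra_simps)?)
qed

lemma Ck_curvature: "Ck_tensor k K q (\<lambda>t. curvature M (q t))"
  unfolding Ck_tensor_def
proof (intro conjI ballI allI)
  show "trilinear (curvature M (q t))" for t
    using trilinear_local_curv[of "c (q t) t" "q t"] by (simp add: curvature_def[abs_def])
  show "Ck_within k (J p) (\<lambda>t. tensor_comp q p (\<lambda>t. curvature M (q t)) t u v w)" for p u v w
  proof (rule Ck_within_cong[OF _ Ck_along[OF Ck_local_curv]])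
    fix t assume t: "t \<in> J p"
    then have t': "t \<in> J (q t)" by auto
    show "local_curv M p (c p t) u v w = tensor_comp q p (\<lambda>t. curvature M (q t)) t u v w"
      using local_curv_change[OF J_overlap[OF t' t], of "change M p (q t) (q t) u" "change M p (q t) (q t) v" "change M p (q t) (q t) w"] t
      by (simp add: tensor_comp_def curvature_def dtrans_chart)
  qed
qed

lemma cont_endo_nabla_curv:
  assumes X: "Ck_field 0 K q X" and Y: "Ck_field 0 K q Y" and Z: "Ck_field 0 K q Z"
  shows "cont_endo K q (\<lambda>t w. nabla_curv M (q t) w (X t) (Y t) (Z t))"
  unfolding cont_endo_def
proof (intro conjI ballI allI impI)
  show "linear (\<lambda>w. nabla_curv M (q t) w (X t) (Y t) (Z t))" for t
    unfolding nabla_curv_eq by (rule linear_nabla_tensor[OF tensor_field_local_curv]) auto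
  fix K' W assume K': "K' \<subseteq> K" and W: "Ck_field 0 K' q W"
  show "Ck_field 0 K' q (\<lambda>t. nabla_curv M (q t) (W t) (X t) (Y t) (Z t))"
    unfolding Ck_field_def
  proof
    fix p
    let ?N = "\<lambda>t. nabla_tensor (local_curv M) p (c p t)"
    have "Ck_within 0 (J p) (\<lambda>t. ?N t u (field_comp M q p X t) (field_comp M q p Y t) (field_comp M q p Z t))" for u
      by (rule Ck_within_trilin_apply[where B = "\<lambda>t. ?N t u", OF trilinear_nabla_tensor[OF tensor_field_local_curv J_img]
            Ck_along[OF Ck_nabla_tensor[OF tensor_field_local_curv]]
            X[unfolded Ck_field_def, rule_format] Y[unfolded Ck_field_def, rule_format] Z[unfolded Ck_field_def, rule_format]])
    then have N: "Ck_within 0 (chart_times K' q p)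
        (\<lambda>t. ?N t u (field_comp M q p X t) (field_comp M q p Y t) (field_comp M q p Z t))" for u
      by (rule Ck_within_subset) (use K' in auto)
    have "Ck_within 0 (chart_times K' q p) (\<lambda>t. ?N t (field_comp M q p W t) (field_comp M q p X t)
        (field_comp M q p Y t) (field_comp M q p Z t))"
      by (rule Ck_within_lin_apply[where L = "\<lambda>t u. ?N t u (field_comp M q p X t) (field_comp M q p Y t) (field_comp M q p Z t)",
            OF linear_nabla_tensor[OF tensor_field_local_curv] N W[unfolded Ck_field_def, rule_format]]) auto
    then show "Ck_within 0 (chart_times K' q p) (field_comp M q p (\<lambda>t. nabla_curv M (q t) (W t) (X t) (Y t) (Z t)))"
    proof (rule Ck_within_cong[rotated])
      fix t assume "t \<in> chart_times K' q p"
      then have t: "t \<in> J p" "t \<in> J (q t)" using K' by auto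
      show "?N t (field_comp M q p W t) (field_comp M q p X t) (field_comp M q p Y t) (field_comp M q p Z t)
          = field_comp M q p (\<lambda>t. nabla_curv M (q t) (W t) (X t) (Y t) (Z t)) t"
        using nabla_tensor_change[OF tensor_field_local_curv J_overlap[OF t(2,1)], of "W t" "X t" "Y t" "Z t"] t(1)
        by (simp add: field_comp_def nabla_curv_eq dtrans_chart)
    qed
  qed
qed

lemma cont_endo_nabla_grad:
  assumes V: "smooth_function M V"
  shows "cont_endo K q (\<lambda>t. nabla_grad M V (q t))"
  unfolding cont_endo_def
proof (intro conjI ballI allI impI)
  show "linear (nabla_grad M V (q t))" for t
    using linear_local_nabla_grad[OF V, of "c (q t) t" "q t"] by (simp add: nabla_grad_eq[abs_def])
  fix K' W assume K': "K' \<subseteq> K" and W: "Ck_field 0 K' q W"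
  show "Ck_field 0 K' q (\<lambda>t. nabla_grad M V (q t) (W t))"
    unfolding Ck_field_def
  proof
    fix p
    have N: "Ck_within 0 (chart_times K' q p) (\<lambda>t. local_nabla_grad V p (c p t) u)" for u
      by (rule Ck_within_subset[OF Ck_along[OF Ck_local_nabla_grad[OF V]]]) (use K' in auto)
    have "Ck_within 0 (chart_times K' q p) (\<lambda>t. local_nabla_grad V p (c p t) (field_comp M q p W t))"
      by (rule Ck_within_lin_apply[where L = "\<lambda>t. local_nabla_grad V p (c p t)",
            OF linear_local_nabla_grad[OF V] N W[unfolded Ck_field_def, rule_format]]) auto
    then show "Ck_within 0 (chart_times K' q p) (field_comp M q p (\<lambda>t. nabla_grad M V (q t) (W t)))"
    proof (rule Ck_within_cong[rotated])
      fix t assume "t \<in> chart_times K' q p"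
      then have t: "t \<in> J p" "t \<in> J (q t)" using K' by auto
      show "local_nabla_grad V p (c p t) (field_comp M q p W t) = field_comp M q p (\<lambda>t. nabla_grad M V (q t) (W t)) t"
        using local_nabla_grad_change[OF V J_overlap[OF t(2,1)], of "W t"] t(1)
        by (simp add: field_comp_def nabla_grad_eq dtrans_chart)
    qed
  qed
qed

lemma Ck_field_of_chart:
  assumes u: "Ck_within k (J p) u"
  shows "Ck_field k (J p) q (\<lambda>t. change M p (q t) (q t) (u t))"
  unfolding Ck_field_def
proof
  fix p'
  let ?S = "chart_times (J p) q p'"
  have sub: "?S \<subseteq> J p" by auto
  have "Ck_within k ?S (\<lambda>t. dtrans p p' (c p t) v)" for v
    by (rule Ck_within_compose[OF Ck_dtrans Ck_within_subset[OF Ck_c sub]]) auto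
  then have "Ck_within k ?S (\<lambda>t. dtrans p p' (c p t) (u t))"
    by (rule Ck_within_lin_apply[where L = "\<lambda>t. dtrans p p' (c p t)", rotated, OF _ Ck_within_subset[OF u sub]])
      (auto intro: linear_dtrans)
  then show "Ck_within k ?S (field_comp M q p' (\<lambda>t. change M p (q t) (q t) (u t)))"
    by (rule Ck_within_cong[rotated]) (auto simp: field_comp_def dtrans_chart change_change)
qed

end

section \<open>Bounds for continuous endomorphism fields\<close>

context riemannian
begin

definition gnorm :: "'a \<Rightarrow> 'e \<Rightarrow> real"
  where "gnorm p x = sqrt (metric M p x x)"

lemma metric_nonneg: "0 \<le> metric M p x x"
  using metric_pos[of x p] bilinear_lzero[OF bilinear_metric] by (cases "x = 0") (auto intro: less_imp_le)

lemma gnorm_nonneg [simp]: "0 \<le> gnorm p x"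
  by (simp add: gnorm_def metric_nonneg)

lemma gnorm_square: "(gnorm p x)\<^sup>2 = metric M p x x"
  by (simp add: gnorm_def metric_nonneg)

lemma gnorm_eq_0: "gnorm p x = 0 \<longleftrightarrow> x = 0"
  using metric_pos[of x p] bilinear_lzero[OF bilinear_metric, of p 0] by (cases "x = 0") (auto simp: gnorm_def)

lemma metric_scale: "metric M p (r *\<^sub>R x) y = r * metric M p x y" "metric M p x (r *\<^sub>R y) = r * metric M p x y"
  using bilinear_lmul[OF bilinear_metric] bilinear_rmul[OF bilinear_metric] by (metis real_scaleR_def)+

lemmas metric_linear = metric_scale bilinear_ladd[OF bilinear_metric] bilinear_radd[OF bilinear_metric]
  bilinear_lsub[OF bilinear_metric] bilinear_rsub[OF bilinear_metric]

lemma metric_Cauchy_Schwarz: "\<bar>metric M p x y\<bar> \<le> gnorm p x * gnorm p y"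
proof (cases "y = 0")
  case True
  then show ?thesis using bilinear_rzero[OF bilinear_metric] by simp
next
  case False
  define g where "g = metric M p y y"
  have g: "g > 0" using metric_pos[OF False] by (simp add: g_def)
  define r where "r = metric M p x y / g"
  have "0 \<le> metric M p (x - r *\<^sub>R y) (x - r *\<^sub>R y)" by (rule metric_nonneg)
  also have "\<dots> = metric M p x x - 2 * r * metric M p x y + r * r * g"
    by (simp add: metric_linear metric_sym[of p y x] g_def algebra_simps)
  also have "\<dots> = metric M p x x - (metric M p x y)\<^sup>2 / g"
    using g by (simp add: r_def power2_eq_square field_simps)
  finally have "(metric M p x y)\<^sup>2 \<le> metric M p x x * g"
    using g by (simp add: field_simps)
  then have "sqrt ((metric M p x y)\<^sup>2) \<le> sqrt (metric M p x x * g)" by (rule real_sqrt_le_mono)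
  then show ?thesis by (simp add: gnorm_def g_def real_sqrt_mult)
qed

lemma gnorm_triangle: "gnorm p (x + y) \<le> gnorm p x + gnorm p y"
proof -
  have "(gnorm p (x + y))\<^sup>2 = (gnorm p x)\<^sup>2 + 2 * metric M p x y + (gnorm p y)\<^sup>2"
    by (simp add: gnorm_square metric_linear metric_sym[of p y x])
  also have "\<dots> \<le> (gnorm p x + gnorm p y)\<^sup>2"
    using metric_Cauchy_Schwarz[of p x y] by (simp add: power2_sum algebra_simps)
  finally show ?thesis by (rule power2_le_imp_le) simp
qed

lemma gnorm_scale: "gnorm p (r *\<^sub>R x) = \<bar>r\<bar> * gnorm p x"
  by (simp add: gnorm_def metric_scale real_sqrt_mult)

lemma gnorm_sum: "finite I \<Longrightarrow> gnorm p (\<Sum>i\<in>I. f i) \<le> (\<Sum>i\<in>I. gnorm p (f i))"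
proof (induction I rule: finite_induct)
  case empty
  then show ?case using gnorm_eq_0[of p 0] by simp
next
  case (insert i I)
  then show ?case using gnorm_triangle[of p "f i" "\<Sum>i\<in>I. f i"] by simp
qed

lemma C1_field_imp_Ck_field: "C1_field M K q X \<Longrightarrow> Ck_field 1 K q X"
  unfolding C1_field_def Ck_field_def C1_curve_on_def
proof
  fix p assume *: "\<forall>p. \<exists>f'. continuous_on {t \<in> K. q t \<in> chart_dom M p} f' \<and>
    (\<forall>t\<in>{t \<in> K. q t \<in> chart_dom M p}. (field_comp M q p X has_vector_derivative f' t) (at t within {t \<in> K. q t \<in> chart_dom M p}))"
  then obtain f' where f': "continuous_on {t \<in> K. q t \<in> chart_dom M p} f'"
    "\<forall>t\<in>{t \<in> K. q t \<in> chart_dom M p}. (field_comp M q p X has_vector_derivative f' t) (at t within {t \<in> K. q t \<in> chart_dom M p})"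
    by blast
  show "Ck_within 1 {t \<in> K. q t \<in> chart_dom M p} (field_comp M q p X)"
    unfolding One_nat_def Ck_within.simps
    by (rule exI[of _ "\<lambda>t h. h *\<^sub>R f' t"])
      (use f' in \<open>auto simp: has_vector_derivative_def intro: continuous_on_scaleR continuous_on_const\<close>)
qed

lemma smooth_field_imp_Ck_field: "smooth_field M K q X \<Longrightarrow> Ck_field k K q X"
  unfolding smooth_field_def Ck_field_def using smooth_curve_on_imp_Ck_within by blast

end

context riemannian_curve
begin

lemma continuous_on_gnorm_chart:
  assumes u: "Ck_within 0 (J p) u"
  shows "continuous_on (J p) (\<lambda>t. gnorm (q t) (change M p (q t) (q t) (u t)))"
proof -
  have "Ck_within 0 (J p) (\<lambda>t. local_metric M p (c p t) (u t) (u t))"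
    by (rule Ck_within_bilin_apply[where B = "\<lambda>s. local_metric M p (c p s)",
          OF bilinear_local_metric[OF J_img] Ck_along[OF Ck_local_metric] u u])
  then have "continuous_on (J p) (\<lambda>t. sqrt (local_metric M p (c p t) (u t) (u t)))"
    by (simp add: continuous_on_real_sqrt)
  then show ?thesis
    by (rule continuous_on_eq) (simp add: gnorm_def local_metric_chart)
qed

text \<open>Expanding \<open>x\<close> in an orthogonal frame, each coefficient is at most the length of \<open>x\<close> divided by that of
  the frame vector. So the norm of \<open>A t\<close> is at most the sum over the frame of the quotients of the
  lengths of \<open>A t (e b t)\<close> and \<open>e b t\<close>, which is continuous in \<open>t\<close>.\<close>

lemma cont_endo_locally_bounded:
  assumes A: "cont_endo K q A"
  obtains N where "continuous_on (J p) N"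
    and "\<And>t x. t \<in> J p \<Longrightarrow> gnorm (q t) (A t x) \<le> N t * gnorm (q t) x"
proof -
  define e where "e b t = change M p (q t) (q t) (frame p b (c p t))" for b t
  define N where "N t = (\<Sum>b\<in>Basis. gnorm (q t) (A t (e b t)) / gnorm (q t) (e b t))" for t
  have fr: "Ck_within 0 (J p) (\<lambda>t. frame p b (c p t))" if "b \<in> Basis" for b
    by (rule Ck_along[OF Ck_frame[OF that]])
  have linA: "linear (A t)" if "t \<in> J p" for t using A that by (simp add: cont_endo_def)
  have pos: "gnorm (q t) (e b t) > 0" if "t \<in> J p" "b \<in> Basis" for t b
    using frame_metric_pos[OF that(2) J_img[OF that(1)]] that(1) by (simp add: gnorm_def e_def local_metric_chart)
  have contA: "continuous_on (J p) (\<lambda>t. gnorm (q t) (A t (e b t)))" if "b \<in> Basis" for b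
  proof -
    have "Ck_field 0 (J p) q (\<lambda>t. A t (e b t))"
      unfolding e_def by (rule cont_endo_apply[OF A _ Ck_field_of_chart[OF fr[OF that]]]) auto
    then have "Ck_within 0 (chart_times (J p) q p) (field_comp M q p (\<lambda>t. A t (e b t)))"
      unfolding Ck_field_def by blast
    then have "Ck_within 0 (J p) (field_comp M q p (\<lambda>t. A t (e b t)))"
      by (rule Ck_within_subset) auto
    from continuous_on_gnorm_chart[OF this] show ?thesis
      by (rule continuous_on_eq) (simp add: field_comp_inverse)
  qed
  have contN: "continuous_on (J p) N"
    unfolding N_def
  proof (intro continuous_on_sum continuous_on_divide ballI contA)
    show "continuous_on (J p) (\<lambda>t. gnorm (q t) (e b t))" if "b \<in> Basis" for b
      unfolding e_def by (rule continuous_on_gnorm_chart[OF fr[OF that]])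
    show "gnorm (q t) (e b t) \<noteq> 0" if "b \<in> Basis" "t \<in> J p" for b t
      using pos[OF that(2,1)] by simp
  qed
  have bound: "gnorm (q t) (A t x) \<le> N t * gnorm (q t) x" if t: "t \<in> J p" for t x
  proof -
    define \<xi> where "\<xi> = change M (q t) p (q t) x"
    define L where "L b = local_metric M p (c p t) \<xi> (frame p b (c p t)) *
        inverse (local_metric M p (c p t) (frame p b (c p t)) (frame p b (c p t)))" for b
    have x: "x = change M p (q t) (q t) \<xi>" using t by (simp add: \<xi>_def)
    have L: "L b = metric M (q t) x (e b t) / (gnorm (q t) (e b t))\<^sup>2" for b
      using t by (simp add: L_def gnorm_square local_metric_chart x e_def divide_inverse)
    have "\<xi> = riesz p (c p t) (local_metric M p (c p t) \<xi>)"
      by (rule local_metric_eqD[OF J_img[OF t]])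
        (use bilinear_local_metric[OF J_img[OF t]] in \<open>simp add: riesz[OF J_img[OF t]] bilinear_def\<close>)
    then have \<xi>: "\<xi> = (\<Sum>b\<in>Basis. L b *\<^sub>R frame p b (c p t))"
      by (simp add: riesz_def L_def)
    have lc: "linear (change M p (q t) (q t))" using t by (intro linear_change) auto
    have "x = (\<Sum>b\<in>Basis. L b *\<^sub>R e b t)"
      unfolding x e_def by (subst \<xi>) (simp add: linear_sum[OF lc] linear_cmul[OF lc])
    then have "A t x = (\<Sum>b\<in>Basis. L b *\<^sub>R A t (e b t))"
      by (simp add: linear_sum[OF linA[OF t]] linear_cmul[OF linA[OF t]])
    then have "gnorm (q t) (A t x) \<le> (\<Sum>b\<in>Basis. \<bar>L b\<bar> * gnorm (q t) (A t (e b t)))"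
      using gnorm_sum[of Basis "q t" "\<lambda>b. L b *\<^sub>R A t (e b t)"] by (simp add: gnorm_scale)
    also have "\<dots> \<le> (\<Sum>b\<in>Basis. (gnorm (q t) (A t (e b t)) / gnorm (q t) (e b t)) * gnorm (q t) x)"
    proof (rule sum_mono)
      fix b :: 'e assume b: "b \<in> Basis"
      let ?n = "gnorm (q t) (e b t)"
      have "\<bar>L b\<bar> \<le> gnorm (q t) x * ?n / ?n\<^sup>2"
        unfolding L using metric_Cauchy_Schwarz[of "q t" x "e b t"] by (simp add: divide_right_mono)
      also have "\<dots> = gnorm (q t) x / ?n" using pos[OF t b] by (simp add: power2_eq_square)
      finally have "\<bar>L b\<bar> * gnorm (q t) (A t (e b t)) \<le> gnorm (q t) x / ?n * gnorm (q t) (A t (e b t))"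
        by (rule mult_right_mono) simp
      then show "\<bar>L b\<bar> * gnorm (q t) (A t (e b t)) \<le> (gnorm (q t) (A t (e b t)) / ?n) * gnorm (q t) x"
        by (simp add: mult.commute)
    qed
    also have "\<dots> = N t * gnorm (q t) x" by (simp add: N_def sum_distrib_right)
    finally show ?thesis .
  qed
  show ?thesis by (rule that[OF contN bound])
qed

lemma cont_endo_bounded:
  assumes A: "cont_endo K q A"
  obtains C where "0 \<le> C" and "\<And>t x. t \<in> K \<Longrightarrow> gnorm (q t) (A t x) \<le> C * gnorm (q t) x"
proof -
  define P where "P l r \<longleftrightarrow> (\<exists>C. \<forall>t\<in>{l..r} \<inter> K. \<forall>x. gnorm (q t) (A t x) \<le> C * gnorm (q t) x)" for l r
  have "P a b"
  proof (rule Bolzano[where P = P])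
    show "a \<le> b" using ab by simp
    fix l m r assume "P l m" "P m r"
    then obtain C D where C: "\<And>t x. t \<in> {l..m} \<inter> K \<Longrightarrow> gnorm (q t) (A t x) \<le> C * gnorm (q t) x"
      and D: "\<And>t x. t \<in> {m..r} \<inter> K \<Longrightarrow> gnorm (q t) (A t x) \<le> D * gnorm (q t) x"
      unfolding P_def by blast
    have "gnorm (q t) (A t x) \<le> max C D * gnorm (q t) x" if t: "t \<in> {l..r} \<inter> K" for t x
    proof -
      have "C * gnorm (q t) x \<le> max C D * gnorm (q t) x" "D * gnorm (q t) x \<le> max C D * gnorm (q t) x"
        by (auto intro: mult_right_mono)
      then show ?thesis using C[of t x] D[of t x] t by (cases "t \<le> m") auto
    qed
    then show "P l r" unfolding P_def by blast
  next
    fix t0 assume "a \<le> t0" "t0 \<le> b"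
    then have t0: "t0 \<in> J (q t0)" by auto
    obtain N where N: "continuous_on (J (q t0)) N"
      and bd: "\<And>t x. t \<in> J (q t0) \<Longrightarrow> gnorm (q t) (A t x) \<le> N t * gnorm (q t) x"
      by (rule cont_endo_locally_bounded[OF A, of "q t0"]) (rule that)
    have "continuous (at t0 within K) N"
      using N t0 unfolding at_within_J[OF t0, symmetric] continuous_on_eq_continuous_within by blast
    then obtain d1 where d1: "d1 > 0" "\<And>t. t \<in> K \<Longrightarrow> dist t t0 < d1 \<Longrightarrow> dist (N t) (N t0) < 1"
      unfolding continuous_within_eps_delta by (metis zero_less_one)
    have "continuous (at t0 within K) q"
      using continuous_on_q t0 continuous_on_eq_continuous_within by blast
    then have "\<forall>\<^sub>F t in at t0 within K. q t \<in> chart_dom M (q t0)"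
      unfolding continuous_within using open_chart_dom in_own_dom by (rule topological_tendstoD)
    then obtain d2 where d2: "d2 > 0" "\<And>t. t \<in> K \<Longrightarrow> t \<noteq> t0 \<Longrightarrow> dist t t0 < d2 \<Longrightarrow> q t \<in> chart_dom M (q t0)"
      unfolding eventually_at by blast
    show "\<exists>d>0. \<forall>l r. l \<le> t0 \<and> t0 \<le> r \<and> r - l < d \<longrightarrow> P l r"
    proof (intro exI[of _ "min d1 d2"] conjI allI impI)
      show "min d1 d2 > 0" using d1 d2 by simp
      fix l r assume lr: "l \<le> t0 \<and> t0 \<le> r \<and> r - l < min d1 d2"
      have "gnorm (q t) (A t x) \<le> (N t0 + 1) * gnorm (q t) x" if t: "t \<in> {l..r} \<inter> K" for t x
      proof -
        have dist: "dist t t0 < d1" "dist t t0 < d2" using lr t by (auto simp: dist_real_def)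
        have tJ: "t \<in> J (q t0)" using d2(2)[of t] dist t by (cases "t = t0") auto
        have "N t \<le> N t0 + 1" using d1(2)[of t] dist t by (simp add: dist_real_def)
        then have "N t * gnorm (q t) x \<le> (N t0 + 1) * gnorm (q t) x" by (rule mult_right_mono) simp
        then show ?thesis using bd[OF tJ, of x] by linarith
      qed
      then show "P l r" unfolding P_def by blast
    qed
  qed
  then have "\<exists>C. \<forall>t\<in>K. \<forall>x. gnorm (q t) (A t x) \<le> C * gnorm (q t) x"
    by (simp add: P_def)
  then obtain C where C: "\<And>t x. t \<in> K \<Longrightarrow> gnorm (q t) (A t x) \<le> C * gnorm (q t) x"
    by blast
  show ?thesis
  proof (rule that[of "\<bar>C\<bar>"])
    fix t x assume "t \<in> K"
    from C[OF this, of x] show "gnorm (q t) (A t x) \<le> \<bar>C\<bar> * gnorm (q t) x"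
      by (rule order_trans) (simp add: mult_right_mono)
  qed simp
qed

end

section \<open>Fields along an arc\<close>

lemma piecewise_conj:
  assumes "piecewise T P" "piecewise T Q"
    and "\<And>l r. 0 \<le> l \<Longrightarrow> l < r \<Longrightarrow> r \<le> T \<Longrightarrow> P {l..r} \<Longrightarrow> Q {l..r} \<Longrightarrow> R {l..r}"
  shows "piecewise T R"
proof -
  obtain B where B: "finite B" "\<And>l r. 0 \<le> l \<Longrightarrow> l < r \<Longrightarrow> r \<le> T \<Longrightarrow> {l<..<r} \<inter> B = {} \<Longrightarrow> P {l..r}"
    using assms(1) unfolding piecewise_def by auto
  obtain B' where B': "finite B'" "\<And>l r. 0 \<le> l \<Longrightarrow> l < r \<Longrightarrow> r \<le> T \<Longrightarrow> {l<..<r} \<inter> B' = {} \<Longrightarrow> Q {l..r}"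
    using assms(2) unfolding piecewise_def by auto
  show ?thesis
    unfolding piecewise_def
  proof (intro exI[of _ "B \<union> B'"] conjI allI impI)
    fix l r assume "0 \<le> l \<and> l < r \<and> r \<le> T \<and> {l<..<r} \<inter> (B \<union> B') = {}"
    then show "R {l..r}" using assms(3)[of l r] B(2)[of l r] B'(2)[of l r] by (auto simp: Int_Un_distrib)
  qed (use B B' in simp)
qed

lemma piecewise_mono:
  assumes "piecewise T P" and "\<And>l r. 0 \<le> l \<Longrightarrow> l < r \<Longrightarrow> r \<le> T \<Longrightarrow> P {l..r} \<Longrightarrow> R {l..r}"
  shows "piecewise T R"
  using piecewise_conj[OF assms(1) assms(1)] assms(2) by blast

lemma piecewise_continuous_imp_absolutely_integrable:
  fixes f :: "real \<Rightarrow> real"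
  assumes "piecewise T (\<lambda>I. \<exists>g. continuous_on I g \<and> (\<forall>t\<in>interior I. f t = g t))"
  shows "f absolutely_integrable_on {0..T}"
proof -
  obtain B where B: "finite B" "\<And>l r. 0 \<le> l \<Longrightarrow> l < r \<Longrightarrow> r \<le> T \<Longrightarrow> {l<..<r} \<inter> B = {} \<Longrightarrow>
      \<exists>g. continuous_on {l..r} g \<and> (\<forall>t\<in>interior {l..r}. f t = g t)"
    using assms unfolding piecewise_def by auto
  have "f absolutely_integrable_on {l..r}" if "0 \<le> l" "l \<le> r" "r \<le> T" for l r
    using that
  proof (induction "card ({l<..<r} \<inter> B)" arbitrary: l r rule: less_induct)
    case less
    show ?case
    proof (cases "{l<..<r} \<inter> B = {}")
      case True
      show ?thesis
      proof (cases "l = r")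
        case False
        then obtain g where g: "continuous_on {l..r} g" "\<And>t. t \<in> {l<..<r} \<Longrightarrow> f t = g t"
          using B(2)[of l r] less.prems True by auto
        show ?thesis
          by (rule absolutely_integrable_spike[OF absolutely_integrable_continuous_real[OF g(1)], of "{l, r}"])
            (use g(2) in auto)
      qed (use absolutely_integrable_negligible[of "{r}" f] in auto)
    next
      case False
      then obtain x where x: "x \<in> {l<..<r}" "x \<in> B" by blast
      have "{l<..<x} \<inter> B \<subset> {l<..<r} \<inter> B" "{x<..<r} \<inter> B \<subset> {l<..<r} \<inter> B" using x by auto
      then have "card ({l<..<x} \<inter> B) < card ({l<..<r} \<inter> B)" "card ({x<..<r} \<inter> B) < card ({l<..<r} \<inter> B)"
        using B(1) by (auto intro!: psubset_card_mono)
      then have "f absolutely_integrable_on {l..x}" "f absolutely_integrable_on {x..r}"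
        using less.hyps less.prems x by auto
      then show ?thesis by (rule absolutely_integrable_on_combine) (use x in auto)
    qed
  qed
  then show ?thesis
    by (cases "0 \<le> T") auto
qed

lemma smooth_curve_subset:
  assumes "smooth_curve M K q" "K' \<subseteq> K" shows "smooth_curve M K' q"
proof -
  have "smooth_curve_on {t \<in> K'. q t \<in> chart_dom M p} (\<lambda>t. chart M p (q t))" for p
  proof -
    have "smooth_curve_on {t \<in> K. q t \<in> chart_dom M p} (\<lambda>t. chart M p (q t))"
      using assms(1) by (simp add: smooth_curve_def)
    then obtain D where D: "D 0 = (\<lambda>t. chart M p (q t))"
      "\<And>k t. t \<in> {t \<in> K. q t \<in> chart_dom M p} \<Longrightarrow>
        (D k has_vector_derivative D (Suc k) t) (at t within {t \<in> K. q t \<in> chart_dom M p})"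
      unfolding smooth_curve_on_def by blast
    have "(D k has_vector_derivative D (Suc k) t) (at t within {t \<in> K'. q t \<in> chart_dom M p})"
      if "t \<in> {t \<in> K'. q t \<in> chart_dom M p}" for k t
      by (rule has_vector_derivative_within_subset[OF D(2)]) (use that assms(2) in auto)
    then show ?thesis unfolding smooth_curve_on_def using D(1) by blast
  qed
  moreover have "continuous_on K' q"
    using assms continuous_on_subset unfolding smooth_curve_def by blast
  ultimately show ?thesis by (simp add: smooth_curve_def)
qed

text \<open>Covariant derivatives are local, but they are one-sided at the end points of the parameter
  interval; on a subinterval they agree with those on the whole interval in the interior only.\<close>

lemma covD_interior:
  assumes "t \<in> interior K" "t \<in> interior K'" and "\<And>s. s \<in> interior K' \<Longrightarrow> X s = X' s"
  shows "covD M K q X t = covD M K' q X' t"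
proof -
  have at: "at t within K = at t" "at t within K' = at t" by (rule at_within_interior[OF assms(1)], rule at_within_interior[OF assms(2)])
  have "\<forall>\<^sub>F s in nhds t. s \<in> UNIV \<longrightarrow> field_comp M q (q t) X s = field_comp M q (q t) X' s"
    using eventually_nhds_in_open[OF open_interior assms(2)]
    by (rule eventually_mono) (simp add: field_comp_def assms(3))
  then have "vector_derivative (field_comp M q (q t) X) (at t within UNIV)
      = vector_derivative (field_comp M q (q t) X') (at t within UNIV)"
    by (rule vector_derivative_cong_eq) auto
  then show ?thesis
    unfolding covD_def at velocity_def using assms(3)[OF assms(2)] by simp
qed

locale smooth_arc = riemannian_curve M q 0 T
  for M :: "('a::{t2_space,second_countable_topology}, 'e::euclidean_space) rmfd" and q T
begin

abbreviation "G \<equiv> \<lambda>t. metric M (q t)"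
abbreviation "D \<equiv> covD M {0..T} q"
abbreviation "sq X \<equiv> \<lambda>t. G t (X t) (X t)"

lemma T_pos: "0 < T" by (rule ab)

text \<open>At a break point the second covariant derivative of an admissible field need not exist, and its value
  there is arbitrary. Requiring a continuous extension from each open piece to the closed one still gives
  boundedness, and hence integrability.\<close>

definition pw_field :: "(real \<Rightarrow> 'e) \<Rightarrow> bool"
  where "pw_field Z \<longleftrightarrow> piecewise T (\<lambda>I. \<exists>Z'. Ck_field 0 I q Z' \<and> (\<forall>t\<in>interior I. Z t = Z' t))"

lemma subarc: "0 \<le> l \<Longrightarrow> l < r \<Longrightarrow> r \<le> T \<Longrightarrow> riemannian_curve M q l r"
  using smooth_curve_subset[OF q] by unfold_locales auto

lemma pw_field_add:
  assumes "pw_field X" "pw_field Y" shows "pw_field (\<lambda>t. X t + Y t)"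
  unfolding pw_field_def
proof (rule piecewise_conj[OF assms[unfolded pw_field_def]])
  fix l r
  assume "\<exists>Z'. Ck_field 0 {l..r} q Z' \<and> (\<forall>t\<in>interior {l..r}. X t = Z' t)"
    "\<exists>Z'. Ck_field 0 {l..r} q Z' \<and> (\<forall>t\<in>interior {l..r}. Y t = Z' t)"
  then obtain X' Y' where X': "Ck_field 0 {l..r} q X'" "\<forall>t\<in>interior {l..r}. X t = X' t"
    and Y': "Ck_field 0 {l..r} q Y'" "\<forall>t\<in>interior {l..r}. Y t = Y' t" by blast
  show "\<exists>Z'. Ck_field 0 {l..r} q Z' \<and> (\<forall>t\<in>interior {l..r}. X t + Y t = Z' t)"
    by (rule exI[of _ "\<lambda>t. X' t + Y' t"]) (use X' Y' Ck_field_add in auto)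
qed

lemma pw_field_endo:
  assumes "pw_field X" and A: "cont_endo {0..T} q A" shows "pw_field (\<lambda>t. A t (X t))"
  unfolding pw_field_def
proof (rule piecewise_mono[OF assms(1)[unfolded pw_field_def]])
  fix l r :: real
  assume lr: "0 \<le> l" "l < r" "r \<le> T" "\<exists>Z'. Ck_field 0 {l..r} q Z' \<and> (\<forall>t\<in>interior {l..r}. X t = Z' t)"
  then obtain X' where X': "Ck_field 0 {l..r} q X'" "\<forall>t\<in>interior {l..r}. X t = X' t" by blast
  have "{l..r} \<subseteq> {0..T}" using lr by auto
  from cont_endo_apply[OF A this X'(1)]
  show "\<exists>Z'. Ck_field 0 {l..r} q Z' \<and> (\<forall>t\<in>interior {l..r}. A t (X t) = Z' t)"
    by (rule_tac exI[of _ "\<lambda>t. A t (X' t)"]) (use X' in auto)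
qed

lemma pw_field_metric_integrable:
  assumes "pw_field X" "pw_field Y" shows "(\<lambda>t. G t (X t) (Y t)) absolutely_integrable_on {0..T}"
proof (rule piecewise_continuous_imp_absolutely_integrable, rule piecewise_conj[OF assms[unfolded pw_field_def]])
  fix l r :: real
  assume lr: "0 \<le> l" "l < r" "r \<le> T" and "\<exists>Z'. Ck_field 0 {l..r} q Z' \<and> (\<forall>t\<in>interior {l..r}. X t = Z' t)"
    "\<exists>Z'. Ck_field 0 {l..r} q Z' \<and> (\<forall>t\<in>interior {l..r}. Y t = Z' t)"
  then obtain X' Y' where X': "Ck_field 0 {l..r} q X'" "\<forall>t\<in>interior {l..r}. X t = X' t"
    and Y': "Ck_field 0 {l..r} q Y'" "\<forall>t\<in>interior {l..r}. Y t = Y' t" by blast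
  show "\<exists>g. continuous_on {l..r} g \<and> (\<forall>t\<in>interior {l..r}. G t (X t) (Y t) = g t)"
    by (rule exI[of _ "\<lambda>t. G t (X' t) (Y' t)"])
      (use X' Y' riemannian_curve.continuous_on_metric[OF subarc[OF lr]] in auto)
qed

end

locale admissible_variation = smooth_arc M q T
  for M :: "('a::{t2_space,second_countable_topology}, 'e::euclidean_space) rmfd" and q T +
  fixes X :: "real \<Rightarrow> 'e"
  assumes X: "X \<in> T_Omega M T q"
begin

lemma Ck_X: "Ck_field 1 {0..T} q X"
  using X C1_field_imp_Ck_field by (simp add: T_Omega_def)

lemma Ck_DX: "Ck_field 0 {0..T} q (D X)"
  using Ck_X Ck_covD[of 0 X] by simp

lemma piecewise_smooth: "piecewise T (\<lambda>I. smooth_field M I q X)"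
  using X by (simp add: T_Omega_def)

lemma pw_X: "pw_field X"
  unfolding pw_field_def
  by (rule piecewise_mono[OF piecewise_smooth], rule exI[of _ X]) (simp add: smooth_field_imp_Ck_field)

lemma piece:
  assumes lr: "0 \<le> l" "l < r" "r \<le> T" and sm: "smooth_field M {l..r} q X" and t: "t \<in> interior {l..r}"
  shows "D X t = covD M {l..r} q X t"
    and "D (D X) t = covD M {l..r} q (covD M {l..r} q X) t"
proof -
  have sub: "interior {l..r} \<subseteq> interior {0..T}" by (rule interior_mono) (use lr in auto)
  have *: "D X t = covD M {l..r} q X t" if "t \<in> interior {l..r}" for t
    by (rule covD_interior) (use that sub in auto)
  show "D X t = covD M {l..r} q X t" by (rule *[OF t])
  show "D (D X) t = covD M {l..r} q (covD M {l..r} q X) t"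
    by (rule covD_interior) (use t sub * in auto)
qed

lemma piece_Ck:
  assumes lr: "0 \<le> l" "l < r" "r \<le> T" and sm: "smooth_field M {l..r} q X"
  shows "Ck_field k {l..r} q (covD M {l..r} q X)"
    and "Ck_field k {l..r} q (covD M {l..r} q (covD M {l..r} q X))"
  using riemannian_curve.Ck_covD[OF subarc[OF lr]] smooth_field_imp_Ck_field[OF sm] by blast+

lemma pw_DX: "pw_field (D X)"
  unfolding pw_field_def
proof (rule piecewise_mono[OF piecewise_smooth])
  fix l r assume lr: "0 \<le> l" "l < r" "r \<le> T" and sm: "smooth_field M {l..r} q X"
  show "\<exists>Z'. Ck_field 0 {l..r} q Z' \<and> (\<forall>t\<in>interior {l..r}. D X t = Z' t)"
    using piece_Ck(1)[OF lr sm, of 0] piece(1)[OF lr sm] by (intro exI[of _ "covD M {l..r} q X"]) simp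
qed

lemma pw_DDX: "pw_field (D (D X))"
  unfolding pw_field_def
proof (rule piecewise_mono[OF piecewise_smooth])
  fix l r assume lr: "0 \<le> l" "l < r" "r \<le> T" and sm: "smooth_field M {l..r} q X"
  show "\<exists>Z'. Ck_field 0 {l..r} q Z' \<and> (\<forall>t\<in>interior {l..r}. D (D X) t = Z' t)"
    using piece_Ck(2)[OF lr sm, of 0] piece(2)[OF lr sm]
    by (intro exI[of _ "covD M {l..r} q (covD M {l..r} q X)"]) simp
qed

lemma energy_has_derivative:
  assumes "t \<in> {0..T}"
  shows "((sq X) has_vector_derivative 2 * G t (X t) (D X t)) (at t within {0..T})"
  using metric_has_derivative[OF Ck_X Ck_X assms] metric_sym[of "q t" "D X t" "X t"] by simp

text \<open>Integration by parts of \<open>\<langle>X, DX\<rangle>\<close>, which is continuous on \<open>[0,T]\<close>, vanishes at the end points and is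
  differentiable off the break points.\<close>

lemma integral_DX_square: "((\<lambda>t. G t (D X t) (D X t) + G t (X t) (D (D X) t)) has_integral 0) {0..T}"
proof -
  obtain B where B: "finite B" "\<And>l r. 0 \<le> l \<Longrightarrow> l < r \<Longrightarrow> r \<le> T \<Longrightarrow> {l<..<r} \<inter> B = {} \<Longrightarrow> smooth_field M {l..r} q X"
    using piecewise_smooth unfolding piecewise_def by auto
  have "((\<lambda>t. G t (D X t) (D X t) + G t (X t) (D (D X) t)) has_integral (G T (X T) (D X T) - G 0 (X 0) (D X 0))) {0..T}"
  proof (rule fundamental_theorem_of_calculus_interior_strong[OF B(1), of 0 T "\<lambda>t. G t (X t) (D X t)"])
    show "0 \<le> T" using T_pos by simp
    show "continuous_on {0..T} (\<lambda>t. G t (X t) (D X t))"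
      by (rule continuous_on_metric[OF Ck_field_mono[OF Ck_X] Ck_DX]) simp
    fix t assume t: "t \<in> {0<..<T} - B"
    have "open ({0<..<T} - B)" using B(1) by (intro open_Diff finite_imp_closed) auto
    then obtain e where e: "e > 0" "cball t e \<subseteq> {0<..<T} - B" using t open_contains_cball by blast
    define l r where "l = t - e" and "r = t + e"
    have cb: "cball t e = {l..r}" by (simp add: l_def r_def cball_eq_atLeastAtMost)
    have "l \<in> cball t e" "r \<in> cball t e" using e(1) by (auto simp: cb l_def r_def)
    then have "l \<in> {0<..<T} - B" "r \<in> {0<..<T} - B" using e(2) by blast+
    moreover have "l < r" using e(1) by (simp add: l_def r_def)
    ultimately have lr: "0 \<le> l" "l < r" "r \<le> T" by auto
    have "{l<..<r} \<inter> B = {}" using e(2) cb by auto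
    then have sm: "smooth_field M {l..r} q X" using B(2) lr by blast
    interpret pc: riemannian_curve M q l r by (rule subarc[OF lr])
    have ti: "t \<in> {l<..<r}" using e(1) by (simp add: l_def r_def)
    have "((\<lambda>t. G t (X t) (covD M {l..r} q X t)) has_vector_derivative
       (G t (covD M {l..r} q X t) (covD M {l..r} q X t) + G t (X t) (covD M {l..r} q (covD M {l..r} q X) t))) (at t within {l..r})"
      by (rule pc.metric_has_derivative[OF smooth_field_imp_Ck_field[OF sm] piece_Ck(1)[OF lr sm]]) (use ti in auto)
    then have "((\<lambda>t. G t (X t) (covD M {l..r} q X t)) has_vector_derivative
       (G t (D X t) (D X t) + G t (X t) (D (D X) t))) (at t)"
      using piece[OF lr sm, of t] ti at_within_interior[of t "{l..r}"] by simp
    then show "((\<lambda>t. G t (X t) (D X t)) has_vector_derivative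
       (G t (D X t) (D X t) + G t (X t) (D (D X) t))) (at t)"
      by (rule has_vector_derivative_transform_within_open[of _ _ _ "{l<..<r}"])
        (use piece(1)[OF lr sm] ti in auto)
  qed
  moreover have "X 0 = 0" "X T = 0" using X by (auto simp: T_Omega_def)
  ultimately show ?thesis using bilinear_lzero[OF bilinear_metric] by simp
qed

end

context smooth_arc
begin

text \<open>All that the estimates use of \<open>F\<close> and of the potential: in every term \<open>X\<close> or one of its derivatives occurs
  exactly once, as the first argument of a tensor, and the other arguments are continuous along \<open>q\<close>.\<close>

lemma F_tensor_decomposition:
  assumes V: "smooth_function M V"
  shows "\<exists>A0 A1 A2. cont_endo {0..T} q A0 \<and> cont_endo {0..T} q A1 \<and> cont_endo {0..T} q A2 \<and>
    (\<forall>t x x1 x2. F_tensor M T q t x x1 x2 + nabla_grad M V (q t) x = A0 t x + A1 t x1 + A2 t x2)"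
proof -
  define Y where "Y = velocity M {0..T} q"
  define Y1 where "Y1 = D Y"
  define Y2 where "Y2 = D Y1"
  define R where "R = (\<lambda>t. curvature M (q t))"
  define DR where "DR = covD_tensor M {0..T} q R"
  define DDR where "DDR = covD_tensor M {0..T} q DR"
  have Y: "Ck_field k {0..T} q Y" for k unfolding Y_def by (rule Ck_velocity)
  have Y1: "Ck_field k {0..T} q Y1" for k unfolding Y1_def by (rule Ck_covD[OF Y])
  have Y2: "Ck_field k {0..T} q Y2" for k unfolding Y2_def by (rule Ck_covD[OF Y1])
  have R: "Ck_tensor k {0..T} q R" for k unfolding R_def by (rule Ck_curvature)
  have DR: "Ck_tensor k {0..T} q DR" for k unfolding DR_def by (rule Ck_covD_tensor[OF R])
  have DDR: "Ck_tensor k {0..T} q DDR" for k unfolding DDR_def by (rule Ck_covD_tensor[OF DR])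
  note tensor = cont_endo_tensor[OF cont_endo_id]
  note RYY = tensor[OF R Y Y]
  define A0 where "A0 t x = DDR t x (Y t) (Y t) + nabla_curv M (q t) x (Y1 t) (Y t) (Y t)
      + R t (R t x (Y t) (Y t)) (Y t) (Y t) + R t x (Y2 t) (Y t) + 2 *\<^sub>R DR t x (Y1 t) (Y t)
      + 3 *\<^sub>R (DR t x (Y t) (Y1 t) + R t x (Y t) (Y2 t) + R t x (Y1 t) (Y1 t)) + nabla_grad M V (q t) x" for t x
  define A1 where "A1 t x = 2 *\<^sub>R DR t x (Y t) (Y t) + 4 *\<^sub>R R t x (Y t) (Y1 t)" for t x
  define A2 where "A2 t x = 2 *\<^sub>R R t x (Y t) (Y t)" for t x
  show ?thesis
  proof (intro exI conjI allI)
    show "cont_endo {0..T} q A0"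
      unfolding A0_def[abs_def]
      by (rule cont_endo_add cont_endo_scale tensor[OF DDR Y Y] cont_endo_nabla_curv[OF Y1 Y Y]
        cont_endo_tensor[OF RYY R Y Y] tensor[OF R Y2 Y] tensor[OF DR Y1 Y] tensor[OF DR Y Y1]
        tensor[OF R Y Y2] tensor[OF R Y1 Y1] cont_endo_nabla_grad[OF V])+
    show "cont_endo {0..T} q A1"
      unfolding A1_def[abs_def]
      by (rule cont_endo_add cont_endo_scale tensor[OF DR Y Y] tensor[OF R Y Y1])+
    show "cont_endo {0..T} q A2"
      unfolding A2_def[abs_def]
      by (rule cont_endo_scale RYY)+
    show "F_tensor M T q t x x1 x2 + nabla_grad M V (q t) x = A0 t x + A1 t x1 + A2 t x2" for t x x1 x2
      by (simp add: F_tensor_def Let_def A0_def A1_def A2_def Y_def[symmetric] Y1_def[symmetric] Y2_def[symmetric]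
        R_def[symmetric] DR_def[symmetric] DDR_def[symmetric] fun_cong[OF R_def, symmetric] scaleR_add_right)
  qed
qed

end

section \<open>Dimension and almost everywhere limits\<close>

text \<open>By induction on the functionals: an element on which one of them does not vanish, together with a
  spanning set for its kernel, spans.\<close>

lemma finite_spanning_set_of_functionals:
  fixes L :: "'i \<Rightarrow> 'v::real_vector \<Rightarrow> real"
  assumes "finite I" and "\<And>i. i \<in> I \<Longrightarrow> linear (L i)" and "subspace S"
    and "\<And>x. x \<in> S \<Longrightarrow> (\<And>i. i \<in> I \<Longrightarrow> L i x = 0) \<Longrightarrow> x = 0"
  shows "\<exists>B. finite B \<and> card B \<le> card I \<and> S \<subseteq> span B"
  using assms
proof (induction I arbitrary: S rule: finite_induct)
  case empty
  then have "S \<subseteq> span {}" by (simp add: subset_iff)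
  then show ?case by (intro exI[of _ "{}"]) simp
next
  case (insert i I)
  have lin: "linear (L i)" by (rule insert.prems(1)) simp
  define S' where "S' = {x \<in> S. L i x = 0}"
  have "subspace S'"
  proof (rule subspaceI)
    show "0 \<in> S'" by (simp add: S'_def linear_0[OF lin] subspace_0[OF insert.prems(2)])
    show "x + y \<in> S'" if "x \<in> S'" "y \<in> S'" for x y
      using that by (simp add: S'_def linear_add[OF lin] subspace_add[OF insert.prems(2)])
    show "r *\<^sub>R x \<in> S'" if "x \<in> S'" for r x
      using that by (simp add: S'_def linear_cmul[OF lin] subspace_scale[OF insert.prems(2)])
  qed
  moreover have "x = 0" if "x \<in> S'" "\<And>j. j \<in> I \<Longrightarrow> L j x = 0" for x
  proof (rule insert.prems(3))
    show "x \<in> S" using that(1) by (simp add: S'_def)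
    show "L j x = 0" if "j \<in> insert i I" for j
      using that \<open>x \<in> S'\<close> \<open>\<And>j. j \<in> I \<Longrightarrow> L j x = 0\<close> by (cases "j = i") (simp_all add: S'_def)
  qed
  moreover have "linear (L j)" if "j \<in> I" for j
    by (rule insert.prems(1)) (simp add: that)
  ultimately have "\<exists>B. finite B \<and> card B \<le> card I \<and> S' \<subseteq> span B"
    using insert.IH[of S'] by blast
  then obtain B where B: "finite B" "card B \<le> card I" "S' \<subseteq> span B"
    by blast
  show ?case
  proof (cases "S \<subseteq> S'")
    case True
    have "card B \<le> card (insert i I)" using B(2) insert.hyps by simp
    moreover have "S \<subseteq> span B" using True B(3) by (rule subset_trans)
    ultimately show ?thesis using B(1) by blast
  next
    case False
    then obtain x0 where x0: "x0 \<in> S" "L i x0 \<noteq> 0" unfolding S'_def by blast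
    have "S \<subseteq> span (insert x0 B)"
    proof
      fix x assume x: "x \<in> S"
      have "x - (L i x / L i x0) *\<^sub>R x0 \<in> S"
        by (intro subspace_diff subspace_scale insert.prems(2) x x0(1))
      moreover have "L i (x - (L i x / L i x0) *\<^sub>R x0) = 0"
        using x0(2) by (simp add: linear_diff[OF lin] linear_cmul[OF lin])
      ultimately have "x - (L i x / L i x0) *\<^sub>R x0 \<in> span B" using B(3) unfolding S'_def by blast
      then show "x \<in> span (insert x0 B)" unfolding span_insert by blast
    qed
    moreover have "card (insert x0 B) \<le> card (insert i I)"
      using B(1,2) insert.hyps by (simp add: card_insert_if)
    moreover have "finite (insert x0 B)" using B(1) by simp
    ultimately show ?thesis by blast
  qed
qed

lemma edim_le_card_functionals:
  fixes L :: "'i \<Rightarrow> 'v::real_vector \<Rightarrow> real"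
  assumes "finite I" and "\<And>i. i \<in> I \<Longrightarrow> linear (L i)" and "subspace S"
    and "\<And>x. x \<in> S \<Longrightarrow> (\<And>i. i \<in> I \<Longrightarrow> L i x = 0) \<Longrightarrow> x = 0"
  shows "edim S \<le> enat (card I)"
proof -
  have "\<exists>B. finite B \<and> card B \<le> card I \<and> S \<subseteq> span B"
    by (rule finite_spanning_set_of_functionals[where L = L]) (use assms in auto)
  then obtain B where B: "finite B" "card B \<le> card I" "S \<subseteq> span B" by blast
  have "dim S \<le> card I" by (rule order_trans[OF dim_le_card[OF B(3,1)] B(2)])
  moreover have "edim S = enat (dim S)"
    unfolding edim_def by (rule if_P) (use B in blast)
  ultimately show ?thesis by simp
qed

lemma borel_measurable_AE_LIMSEQ:
  fixes h :: "nat \<Rightarrow> real \<Rightarrow> real"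
  assumes h: "\<And>k. h k \<in> borel_measurable lebesgue" and lim: "AE t in lebesgue. (\<lambda>k. h k t) \<longlonglongrightarrow> g t"
  shows "g \<in> borel_measurable lebesgue"
proof -
  obtain N where N: "N \<in> null_sets lebesgue" "{t. \<not> (\<lambda>k. h k t) \<longlonglongrightarrow> g t} \<subseteq> N"
    using lim unfolding eventually_ae_filter by auto
  have "(\<lambda>t. indicator (- N) t * g t) \<in> borel_measurable lebesgue"
  proof (rule borel_measurable_LIMSEQ_metric)
    show "(\<lambda>t. indicator (- N) t * h k t) \<in> borel_measurable lebesgue" for k
    proof (intro borel_measurable_times borel_measurable_indicator h)
      show "- N \<in> sets lebesgue" using sets.compl_sets[OF null_setsD2[OF N(1)]] by (simp add: Compl_eq_Diff_UNIV)
    qed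
    show "(\<lambda>k. indicator (- N) t * h k t) \<longlonglongrightarrow> indicator (- N) t * g t" for t
      using N(2) by (cases "t \<in> N") (auto intro: tendsto_mult)
  qed
  moreover have "AE t in lebesgue. indicator (- N) t * g t = g t"
    using AE_not_in[OF N(1)] by eventually_elim simp
  ultimately show ?thesis by (rule borel_measurable_AE)
qed

lemma absolutely_integrable_AE_limit:
  fixes h :: "nat \<Rightarrow> real \<Rightarrow> real"
  assumes h: "\<And>k. h k absolutely_integrable_on S" and b: "b absolutely_integrable_on S"
    and lim: "AE t in lebesgue. t \<in> S \<longrightarrow> (\<lambda>k. h k t) \<longlonglongrightarrow> g t"
    and bound: "\<And>t. t \<in> S \<Longrightarrow> \<bar>g t\<bar> \<le> b t"
  shows "g absolutely_integrable_on S"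
  unfolding set_integrable_def
proof (rule Bochner_Integration.integrable_bound[OF b[unfolded set_integrable_def]])
  show "(\<lambda>t. indicator S t *\<^sub>R g t) \<in> borel_measurable lebesgue"
  proof (rule borel_measurable_AE_LIMSEQ)
    show "(\<lambda>t. indicator S t *\<^sub>R h k t) \<in> borel_measurable lebesgue" for k
      using h[of k] unfolding set_integrable_def by (rule borel_measurable_integrable)
    show "AE t in lebesgue. (\<lambda>k. indicator S t *\<^sub>R h k t) \<longlonglongrightarrow> indicator S t *\<^sub>R g t"
      using lim by eventually_elim (auto simp: indicator_def)
  qed
  show "AE t in lebesgue. norm (indicator S t *\<^sub>R g t) \<le> norm (indicator S t *\<^sub>R b t)"
  proof (rule AE_I2)
    show "norm (indicator S t *\<^sub>R g t) \<le> norm (indicator S t *\<^sub>R b t)" for t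
      using bound[of t] by (cases "t \<in> S") auto
  qed
qed

lemma AE_lebesgue_dense:
  assumes "AE t in lebesgue. P t" and "(a::real) < b"
  shows "\<exists>t\<in>{a<..<b}. P t"
proof (rule ccontr)
  assume "\<not> (\<exists>t\<in>{a<..<b}. P t)"
  moreover obtain N where "negligible N" "{t. \<not> P t} \<subseteq> N"
    using assms(1) eventually_ae_filter_negligible by blast
  ultimately have "{a<..<b} \<subseteq> N" "negligible N" by blast+
  then have "negligible {a<..<b}" by (metis negligible_subset)
  then show False using open_not_negligible[of "{a<..<b}"] assms(2) by auto
qed

lemma mult_le_half_squares:
  fixes a b r :: real
  assumes "0 < r" shows "a * b \<le> (r * a\<^sup>2 + b\<^sup>2 / r) / 2"
proof -
  have "0 \<le> (r * a - b)\<^sup>2 / r" using assms by simp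
  also have "\<dots> = r * a\<^sup>2 - 2 * (a * b) + b\<^sup>2 / r"
    using assms by (simp add: power2_eq_square field_simps)
  finally show ?thesis by simp
qed

context riemannian
begin

lemma metric_le_half_squares:
  assumes "0 < r" shows "\<bar>metric M p x y\<bar> \<le> (r * metric M p x x + metric M p y y / r) / 2"
  using order_trans[OF metric_Cauchy_Schwarz mult_le_half_squares[OF assms]]
  by (simp add: gnorm_square)

lemma metric_tendsto:
  assumes u: "(\<lambda>k. gnorm p (u k - u0)) \<longlonglongrightarrow> 0" and v: "(\<lambda>k. gnorm p (v k - v0)) \<longlonglongrightarrow> 0"
  shows "(\<lambda>k. metric M p (u k) (v k)) \<longlonglongrightarrow> metric M p u0 v0"
proof -
  let ?b = "\<lambda>k. gnorm p (u k - u0) * gnorm p (v k - v0) + gnorm p (u k - u0) * gnorm p v0 + gnorm p u0 * gnorm p (v k - v0)"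
  have "?b \<longlonglongrightarrow> 0 * 0 + 0 * gnorm p v0 + gnorm p u0 * 0"
    by (intro tendsto_intros u v)
  then have b: "?b \<longlonglongrightarrow> 0" by simp
  have "norm (metric M p (u k) (v k) - metric M p u0 v0) \<le> ?b k" for k
  proof -
    have "metric M p (u k) (v k) - metric M p u0 v0
        = metric M p (u k - u0) (v k - v0) + metric M p (u k - u0) v0 + metric M p u0 (v k - v0)"
      by (simp add: metric_linear)
    then show ?thesis
      using metric_Cauchy_Schwarz[of p "u k - u0" "v k - v0"] metric_Cauchy_Schwarz[of p "u k - u0" v0]
        metric_Cauchy_Schwarz[of p u0 "v k - v0"] by simp
  qed
  then have "(\<lambda>k. metric M p (u k) (v k) - metric M p u0 v0) \<longlonglongrightarrow> 0"
    by (intro Lim_null_comparison[OF _ b] always_eventually allI)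
  then show ?thesis by (simp add: LIM_zero_iff)
qed

end

section \<open>Inequalities for admissible fields\<close>

context admissible_variation
begin

lemma metric_integrable:
  "(sq X) integrable_on {0..T}" "(sq (D X)) integrable_on {0..T}"
  "(sq (D (D X))) integrable_on {0..T}" "(\<lambda>t. G t (X t) (D X t)) integrable_on {0..T}"
  using pw_field_metric_integrable pw_X pw_DX pw_DDX set_lebesgue_integral_eq_integral(1) by blast+

text \<open>The fundamental theorem of calculus for \<open>(d - t) |X|\<^sup>2\<close>, followed by absorption of half of \<open>|X|\<^sup>2\<close> on the
  left. The weight vanishes at \<open>d\<close>, which leaves only the boundary term at \<open>l\<close>; squared norms suffice, so
  that \<open>|X|\<close> is never differentiated.\<close>

lemma poincare:
  assumes cd: "0 \<le> l" "l < d" "d \<le> T"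
  shows "integral {l..d} (sq X)
    \<le> 2 * (d - l) * G l (X l) (X l) + 4 * (d - l)\<^sup>2 * integral {l..d} (sq (D X))"
proof -
  have sub: "{l..d} \<subseteq> {0..T}" using cd by auto
  note int = metric_integrable(1,2)[THEN integrable_on_subinterval, OF sub]
  define S where "S t = G t (X t) (X t) - (d - t) * (2 * G t (X t) (D X t))" for t
  have "((\<lambda>t. - S t) has_integral ((d - d) * G d (X d) (X d) - (d - l) * G l (X l) (X l))) {l..d}"
  proof (rule fundamental_theorem_of_calculus)
    fix t assume t: "t \<in> {l..d}"
    have "((sq X) has_vector_derivative 2 * G t (X t) (D X t)) (at t within {l..d})"
      by (rule has_vector_derivative_within_subset[OF energy_has_derivative sub]) (use t sub in auto)
    then have e: "((sq X) has_real_derivative 2 * G t (X t) (D X t)) (at t within {l..d})"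
      by (simp add: has_real_derivative_iff_has_vector_derivative)
    have "((\<lambda>t. (d - t) * G t (X t) (X t)) has_real_derivative - S t) (at t within {l..d})"
      unfolding S_def by (rule derivative_eq_intros refl e)+ (simp add: algebra_simps)
    then show "((\<lambda>t. (d - t) * G t (X t) (X t)) has_vector_derivative - S t) (at t within {l..d})"
      by (simp add: has_real_derivative_iff_has_vector_derivative)
  qed (use cd in simp)
  from has_integral_neg[OF this]
  have S: "(S has_integral (d - l) * G l (X l) (X l)) {l..d}" by simp
  have "G t (X t) (X t) \<le> 2 * S t + 4 * (d - l)\<^sup>2 * G t (D X t) (D X t)" if t: "t \<in> {l..d}" for t
  proof -
    have "G t (X t) ((2 * (d - t)) *\<^sub>R D X t) \<le> (1 * G t (X t) (X t) + G t ((2 * (d - t)) *\<^sub>R D X t) ((2 * (d - t)) *\<^sub>R D X t) / 1) / 2"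
      using abs_le_D1[OF metric_le_half_squares[of 1 "q t" "X t" "(2 * (d - t)) *\<^sub>R D X t"]] by simp
    then have 2: "2 * (d - t) * G t (X t) (D X t) \<le> G t (X t) (X t) / 2 + 2 * (d - t)\<^sup>2 * G t (D X t) (D X t)"
      unfolding metric_scale by (simp add: power2_eq_square algebra_simps)
    have "(d - t)\<^sup>2 * G t (D X t) (D X t) \<le> (d - l)\<^sup>2 * G t (D X t) (D X t)"
      using t by (intro mult_right_mono power_mono metric_nonneg) auto
    with 2 show ?thesis unfolding S_def by (simp add: algebra_simps)
  qed
  then have "integral {l..d} (sq X) \<le> integral {l..d} (\<lambda>t. 2 * S t + 4 * (d - l)\<^sup>2 * G t (D X t) (D X t))"
    using S int by (intro integral_le integrable_add integrable_on_mult_right) auto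
  also have "\<dots> = 2 * ((d - l) * G l (X l) (X l)) + 4 * (d - l)\<^sup>2 * integral {l..d} (sq (D X))"
    by (subst integral_add[OF integrable_on_mult_right[OF has_integral_integrable[OF S]] integrable_on_mult_right[OF int(2)]])
      (simp add: integral_unique[OF S])
  finally show ?thesis by (simp only: mult.assoc)
qed

text \<open>The parameter \<open>r\<close> replaces the product of norms that Cauchy-Schwarz would give, because sums of
  integrals pass to the limit directly.\<close>

lemma interpolation:
  assumes r: "0 < r"
  shows "integral {0..T} (sq (D X)) \<le>
    (r * integral {0..T} (sq X) + integral {0..T} (sq (D (D X))) / r) / 2"
proof -
  let ?S = "\<lambda>t. G t (D X t) (D X t) + G t (X t) (D (D X) t)"
  let ?b = "\<lambda>t. (r / 2) * G t (X t) (X t) + (1 / (2 * r)) * G t (D (D X) t) (D (D X) t)"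
  note int = metric_integrable
  have b: "?b integrable_on {0..T}" by (intro integrable_add integrable_on_mult_right int)
  have "integral {0..T} (sq (D X)) \<le> integral {0..T} (\<lambda>t. ?S t + ?b t)"
  proof (rule integral_le[OF int(2)])
    show "(\<lambda>t. ?S t + ?b t) integrable_on {0..T}"
      by (rule integrable_add[OF has_integral_integrable[OF integral_DX_square] b])
    show "G t (D X t) (D X t) \<le> ?S t + ?b t" for t
      using abs_le_D2[OF metric_le_half_squares[OF r, of "q t" "X t" "D (D X) t"]] by (simp add: add_divide_distrib)
  qed
  also have "\<dots> = integral {0..T} ?b"
    by (subst integral_add[OF has_integral_integrable[OF integral_DX_square] b])
      (simp add: integral_unique[OF integral_DX_square])
  also have "\<dots> = (r / 2) * integral {0..T} (sq X) + (1 / (2 * r)) * integral {0..T} (sq (D (D X)))"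
    by (subst integral_add[OF integrable_on_mult_right[OF int(1)] integrable_on_mult_right[OF int(3)]]) simp
  finally show ?thesis by (simp add: add_divide_distrib)
qed

end

section \<open>Passage to limits in the mean\<close>

context smooth_arc
begin

definition AE_tendsto :: "(nat \<Rightarrow> real \<Rightarrow> 'e) \<Rightarrow> (real \<Rightarrow> 'e) \<Rightarrow> bool"
  where "AE_tendsto f g \<longleftrightarrow> (AE t in lebesgue. t \<in> {0..T} \<longrightarrow> (\<lambda>k. gnorm (q t) (f k t - g t)) \<longlonglongrightarrow> 0)"

abbreviation sqdist :: "(nat \<Rightarrow> real \<Rightarrow> 'e) \<Rightarrow> (real \<Rightarrow> 'e) \<Rightarrow> nat \<Rightarrow> real \<Rightarrow> real"
  where "sqdist f g k t \<equiv> G t (f k t - g t) (f k t - g t)"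

lemma L2_tendstoD:
  assumes "L2_tendsto M T q f g"
  shows "sqdist f g k absolutely_integrable_on {0..T}" "(\<lambda>k. integral {0..T} (sqdist f g k)) \<longlonglongrightarrow> 0"
proof -
  have 1: "sqdist f g k absolutely_integrable_on {0..T}" for k
    using assms by (simp add: L2_tendsto_def)
  have 2: "(\<lambda>k. LINT t:{0..T}|lebesgue. sqdist f g k t) \<longlonglongrightarrow> 0"
    using assms by (simp add: L2_tendsto_def)
  show "sqdist f g k absolutely_integrable_on {0..T}" by (rule 1)
  show "(\<lambda>k. integral {0..T} (sqdist f g k)) \<longlonglongrightarrow> 0"
    using 2 by (simp add: set_lebesgue_integral_eq_integral(2)[OF 1])
qed

lemma L2_tendsto_subseq:
  assumes "L2_tendsto M T q f g" "strict_mono r" shows "L2_tendsto M T q (\<lambda>k. f (r k)) g"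
  using assms LIMSEQ_subseq_LIMSEQ[of _ _ r] by (auto simp: L2_tendsto_def o_def)

text \<open>Convergence of the sum of the three squared distances to \<open>0\<close> in \<open>L\<^sup>1\<close> yields a subsequence that works for all
  three sequences at once.\<close>

lemma joint_AE_subsequence:
  assumes L: "L2_tendsto M T q f0 g0" "L2_tendsto M T q f1 g1" "L2_tendsto M T q f2 g2"
  obtains r where "strict_mono (r :: nat \<Rightarrow> nat)" "AE_tendsto (\<lambda>k. f0 (r k)) g0"
    "AE_tendsto (\<lambda>k. f1 (r k)) g1" "AE_tendsto (\<lambda>k. f2 (r k)) g2"
proof -
  define s where "s k t = sqdist f0 g0 k t + sqdist f1 g1 k t + sqdist f2 g2 k t" for k t
  note ai = L2_tendstoD(1)[OF L(1)] L2_tendstoD(1)[OF L(2)] L2_tendstoD(1)[OF L(3)]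
  have s: "s k absolutely_integrable_on {0..T}" for k
    unfolding s_def by (intro set_integral_add(1) ai)
  have "integral {0..T} (s k) = integral {0..T} (sqdist f0 g0 k) + integral {0..T} (sqdist f1 g1 k) + integral {0..T} (sqdist f2 g2 k)" for k
    unfolding s_def using ai by (simp add: integral_add integrable_add set_lebesgue_integral_eq_integral(1))
  then have "(\<lambda>k. integral {0..T} (s k)) \<longlonglongrightarrow> 0 + 0 + 0"
    by (simp only:) (intro tendsto_add L2_tendstoD(2) L)
  then have lim: "(\<lambda>k. LINT t|lebesgue. norm (indicator {0..T} t *\<^sub>R s k t)) \<longlonglongrightarrow> 0"
  proof -
    have "norm (indicator {0..T} t *\<^sub>R s k t) = indicator {0..T} t *\<^sub>R s k t" for k t
      using metric_nonneg by (simp add: s_def indicator_def)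
    then have "(LINT t|lebesgue. norm (indicator {0..T} t *\<^sub>R s k t)) = integral {0..T} (s k)" for k
      using set_lebesgue_integral_eq_integral(2)[OF s[of k]] by (simp add: set_lebesgue_integral_def)
    then show ?thesis using \<open>(\<lambda>k. integral {0..T} (s k)) \<longlonglongrightarrow> 0 + 0 + 0\<close> by simp
  qed
  obtain r where r: "strict_mono (r :: nat \<Rightarrow> nat)"
    "AE t in lebesgue. (\<lambda>k. indicator {0..T} t *\<^sub>R s (r k) t) \<longlonglongrightarrow> 0"
    using tendsto_L1_AE_subseq[OF s[unfolded set_integrable_def] lim] by blast
  have gn: "(\<lambda>k. gnorm (q t) (f (r k) t - g t)) \<longlonglongrightarrow> 0"
    if "(\<lambda>k. s (r k) t) \<longlonglongrightarrow> 0" "\<And>k. sqdist f g k t \<le> s k t" for f g t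
  proof -
    have "(\<lambda>k. sqdist f g (r k) t) \<longlonglongrightarrow> 0"
      by (rule tendsto_sandwich[OF _ _ tendsto_const that(1)]) (auto simp: metric_nonneg that(2))
    then have "(\<lambda>k. sqrt (sqdist f g (r k) t)) \<longlonglongrightarrow> sqrt 0" by (rule tendsto_real_sqrt)
    then show ?thesis by (simp add: gnorm_def)
  qed
  have le: "sqdist f0 g0 k t \<le> s k t" "sqdist f1 g1 k t \<le> s k t" "sqdist f2 g2 k t \<le> s k t" for k t
    using metric_nonneg[of "q t" "f0 k t - g0 t"] metric_nonneg[of "q t" "f1 k t - g1 t"] metric_nonneg[of "q t" "f2 k t - g2 t"]
    by (simp_all add: s_def)
  have "AE t in lebesgue. t \<in> {0..T} \<longrightarrow> (\<lambda>k. s (r k) t) \<longlonglongrightarrow> 0"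
    using r(2) by eventually_elim (auto simp: indicator_def)
  then have "AE_tendsto (\<lambda>k. f0 (r k)) g0" "AE_tendsto (\<lambda>k. f1 (r k)) g1" "AE_tendsto (\<lambda>k. f2 (r k)) g2"
    unfolding AE_tendsto_def by (eventually_elim, use gn le in blast)+
  then show ?thesis using that r(1) by blast
qed

lemma metric_shift_le:
  assumes "0 < e"
  shows "\<bar>metric M p x x - metric M p y y\<bar> \<le> (1 + 1 / e) * metric M p (x - y) (x - y) + e * metric M p y y"
proof -
  have "metric M p x x - metric M p y y = metric M p (x - y) (x - y) + 2 * metric M p y (x - y)"
    by (simp add: metric_linear metric_sym[of p y x])
  moreover have "2 * \<bar>metric M p y (x - y)\<bar> \<le> e * metric M p y y + metric M p (x - y) (x - y) / e"
    using metric_le_half_squares[OF assms, of p y "x - y"] by simp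
  ultimately show ?thesis
    using metric_nonneg[of p "x - y"] by (simp add: algebra_simps abs_le_iff) linarith
qed

text \<open>The limit field is an arbitrary function; measurability of its squared length comes from
  convergence almost everywhere.\<close>

lemma L2_limit_integrable:
  assumes f: "\<And>k. pw_field (f k)" and L: "L2_tendsto M T q f g" and AE: "AE_tendsto f g"
  shows "(sq g) absolutely_integrable_on {0..T}"
proof (rule absolutely_integrable_AE_limit)
  show "(sq (f k)) absolutely_integrable_on {0..T}" for k
    by (rule pw_field_metric_integrable[OF f f])
  show "(\<lambda>t. 2 * G t (f 0 t) (f 0 t) + 2 * sqdist f g 0 t) absolutely_integrable_on {0..T}"
    by (intro set_integral_add(1) set_integrable_mult_right pw_field_metric_integrable f L2_tendstoD(1)[OF L])
  show "AE t in lebesgue. t \<in> {0..T} \<longrightarrow> (\<lambda>k. G t (f k t) (f k t)) \<longlonglongrightarrow> G t (g t) (g t)"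
    using AE unfolding AE_tendsto_def by eventually_elim (auto intro: metric_tendsto)
  show "\<bar>G t (g t) (g t)\<bar> \<le> 2 * G t (f 0 t) (f 0 t) + 2 * sqdist f g 0 t" for t
    using metric_shift_le[of 1 "q t" "g t" "f 0 t"] metric_nonneg[of "q t" "g t"]
    by (simp add: metric_linear metric_sym[of "q t" "g t" "f 0 t"])
qed

lemma L2_limit_integral:
  assumes f: "\<And>k. pw_field (f k)" and L: "L2_tendsto M T q f g" and AE: "AE_tendsto f g"
    and cd: "0 \<le> l" "d \<le> T"
  shows "(\<lambda>k. integral {l..d} (sq (f k))) \<longlonglongrightarrow> integral {l..d} (sq g)"
proof -
  have sub: "{l..d} \<subseteq> {0..T}" using cd by auto
  have ai: "(sq g) integrable_on {0..T}" "\<And>k. (sq (f k)) integrable_on {0..T}"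
    "\<And>k. sqdist f g k integrable_on {0..T}"
    using L2_limit_integrable[OF f L AE] pw_field_metric_integrable[OF f f] L2_tendstoD(1)[OF L]
      set_lebesgue_integral_eq_integral(1) by blast+
  note ai' = ai[THEN integrable_on_subinterval, OF sub]
  define N where "N = integral {0..T} (sq g)"
  have N: "N \<ge> 0" unfolding N_def by (intro integral_nonneg ai metric_nonneg)
  have est: "\<bar>integral {l..d} (sq (f k)) - integral {l..d} (sq g)\<bar>
      \<le> (1 + 1 / e) * integral {0..T} (sqdist f g k) + e * N" if e: "e > 0" for e k
  proof -
    let ?h = "\<lambda>t. (1 + 1 / e) * sqdist f g k t + e * G t (g t) (g t)"
    have h: "?h integrable_on {0..T}" by (intro integrable_add integrable_on_mult_right ai)
    have "\<bar>integral {l..d} (sq (f k)) - integral {l..d} (sq g)\<bar>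
        = norm (integral {l..d} (\<lambda>t. G t (f k t) (f k t) - G t (g t) (g t)))"
      using ai' by (simp add: integral_diff)
    also have "\<dots> \<le> integral {l..d} ?h"
      using metric_shift_le[OF e] ai' integrable_on_subinterval[OF h sub]
      by (intro integral_norm_bound_integral integrable_diff) auto
    also have "\<dots> \<le> integral {0..T} ?h"
      using h integrable_on_subinterval[OF h sub] sub e
      by (intro integral_subset_le) (auto intro!: add_nonneg_nonneg mult_nonneg_nonneg metric_nonneg)
    also have "\<dots> = (1 + 1 / e) * integral {0..T} (sqdist f g k) + e * N"
      unfolding N_def by (subst integral_add) (auto intro!: integrable_on_mult_right ai)
    finally show ?thesis .
  qed
  show ?thesis
  proof (rule LIMSEQ_I)
    fix e :: real assume e: "e > 0"
    define e' where "e' = e / (2 * (N + 1))"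
    have e': "e' > 0" using e N by (simp add: e'_def)
    have "e' * N \<le> e / 2" using e N by (simp add: e'_def field_simps)
    have "(\<lambda>k. (1 + 1 / e') * integral {0..T} (sqdist f g k)) \<longlonglongrightarrow> (1 + 1 / e') * 0"
      by (intro tendsto_mult tendsto_const L2_tendstoD(2)[OF L])
    then have "\<forall>\<^sub>F k in sequentially. (1 + 1 / e') * integral {0..T} (sqdist f g k) < e / 2"
      using e by (intro order_tendstoD(2)) auto
    then obtain n where n: "\<And>k. k \<ge> n \<Longrightarrow> (1 + 1 / e') * integral {0..T} (sqdist f g k) < e / 2"
      unfolding eventually_sequentially by blast
    show "\<exists>n. \<forall>k\<ge>n. norm (integral {l..d} (sq (f k)) - integral {l..d} (sq g)) < e"
    proof (intro exI[of _ n] allI impI)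
      fix k assume "k \<ge> n"
      from n[OF this] est[OF e', of k] \<open>e' * N \<le> e / 2\<close>
      show "norm (integral {l..d} (sq (f k)) - integral {l..d} (sq g)) < e"
        unfolding real_norm_def by linarith
    qed
  qed
qed

end

section \<open>Fields with two weak derivatives\<close>

locale weak_field = smooth_arc M q T
  for M :: "('a::{t2_space,second_countable_topology}, 'e::euclidean_space) rmfd" and q T +
  fixes X X1 X2 :: "real \<Rightarrow> 'e"
  assumes X: "continuous_field M {0..T} q X" and weak: "has_weak_derivs M T q X (X1, X2)"
begin

definition approximates :: "(nat \<Rightarrow> real \<Rightarrow> 'e) \<Rightarrow> bool"
  where "approximates Xs \<longleftrightarrow> (\<forall>k. Xs k \<in> T_Omega M T q) \<and>
    (L2_tendsto M T q Xs X \<and> L2_tendsto M T q (\<lambda>k. D (Xs k)) X1 \<and> L2_tendsto M T q (\<lambda>k. D (D (Xs k))) X2) \<and>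
    AE_tendsto Xs X \<and> AE_tendsto (\<lambda>k. D (Xs k)) X1 \<and> AE_tendsto (\<lambda>k. D (D (Xs k))) X2"

lemma approximates_exists: "\<exists>Xs. approximates Xs"
proof -
  obtain Xs where Xs: "\<And>k. Xs k \<in> T_Omega M T q" and L: "L2_tendsto M T q Xs X"
    "L2_tendsto M T q (\<lambda>k. D (Xs k)) X1" "L2_tendsto M T q (\<lambda>k. D (D (Xs k))) X2"
    using weak by (auto simp: has_weak_derivs_def Let_def)
  obtain r where "strict_mono (r :: nat \<Rightarrow> nat)" "AE_tendsto (\<lambda>k. Xs (r k)) X"
    "AE_tendsto (\<lambda>k. D (Xs (r k))) X1" "AE_tendsto (\<lambda>k. D (D (Xs (r k)))) X2"
    by (rule joint_AE_subsequence[OF L])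
  then have "approximates (\<lambda>k. Xs (r k))"
    unfolding approximates_def using Xs L[THEN L2_tendsto_subseq] by simp
  then show ?thesis by blast
qed

definition Xs :: "nat \<Rightarrow> real \<Rightarrow> 'e"
  where "Xs = (SOME Xs. approximates Xs)"

lemma approximates_Xs: "approximates Xs"
  unfolding Xs_def by (rule someI_ex[OF approximates_exists])

lemma admissible: "admissible_variation M q T (Xs k)"
  by unfold_locales (use approximates_Xs in \<open>simp add: approximates_def\<close>)

lemma L2:
  "L2_tendsto M T q Xs X" "L2_tendsto M T q (\<lambda>k. D (Xs k)) X1" "L2_tendsto M T q (\<lambda>k. D (D (Xs k))) X2"
  using approximates_Xs by (simp_all add: approximates_def)

lemma AE_lim:
  "AE_tendsto Xs X" "AE_tendsto (\<lambda>k. D (Xs k)) X1" "AE_tendsto (\<lambda>k. D (D (Xs k))) X2"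
  using approximates_Xs by (simp_all add: approximates_def)

lemmas pw = admissible_variation.pw_X[OF admissible] admissible_variation.pw_DX[OF admissible]
  admissible_variation.pw_DDX[OF admissible]

lemma square_integrable:
  "(sq X) absolutely_integrable_on {0..T}"
  "(sq X1) absolutely_integrable_on {0..T}"
  "(sq X2) absolutely_integrable_on {0..T}"
  by (rule L2_limit_integrable[OF pw(1) L2(1) AE_lim(1)] L2_limit_integrable[OF pw(2) L2(2) AE_lim(2)]
      L2_limit_integrable[OF pw(3) L2(3) AE_lim(3)])+

lemma square_integrable_on:
  "(sq X) integrable_on {0..T}"
  "(sq X1) integrable_on {0..T}"
  "(sq X2) integrable_on {0..T}"
  using square_integrable set_lebesgue_integral_eq_integral(1) by blast+

abbreviation "N0 \<equiv> integral {0..T} (sq X)"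
abbreviation "N1 \<equiv> integral {0..T} (sq X1)"
abbreviation "N2 \<equiv> integral {0..T} (sq X2)"

lemma continuous_energy: "continuous_on {0..T} (sq X)"
  using X by (intro continuous_on_metric) (simp_all add: Ck_field_def continuous_field_def)

lemma interpolation_weak: "0 < r \<Longrightarrow> N1 \<le> (r * N0 + N2 / r) / 2"
proof (rule LIMSEQ_le)
  assume r: "0 < r"
  show "(\<lambda>k. integral {0..T} (sq (D (Xs k)))) \<longlonglongrightarrow> N1"
    by (rule L2_limit_integral[OF pw(2) L2(2) AE_lim(2)]) auto
  show "(\<lambda>k. (r * integral {0..T} (sq (Xs k))
      + integral {0..T} (sq (D (D (Xs k)))) / r) / 2) \<longlonglongrightarrow> (r * N0 + N2 / r) / 2"
    using r by (intro tendsto_intros L2_limit_integral[OF pw(1) L2(1) AE_lim(1)]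
        L2_limit_integral[OF pw(3) L2(3) AE_lim(3)]) auto
  show "\<exists>N. \<forall>k\<ge>N. integral {0..T} (sq (D (Xs k))) \<le>
      (r * integral {0..T} (sq (Xs k))
      + integral {0..T} (sq (D (D (Xs k)))) / r) / 2"
    using admissible_variation.interpolation[OF admissible r] by blast
qed

text \<open>Convergence almost everywhere does not give convergence at a prescribed time, so the inequality is
  first obtained at times where the sequence converges.\<close>

lemma poincare_AE:
  assumes l: "0 \<le> l" "l < d" "d \<le> T" and lim: "(\<lambda>k. gnorm (q l) (Xs k l - X l)) \<longlonglongrightarrow> 0"
  shows "integral {l..d} (sq X)
    \<le> 2 * (d - l) * G l (X l) (X l) + 4 * (d - l)\<^sup>2 * integral {l..d} (sq X1)"
proof (rule LIMSEQ_le)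
  show "(\<lambda>k. integral {l..d} (sq (Xs k))) \<longlonglongrightarrow> integral {l..d} (sq X)"
    by (rule L2_limit_integral[OF pw(1) L2(1) AE_lim(1) l(1,3)])
  show "(\<lambda>k. 2 * (d - l) * G l (Xs k l) (Xs k l) + 4 * (d - l)\<^sup>2 * integral {l..d} (sq (D (Xs k))))
     \<longlonglongrightarrow> 2 * (d - l) * G l (X l) (X l) + 4 * (d - l)\<^sup>2 * integral {l..d} (sq X1)"
    by (intro tendsto_add tendsto_mult tendsto_const metric_tendsto lim
        L2_limit_integral[OF pw(2) L2(2) AE_lim(2) l(1,3)])
  show "\<exists>N. \<forall>k\<ge>N. integral {l..d} (sq (Xs k)) \<le>
      2 * (d - l) * G l (Xs k l) (Xs k l) + 4 * (d - l)\<^sup>2 * integral {l..d} (sq (D (Xs k)))"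
    using admissible_variation.poincare[OF admissible l] by blast
qed

text \<open>Arbitrarily close to \<open>l\<close> there are times \<open>m\<close> at which the approximating sequence converges. Since \<open>X\<close> is
  continuous and vanishes at \<open>l\<close>, the boundary term at \<open>m\<close> and the integral over \<open>[l,m]\<close> are as small as
  desired.\<close>

lemma poincare_weak:
  assumes l: "0 \<le> l" "l < d" "d \<le> T" and zero: "X l = 0"
  shows "integral {l..d} (sq X) \<le> 4 * (d - l)\<^sup>2 * integral {l..d} (sq X1)"
proof (rule field_le_epsilon)
  fix e :: real assume e: "e > 0"
  \<comment> \<open>the boundary term costs \<open>2 (d - l) e'\<close> and the initial interval \<open>(d - l) e'\<close>\<close>
  define e' where "e' = e / (3 * (d - l))"
  have e': "e' > 0" "3 * (d - l) * e' = e" using e l by (simp_all add: e'_def)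
  define \<phi> where "\<phi> t = G t (X t) (X t)" for t
  define \<psi> where "\<psi> t = G t (X1 t) (X1 t)" for t
  have \<phi>_int: "\<phi> integrable_on {a..b}" and \<psi>_int: "\<psi> integrable_on {a..b}" if "0 \<le> a" "b \<le> T" for a b
    unfolding \<phi>_def \<psi>_def
    by (rule integrable_on_subinterval[OF square_integrable_on(1)] integrable_on_subinterval[OF square_integrable_on(2)],
        use that in simp)+
  have \<phi>l: "\<phi> l = 0" using zero bilinear_lzero[OF bilinear_metric] by (simp add: \<phi>_def)
  have "continuous (at l within {0..T}) \<phi>"
    using continuous_energy l unfolding continuous_on_eq_continuous_within \<phi>_def[abs_def] by simp
  then obtain \<delta> where \<delta>: "\<delta> > 0" "\<And>t. t \<in> {0..T} \<Longrightarrow> dist t l < \<delta> \<Longrightarrow> dist (\<phi> t) (\<phi> l) < e'"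
    using e'(1) unfolding continuous_within_eps_delta by blast
  have small: "\<phi> t \<le> e'" if "l \<le> t" "t < l + \<delta>" "t \<le> d" for t
    using \<delta>(2)[of t] that l by (simp add: dist_real_def \<phi>l)
  have "l < min (l + \<delta>) d" using \<delta>(1) l by simp
  from AE_lebesgue_dense[OF AE_lim(1)[unfolded AE_tendsto_def] this]
  obtain m where m: "l < m" "m < l + \<delta>" "m < d" "(\<lambda>k. gnorm (q m) (Xs k m - X m)) \<longlonglongrightarrow> 0"
    using l by auto
  have "integral {l..d} \<phi> = integral {l..m} \<phi> + integral {m..d} \<phi>"
    by (rule Henstock_Kurzweil_Integration.integral_combine[symmetric, OF _ _ \<phi>_int]) (use m l in auto)
  also have "integral {l..m} \<phi> \<le> integral {l..m} (\<lambda>_. e')"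
    using m l small by (intro integral_le \<phi>_int) auto
  also have "integral {l..m} (\<lambda>_. e') = (m - l) * e'" using m by simp
  also have "(m - l) * e' \<le> (d - l) * e'" using m e' by (intro mult_right_mono) auto
  also have "integral {m..d} \<phi> \<le> 2 * (d - m) * \<phi> m + 4 * (d - m)\<^sup>2 * integral {m..d} \<psi>"
    unfolding \<phi>_def \<psi>_def using poincare_AE[of m d] m l by auto
  also have "\<dots> \<le> 2 * (d - l) * e' + 4 * (d - l)\<^sup>2 * integral {l..d} \<psi>"
  proof (rule add_mono)
    show "2 * (d - m) * \<phi> m \<le> 2 * (d - l) * e'"
      using small[of m] m metric_nonneg by (intro mult_mono) (auto simp: \<phi>_def)
    have "integral {m..d} \<psi> \<le> integral {l..d} \<psi>"
      using m l by (intro integral_subset_le \<psi>_int) (auto simp: \<psi>_def metric_nonneg)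
    moreover have "0 \<le> integral {m..d} \<psi>"
      using m l by (intro integral_nonneg \<psi>_int) (auto simp: \<psi>_def metric_nonneg)
    ultimately show "4 * (d - m)\<^sup>2 * integral {m..d} \<psi> \<le> 4 * (d - l)\<^sup>2 * integral {l..d} \<psi>"
      using m by (intro mult_mono power_mono) auto
  qed
  finally have "integral {l..d} \<phi> \<le> 4 * (d - l)\<^sup>2 * integral {l..d} \<psi> + 3 * (d - l) * e'"
    by (simp add: algebra_simps)
  then show "integral {l..d} (sq X) \<le> 4 * (d - l)\<^sup>2 * integral {l..d} (sq X1) + e"
    unfolding e'(2) \<phi>_def[abs_def] \<psi>_def[abs_def] .
qed

lemma poincare_grid:
  assumes m: "0 < m" and zero: "\<And>i. i < m \<Longrightarrow> X (real i * (T / real m)) = 0"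
  shows "N0 \<le> 4 * (T / real m)\<^sup>2 * N1"
proof -
  define h where "h = T / real m"
  have h: "h > 0" using m T_pos by (simp add: h_def)
  have mh: "real m * h = T" using m by (simp add: h_def)
  have le: "real i * h \<le> T" if "i \<le> m" for i
    using that h mh mult_right_mono[of "real i" "real m" h] by simp
  have "integral {0..real i * h} (sq X) \<le> 4 * h\<^sup>2 * integral {0..real i * h} (sq X1)"
    if "i \<le> m" for i
    using that
  proof (induction i)
    case (Suc i)
    have Si: "real (Suc i) * h = real i * h + h" by (simp add: algebra_simps)
    have le': "real i * h + h \<le> T" using le[OF Suc.prems] Si by simp
    have split: "integral {0..real i * h + h} f = integral {0..real i * h} f + integral {real i * h..real i * h + h} f"
      if "f integrable_on {0..T}" for f :: "real \<Rightarrow> real"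
      by (rule Henstock_Kurzweil_Integration.integral_combine[symmetric, OF _ _ integrable_on_subinterval[OF that]])
        (use h le' in auto)
    have "integral {real i * h..real i * h + h} (sq X)
        \<le> 4 * h\<^sup>2 * integral {real i * h..real i * h + h} (sq X1)"
      using poincare_weak[OF _ _ le' zero[of i, folded h_def]] h Suc.prems by simp
    then show ?case
      using Suc unfolding Si split[OF square_integrable_on(1)] split[OF square_integrable_on(2)]
      by (simp add: algebra_simps)
  qed simp
  from this[of m, unfolded mh] show ?thesis by (simp add: h_def)
qed

text \<open>Integrability has to be established because the integral of a nonintegrable function is \<open>0\<close> by convention:
  without it the sign of the index form would carry no information.\<close>

lemma linear_density_integrable:
  assumes A: "cont_endo {0..T} q A0" "cont_endo {0..T} q A1" "cont_endo {0..T} q A2"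
    and C: "\<And>t x. t \<in> {0..T} \<Longrightarrow> gnorm (q t) (A0 t x) \<le> C * gnorm (q t) x"
      "\<And>t x. t \<in> {0..T} \<Longrightarrow> gnorm (q t) (A1 t x) \<le> C * gnorm (q t) x"
      "\<And>t x. t \<in> {0..T} \<Longrightarrow> gnorm (q t) (A2 t x) \<le> C * gnorm (q t) x"
    and "0 \<le> C"
  defines "b \<equiv> \<lambda>t. (3 / 2 * C + C\<^sup>2 / 2) * G t (X t) (X t) + (C / 2) * G t (X1 t) (X1 t) + (1 / 2) * G t (X2 t) (X2 t)"
  shows "(\<lambda>t. G t (X t) (A0 t (X t) + A1 t (X1 t) + A2 t (X2 t))) absolutely_integrable_on {0..T}" (is "?f absolutely_integrable_on _")
    and "t \<in> {0..T} \<Longrightarrow> \<bar>G t (X t) (A0 t (X t) + A1 t (X1 t) + A2 t (X2 t))\<bar> \<le> b t"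
proof -
  show bound: "\<bar>?f t\<bar> \<le> b t" if t: "t \<in> {0..T}" for t
  proof -
    let ?n = "gnorm (q t)"
    have "\<bar>?f t\<bar> \<le> ?n (X t) * ?n (A0 t (X t) + A1 t (X1 t) + A2 t (X2 t))" by (rule metric_Cauchy_Schwarz)
    also have "\<dots> \<le> ?n (X t) * (C * ?n (X t) + C * ?n (X1 t) + C * ?n (X2 t))"
      using C(1)[OF t, of "X t"] C(2)[OF t, of "X1 t"] C(3)[OF t, of "X2 t"]
        gnorm_triangle[of "q t" "A0 t (X t) + A1 t (X1 t)" "A2 t (X2 t)"]
        gnorm_triangle[of "q t" "A0 t (X t)" "A1 t (X1 t)"]
      by (intro mult_left_mono) (linarith, simp)
    also have "\<dots> = C * (?n (X t))\<^sup>2 + C * (?n (X t) * ?n (X1 t)) + (C * ?n (X t)) * ?n (X2 t)"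
      by (simp add: power2_eq_square algebra_simps)
    also have "\<dots> \<le> C * (?n (X t))\<^sup>2 + C * ((1 * (?n (X t))\<^sup>2 + (?n (X1 t))\<^sup>2 / 1) / 2) + (1 * (C * ?n (X t))\<^sup>2 + (?n (X2 t))\<^sup>2 / 1) / 2"
      using \<open>0 \<le> C\<close> by (intro add_mono mult_left_mono mult_le_half_squares order_refl) auto
    also have "\<dots> = b t"
      by (simp add: b_def gnorm_square[symmetric] power_mult_distrib algebra_simps add_divide_distrib)
    finally show ?thesis .
  qed
  show "?f absolutely_integrable_on {0..T}"
  proof (rule absolutely_integrable_AE_limit[OF _ _ _ bound])
    show "(\<lambda>t. G t (Xs k t) (A0 t (Xs k t) + A1 t (D (Xs k) t) + A2 t (D (D (Xs k)) t))) absolutely_integrable_on {0..T}" for k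
      by (rule pw_field_metric_integrable[OF pw(1) pw_field_add[OF pw_field_add[OF
          pw_field_endo[OF pw(1) A(1)] pw_field_endo[OF pw(2) A(2)]] pw_field_endo[OF pw(3) A(3)]]])
    show "b absolutely_integrable_on {0..T}"
      unfolding b_def by (intro set_integral_add(1) set_integrable_mult_right square_integrable)
    have endo: "(\<lambda>k. gnorm (q t) (A t (f k) - A t y)) \<longlonglongrightarrow> 0"
      if "(\<lambda>k. gnorm (q t) (f k - y)) \<longlonglongrightarrow> 0" "cont_endo {0..T} q A" "t \<in> {0..T}"
        "\<And>x. gnorm (q t) (A t x) \<le> C * gnorm (q t) x" for A t f y
    proof (rule Lim_null_comparison)
      show "(\<lambda>k. C * gnorm (q t) (f k - y)) \<longlonglongrightarrow> 0" using tendsto_mult_right_zero[OF that(1)] .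
      have "A t (f k) - A t y = A t (f k - y)" for k
        using that(2,3) by (intro linear_diff[symmetric]) (simp add: cont_endo_def)
      then show "\<forall>\<^sub>F k in sequentially. norm (gnorm (q t) (A t (f k) - A t y)) \<le> C * gnorm (q t) (f k - y)"
        using that(4) by simp
    qed
    have add: "(\<lambda>k. gnorm p ((u k + v k) - (x + y))) \<longlonglongrightarrow> 0"
      if "(\<lambda>k. gnorm p (u k - x)) \<longlonglongrightarrow> 0" "(\<lambda>k. gnorm p (v k - y)) \<longlonglongrightarrow> 0" for p u v x y
    proof (rule Lim_null_comparison)
      show "(\<lambda>k. gnorm p (u k - x) + gnorm p (v k - y)) \<longlonglongrightarrow> 0" using tendsto_add[OF that] by simp
      have "u k + v k - (x + y) = (u k - x) + (v k - y)" for k by simp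
      then have "norm (gnorm p (u k + v k - (x + y))) \<le> gnorm p (u k - x) + gnorm p (v k - y)" for k
        by (simp only: real_norm_def abs_of_nonneg[OF gnorm_nonneg] gnorm_triangle)
      then show "\<forall>\<^sub>F k in sequentially. norm (gnorm p (u k + v k - (x + y))) \<le> gnorm p (u k - x) + gnorm p (v k - y)"
        by (rule always_eventually[OF allI])
    qed
    show "AE t in lebesgue. t \<in> {0..T} \<longrightarrow> (\<lambda>k. G t (Xs k t) (A0 t (Xs k t) + A1 t (D (Xs k) t) + A2 t (D (D (Xs k)) t))) \<longlonglongrightarrow> ?f t"
      using AE_lim unfolding AE_tendsto_def
    proof eventually_elim
      fix t
      assume lims: "t \<in> {0..T} \<longrightarrow> (\<lambda>k. gnorm (q t) (Xs k t - X t)) \<longlonglongrightarrow> 0"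
        "t \<in> {0..T} \<longrightarrow> (\<lambda>k. gnorm (q t) (D (Xs k) t - X1 t)) \<longlonglongrightarrow> 0"
        "t \<in> {0..T} \<longrightarrow> (\<lambda>k. gnorm (q t) (D (D (Xs k)) t - X2 t)) \<longlonglongrightarrow> 0"
      show "t \<in> {0..T} \<longrightarrow> (\<lambda>k. G t (Xs k t) (A0 t (Xs k t) + A1 t (D (Xs k) t) + A2 t (D (D (Xs k)) t))) \<longlonglongrightarrow> ?f t"
      proof
        assume t: "t \<in> {0..T}"
        note lim = lims[rule_format, OF t]
        show "(\<lambda>k. G t (Xs k t) (A0 t (Xs k t) + A1 t (D (Xs k) t) + A2 t (D (D (Xs k)) t))) \<longlonglongrightarrow> ?f t"
          by (rule metric_tendsto[OF lim(1) add[OF add[OF endo[OF lim(1) A(1) t C(1)[OF t]]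
            endo[OF lim(2) A(2) t C(2)[OF t]]] endo[OF lim(3) A(3) t C(3)[OF t]]]])
      qed
    qed
  qed
qed

text \<open>On a fine enough grid the form is coercive on the fields that vanish at the nodes. With mesh
  \<open>h \<le> 1\<close> the bounds \<open>N1 \<le> 4 h\<^sup>2 N2\<close> and \<open>N0 \<le> 16 h\<^sup>2 N2\<close> turn the right-hand side of
  \<open>N2 / 2 \<le> (3 C / 2 + C\<^sup>2 / 2) N0 + (C / 2) N1\<close> into \<open>h\<^sup>2 (26 C + 8 C\<^sup>2) N2\<close>, and the premise
  on \<open>m\<close> makes this at most \<open>N2 / 4\<close>.\<close>

lemma vanishing_field:
  assumes A: "cont_endo {0..T} q A0" "cont_endo {0..T} q A1" "cont_endo {0..T} q A2"
    and C: "\<And>t x. t \<in> {0..T} \<Longrightarrow> gnorm (q t) (A0 t x) \<le> C * gnorm (q t) x"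
      "\<And>t x. t \<in> {0..T} \<Longrightarrow> gnorm (q t) (A1 t x) \<le> C * gnorm (q t) x"
      "\<And>t x. t \<in> {0..T} \<Longrightarrow> gnorm (q t) (A2 t x) \<le> C * gnorm (q t) x"
    and C0: "0 \<le> C"
    and m: "T * (1 + 4 * (26 * C + 8 * C\<^sup>2)) \<le> real m"
    and zero: "\<And>i. i < m \<Longrightarrow> X (real i * (T / real m)) = 0"
    and neg: "(LINT t:{0..T}|lebesgue. G t (X2 t) (X2 t) + G t (X t) (A0 t (X t) + A1 t (X1 t) + A2 t (X2 t))) \<le> 0"
    and t: "t \<in> {0..T}"
  shows "X t = 0"
proof -
  let ?f = "\<lambda>t. G t (X t) (A0 t (X t) + A1 t (X1 t) + A2 t (X2 t))"
  let ?b = "\<lambda>t. (3 / 2 * C + C\<^sup>2 / 2) * G t (X t) (X t) + (C / 2) * G t (X1 t) (X1 t) + (1 / 2) * G t (X2 t) (X2 t)"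
  note dens = linear_density_integrable[OF A C C0]
  have N_nonneg: "0 \<le> N0" "0 \<le> N1" "0 \<le> N2"
    by (intro integral_nonneg square_integrable_on metric_nonneg)+
  have f_int: "?f integrable_on {0..T}" using dens(1) set_lebesgue_integral_eq_integral(1) by blast
  note ci = integrable_on_mult_right[OF square_integrable_on(1)] integrable_on_mult_right[OF square_integrable_on(2)]
    integrable_on_mult_right[OF square_integrable_on(3)]
  have "(LINT t:{0..T}|lebesgue. G t (X2 t) (X2 t) + ?f t) = N2 + integral {0..T} ?f"
    using set_lebesgue_integral_eq_integral(2)[OF set_integral_add(1)[OF square_integrable(3) dens(1)]]
    by (simp add: integral_add[OF square_integrable_on(3) f_int])
  then have "N2 \<le> - integral {0..T} ?f" using neg by simp
  also have "\<dots> = integral {0..T} (\<lambda>t. - ?f t)" by simp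
  also have "\<dots> \<le> integral {0..T} ?b"
    by (rule integral_le[OF integrable_neg[OF f_int] integrable_add[OF integrable_add[OF ci(1,2)] ci(3)]])
      (rule abs_le_D2[OF dens(2)])
  also have "\<dots> = (3 / 2 * C + C\<^sup>2 / 2) * N0 + (C / 2) * N1 + (1 / 2) * N2"
    by (subst integral_add[OF integrable_add[OF ci(1,2)] ci(3)], subst integral_add[OF ci(1,2)]) simp
  finally have idx: "N2 / 2 \<le> (3 / 2 * C + C\<^sup>2 / 2) * N0 + (C / 2) * N1" by simp
  define h where "h = T / real m"
  define \<kappa> where "\<kappa> = 26 * C + 8 * C\<^sup>2"
  have \<kappa>: "0 \<le> \<kappa>" using C0 by (simp add: \<kappa>_def)
  have "0 < T * (1 + 4 * \<kappa>)" using T_pos \<kappa> by (intro mult_pos_pos) auto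
  then have m0: "0 < real m" using m by (simp add: \<kappa>_def)
  have h: "0 < h" using T_pos m0 by (simp add: h_def)
  have h1: "h * (1 + 4 * \<kappa>) \<le> 1" using m m0 by (simp add: h_def \<kappa>_def field_simps)
  have "h \<le> 1"
  proof -
    have "h * 1 \<le> h * (1 + 4 * \<kappa>)" using h \<kappa> by (intro mult_left_mono) auto
    then show ?thesis using h1 by simp
  qed
  have h2: "h\<^sup>2 * \<kappa> \<le> 1 / 4"
  proof -
    have "h\<^sup>2 * \<kappa> \<le> h * \<kappa>" using h \<open>h \<le> 1\<close> \<kappa> by (intro mult_right_mono) (simp_all add: power2_eq_square)
    moreover have "4 * (h * \<kappa>) \<le> 1" using h1 h by (simp add: algebra_simps)
    ultimately show ?thesis by simp
  qed
  have P: "N0 \<le> 4 * h\<^sup>2 * N1" using poincare_grid[OF _ zero] m0 by (simp add: h_def)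
  have N1: "N1 \<le> 4 * h\<^sup>2 * N2"
  proof -
    \<comment> \<open>this parameter turns the Poincare inequality into a bound of the first term by \<open>N1 / 2\<close>\<close>
    have "N1 \<le> (1 / (4 * h\<^sup>2) * N0 + N2 / (1 / (4 * h\<^sup>2))) / 2"
      using h by (intro interpolation_weak) simp
    moreover have "1 / (4 * h\<^sup>2) * N0 \<le> N1" using P h by (simp add: field_simps)
    ultimately show ?thesis by (simp add: mult.commute)
  qed
  have N0: "N0 \<le> 16 * h\<^sup>2 * N2"
  proof -
    have "N0 \<le> 4 * h\<^sup>2 * (4 * h\<^sup>2 * N2)" by (rule order_trans[OF P]) (intro mult_left_mono N1, simp)
    also have "\<dots> = h\<^sup>2 * (16 * h\<^sup>2 * N2)" by simp
    also have "\<dots> \<le> 1 * (16 * h\<^sup>2 * N2)"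
      using h \<open>h \<le> 1\<close> N_nonneg(3) by (intro mult_right_mono power_le_one mult_nonneg_nonneg) simp_all
    finally show ?thesis by simp
  qed
  have "N2 / 2 \<le> (3 / 2 * C + C\<^sup>2 / 2) * (16 * h\<^sup>2 * N2) + (C / 2) * (4 * h\<^sup>2 * N2)"
    by (rule order_trans[OF idx]) (intro add_mono mult_left_mono N0 N1, use C0 in auto)
  also have "\<dots> = (h\<^sup>2 * \<kappa>) * N2" by (simp add: \<kappa>_def algebra_simps)
  also have "\<dots> \<le> 1 / 4 * N2" using h2 N_nonneg by (intro mult_right_mono) auto
  finally have "N2 = 0" using N_nonneg by simp
  then have "N0 = 0" using N0 N_nonneg by simp
  then have "G t (X t) (X t) = 0"
    using integral_eq_0_iff[OF continuous_energy T_pos metric_nonneg] t by simp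
  then show ?thesis using metric_pos[of "X t" "q t"] by auto
qed

end

context smooth_arc
begin

section \<open>Finiteness of the extended index\<close>

text \<open>Point evaluations are used as functionals because they are linear in the field, whereas the weak
  derivatives that enter the form are a choice of representatives and need not depend linearly on it.\<close>

lemma extended_index_finite:
  assumes V: "smooth_function M V"
  shows "extended_index M V T q < \<infinity>"
proof -
  obtain A0 A1 A2 where A: "cont_endo {0..T} q A0" "cont_endo {0..T} q A1" "cont_endo {0..T} q A2"
    and F: "\<And>t x x1 x2. F_tensor M T q t x x1 x2 + nabla_grad M V (q t) x = A0 t x + A1 t x1 + A2 t x2"
    using F_tensor_decomposition[OF V] by blast
  obtain C0 where C0: "0 \<le> C0" and bd0: "\<And>t x. t \<in> {0..T} \<Longrightarrow> gnorm (q t) (A0 t x) \<le> C0 * gnorm (q t) x"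
    by (rule cont_endo_bounded[OF A(1)]) (rule that)
  obtain C1 where C1: "0 \<le> C1" and bd1: "\<And>t x. t \<in> {0..T} \<Longrightarrow> gnorm (q t) (A1 t x) \<le> C1 * gnorm (q t) x"
    by (rule cont_endo_bounded[OF A(2)]) (rule that)
  obtain C2 where C2: "0 \<le> C2" and bd2: "\<And>t x. t \<in> {0..T} \<Longrightarrow> gnorm (q t) (A2 t x) \<le> C2 * gnorm (q t) x"
    by (rule cont_endo_bounded[OF A(3)]) (rule that)
  define C where "C = C0 + C1 + C2"
  have C: "0 \<le> C" using C0 C1 C2 by (simp add: C_def)
  have le: "C0 \<le> C" "C1 \<le> C" "C2 \<le> C"
    using C0 C1 C2 by (simp_all add: C_def)
  have bdC: "gnorm (q t) (A0 t x) \<le> C * gnorm (q t) x" "gnorm (q t) (A1 t x) \<le> C * gnorm (q t) x"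
    "gnorm (q t) (A2 t x) \<le> C * gnorm (q t) x" if "t \<in> {0..T}" for t x
    by (rule order_trans[OF bd0[OF that] mult_right_mono[OF le(1) gnorm_nonneg]],
        rule order_trans[OF bd1[OF that] mult_right_mono[OF le(2) gnorm_nonneg]],
        rule order_trans[OF bd2[OF that] mult_right_mono[OF le(3) gnorm_nonneg]])
  obtain m :: nat where m: "T * (1 + 4 * (26 * C + 8 * C\<^sup>2)) \<le> real m"
    using real_arch_simple by blast
  define I where "I = {..<m} \<times> (Basis :: 'e set)"
  define L where "L = (\<lambda>(i, b) (X :: real \<Rightarrow> 'e). X (real i * (T / real m)) \<bullet> b)"
  have bound: "edim S \<le> enat (card I)"
    if S: "subspace S" "S \<subseteq> H2_0 M T q" "\<forall>X\<in>S. index_form M V T q X X \<le> 0" for S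
  proof (rule edim_le_card_functionals[OF _ _ S(1)])
    show "finite I" by (simp add: I_def)
    show "linear (L i)" for i
      by (cases i) (simp add: L_def linear_iff scaleR_fun_def inner_add_left)
    fix X assume XS: "X \<in> S" and L0: "\<And>i. i \<in> I \<Longrightarrow> L i X = 0"
    have XH: "continuous_field M {0..T} q X" "\<And>t. t \<notin> {0..T} \<Longrightarrow> X t = 0" "\<exists>W. has_weak_derivs M T q X W"
      using subsetD[OF S(2) XS] unfolding H2_0_def by blast+
    obtain X1 X2 where W: "weak_derivs M T q X = (X1, X2)" by (rule prod.exhaust)
    have weak: "has_weak_derivs M T q X (X1, X2)"
      unfolding W[symmetric] weak_derivs_def by (rule someI_ex[OF XH(3)])
    interpret weak_field M q T X X1 X2
      by unfold_locales (rule XH(1), rule weak)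
    have nodes: "X (real i * (T / real m)) = 0" if "i < m" for i
    proof (rule euclidean_eqI)
      fix b :: 'e assume "b \<in> Basis"
      then show "X (real i * (T / real m)) \<bullet> b = 0 \<bullet> b"
        using L0[of "(i, b)"] that by (simp add: I_def L_def)
    qed
    have "index_form M V T q X X \<le> 0" by (rule bspec[OF S(3) XS])
    then have neg: "(LINT t:{0..T}|lebesgue. G t (X2 t) (X2 t) + G t (X t) (A0 t (X t) + A1 t (X1 t) + A2 t (X2 t))) \<le> 0"
      unfolding index_form_def W Let_def prod.case F .
    show "X = 0"
    proof
      show "X t = 0 t" for t
      proof (cases "t \<in> {0..T}")
        case True
        from vanishing_field[OF A bdC C m nodes neg this] show ?thesis by simp
      next
        case False
        from XH(2)[OF this] show ?thesis by simp
      qed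
    qed
  qed
  have "extended_index M V T q \<le> enat (card I)"
    unfolding extended_index_def
  proof (rule Sup_least)
    fix x assume "x \<in> edim ` {S. subspace S \<and> S \<subseteq> H2_0 M T q \<and> (\<forall>X\<in>S. index_form M V T q X X \<le> 0)}"
    then show "x \<le> enat (card I)" using bound by blast
  qed
  also have "\<dots> < \<infinity>" by simp
  finally show ?thesis .
qed

end

theorem lemma3p9:
  fixes Q :: "('a::{t2_space,second_countable_topology}, 'e::euclidean_space) rmfd"
    and V :: "'a \<Rightarrow> real" and T :: real
    and q\<^sub>a q\<^sub>b :: 'a and v\<^sub>a v\<^sub>b :: 'e and q :: "real \<Rightarrow> 'a"
  assumes "riemannian_manifold Q" and "connected (UNIV :: 'a set)" and "geodesically_complete Q"
    and "smooth_function Q V" and "\<forall>p. 0 \<le> V p"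
    and "0 < T"
    and "q \<in> Omega Q T (q\<^sub>a, v\<^sub>a) (q\<^sub>b, v\<^sub>b)"
    and "modified_cubic Q V T q"
  shows "extended_index Q V T q < \<infinity>"
proof -
  interpret smooth_arc Q q T
    using assms(1,6,8) by unfold_locales (simp_all add: modified_cubic_def)
  show ?thesis by (rule extended_index_finite[OF assms(4)])
qed

end
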